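(* (i) For all ordered subsets $I,J$ of $\{1,\dots,n\}$ with $\#I=\#J$, $$\Delta(\xi^I_J)=\sum_{\#K=\#I}\xi^I_K\otimes\xi^K_J,\qquad \varepsilon(\xi^I_J)=\delta_{IJ}T_{-\omega(I)},$$ the sum running over all ordered subsets $K$ with $\#K=\#I$. (ii) $R(W^r)\subset W^r\widetilde\otimes\mathcal F_R(M(n))$ for $0\le r\le n$.
   Context: Setting. Fix $n\ge 1$ and $q\in\mathbb C^\times$ not a root of unity, with a fixed choice of $\log q$ and $q^z=\exp(z\log q)$. Identify $\mathfrak h^*\cong\mathbb C^n$ with unit vectors $e_i$, put $\omega(i)=e_i$, $\omega(I)=\sum_{i\in I}e_i$. $M_{\mathfrak h^*}$ is the field of meromorphic functions on $\mathfrak h^*$ (in $\underline\lambda=(\lambda_1,\dots,\lambda_n)$), $(T_\alpha f)(\lambda)=f(\lambda+\alpha)$. Put $h_0(z)=\frac{q^{-1}-q}{q^{-2z}-1}$, $g(z)=\frac{(q^{-2z}-q^{-2})(q^{-2z}-q^2)}{(q^{-2z}-1)^2}$, $h(z)=q-h_0(z)=q\frac{q^{-2z}-q^{-2}}{q^{-2z}-1}$. The $\mathfrak h$-bialgebroid $\mathcal F_R(M(n))$. It is the unital associative $\mathbb C$-algebra generated by $t_{ij}$ ($1\le i,j\le n$) and two commuting copies of $M_{\mathfrak h^*}$, written $f(\underline\lambda)=\mu_l(f)$ and $f(\underline\mu)=\mu_r(f)$, with relations $f(\underline\lambda)t_{ij}=t_{ij}f(\underline\lambda+\omega(i))$, $f(\underline\mu)t_{ij}=t_{ij}f(\underline\mu+\omega(j))$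 and, for all $a,b,c,d$, the RLL-relations $\sum_{x,y}R^{xy}_{ac}(\underline\lambda)t_{xb}t_{yd}=\sum_{x,y}R^{bd}_{xy}(\underline\mu)t_{cy}t_{ax}$. The nonzero $R$-entries are $R^{aa}_{aa}=q$; $R^{ab}_{ab}(\underline\lambda)=1$ if $a<b$ and $g(\lambda_a-\lambda_b)$ if $a>b$; $R^{ab}_{ba}(\underline\lambda)=h_0(\lambda_a-\lambda_b)$ if $a\ne b$. It is bigraded by $\mathfrak h^*$: $t_{ij}$ has bidegree $(\omega(i),\omega(j))$, and $f(\underline\lambda),f(\underline\mu)$ have bidegree $(0,0)$. For bigraded algebras $\mathcal A,\mathcal B$ with maps $\mu_l,\mu_r$ from $M_{\mathfrak h^*}$, $(\mathcal A\widetilde\otimes\mathcal B)_{\alpha\beta}=\bigoplus_\gamma\mathcal A_{\alpha\gamma}\otimes\mathcal B_{\gamma\beta}$ modulo $\mu_r(f)a\otimes b=a\otimes\mu_l(f)b$, with product $(a\otimes b)(c\otimes d)=ac\otimes bd$. $D_{\mathfrak h^*}$ is the algebra of difference operators $\sum_i f_iT_{\beta_i}$ on $M_{\mathfrak h^*}$. The comultiplication $\Delta\colon\mathcal F_R(M(n))\to\mathcal F_R(M(n))\widetilde\otimes\mathcal F_R(M(n))$ and counit $\varepsilon\colon\mathcal F_R(M(n))\to D_{\mathfrak h^*}$ are the algebra homomorphisms with $\Delta(t_{ij})=\sum_kt_{ik}\otimes t_{kj}$, $\Delta(f(\underline\lambda))=f(\underline\lambda)\otimes1$, $\Delta(f(\underline\mu))=1\otimes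 f(\underline\mu)$, $\varepsilon(t_{ij})=\delta_{ij}T_{-\omega(i)}$, $\varepsilon(f(\underline\lambda))=\varepsilon(f(\underline\mu))=f$. The elements $\xi^I_J$. $W$ is the unital associative algebra generated by $w_1,\dots,w_n$ and a copy of $M_{\mathfrak h^*}$ (elements $f(\underline\lambda)=\mu_W(f)$), with relations $w_i^2=0$, $w_jw_i=-h(\lambda_j-\lambda_i)w_iw_j$ for $i<j$, $f(\underline\lambda)w_i=w_if(\underline\lambda+\omega(i))$. For an ordered subset $I=\{i_1<\dots<i_r\}$ of $\{1,\dots,n\}$ put $w_I=w_{i_1}\cdots w_{i_r}$ ($w_\emptyset=1$), of degree $\omega(I)$; the $w_I$ form an $M_{\mathfrak h^*}$-basis of $W$, and $W^r=\mathrm{span}_{M_{\mathfrak h^*}}\{w_I:\#I=r\}$. $W\widetilde\otimes\mathcal F_R(M(n))=\bigoplus_{\alpha,\beta}W_\alpha\otimes\mathcal F_R(M(n))_{\alpha\beta}$ modulo $w\otimes\mu_l(f)a=\mu_W(f)w\otimes a$, with product $(v\otimes a)(w\otimes b)=vw\otimes ab$; $W^r\widetilde\otimes\mathcal F_R(M(n))$ is defined likewise. There is a unique unital algebra homomorphism $R\colon W\to W\widetilde\otimes\mathcal F_R(M(n))$ with $R(w_i)=\sum_jw_j\otimes t_{ji}$ and $R(\mu_W(f)w)=(1\otimes\mu_r(f))R(w)$; it is a right corepresentation, i.e. $(\mathrm{Id}\otimes\Delta)R=(R\otimes\mathrm{Id})R$ and $(\mathrm{Id}\otimes\varepsilon)R=\mathrm{Id}$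 (with $w\otimes fT_{-\alpha}\cong fw$ for $w\in W_\alpha$). The elements $\xi^I_J$ ($\#I=\#J$) are its matrix elements: $R(w_J)=\sum_{\#I=\#J}w_I\otimes\xi^I_J$, and $\xi^I_J=0$ if $\#I\ne\#J$. *)

theory Defs
  imports
    "HOL-Complex_Analysis.Complex_Analysis"
    "HOL-Library.Poly_Mapping"
    "HOL-Algebra.QuotRing"
    "HOL-Algebra.Generated_Groups"
begin

section \<open>Meromorphic functions on \<open>\<complex>\<^sup>n\<close>\<close>

text \<open>Only used for open \<open>U\<close>: complex (Frechet) differentiability at each point of \<open>U\<close>.\<close>

definition holo_on :: "(complex ^ 'n \<Rightarrow> complex) \<Rightarrow> (complex ^ 'n) set \<Rightarrow> bool" where
  "holo_on f U \<longleftrightarrow>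
     (\<forall>x\<in>U. \<exists>D. (f has_derivative D) (at x) \<and> (\<forall>c v. D (c *s v) = c * D v))"

text \<open>
  Locally a quotient \<open>g / h\<close> of holomorphic functions, where \<open>h\<close> does not vanish identically on
  any nonempty open set. The value where \<open>h = 0\<close> is unconstrained; it is removed by
  identifying functions which agree on a dense open set.
\<close>

definition meromorphic_rep :: "(complex ^ 'n \<Rightarrow> complex) \<Rightarrow> bool" where
  "meromorphic_rep f \<longleftrightarrow>
     (\<forall>p. \<exists>U g h. open U \<and> p \<in> U \<and> holo_on g U \<and> holo_on h U \<and>
        U \<subseteq> closure {x\<in>U. h x \<noteq> 0} \<and> (\<forall>x\<in>U. h x \<noteq> 0 \<longrightarrow> f x = g x / h x))"

definition mero_eq :: "(complex ^ 'n \<Rightarrow> complex) \<Rightarrow> (complex ^ 'n \<Rightarrow> complex) \<Rightarrow> bool" where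
  "mero_eq f g \<longleftrightarrow> meromorphic_rep f \<and> meromorphic_rep g \<and>
     (\<exists>D. open D \<and> closure D = UNIV \<and> (\<forall>x\<in>D. f x = g x))"

definition dense_in :: "'a::topological_space set \<Rightarrow> 'a set \<Rightarrow> bool" where
  "dense_in A U \<longleftrightarrow> (\<forall>V. open V \<longrightarrow> V \<subseteq> U \<longrightarrow> V \<noteq> {} \<longrightarrow> V \<inter> A \<noteq> {})"

lemma dense_in_iff_closure:
  assumes "open U" shows "dense_in A U \<longleftrightarrow> U \<subseteq> closure A"
proof
  assume L: "dense_in A U"
  show "U \<subseteq> closure A"
  proof
    fix x assume "x \<in> U"
    show "x \<in> closure A"
      unfolding closure_iff_nhds_not_empty
    proof (intro allI impI)
      fix B V :: "'a set" assume "V \<subseteq> B" "open V" "x \<in> V"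
      then have "open (V \<inter> U)" "V \<inter> U \<subseteq> U" "V \<inter> U \<noteq> {}" using \<open>x \<in> U\<close> assms by auto
      then have "V \<inter> U \<inter> A \<noteq> {}" using L unfolding dense_in_def by blast
      then show "A \<inter> B \<noteq> {}" using \<open>V \<subseteq> B\<close> by blast
    qed
  qed
next
  assume R: "U \<subseteq> closure A"
  show "dense_in A U"
    unfolding dense_in_def
  proof (intro allI impI)
    fix V :: "'a set" assume "open V" "V \<subseteq> U" "V \<noteq> {}"
    then obtain x where "x \<in> V" "x \<in> closure A" using R by blast
    then show "V \<inter> A \<noteq> {}"
      using \<open>open V\<close> open_Int_closure_eq_empty by fastforce
  qed
qed

lemma dense_in_UNIV: "closure A = UNIV \<longleftrightarrow> dense_in A UNIV"
  using dense_in_iff_closure[of UNIV A] by auto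

lemma dense_in_mono: "dense_in A U \<Longrightarrow> V \<subseteq> U \<Longrightarrow> A \<inter> V \<subseteq> B \<Longrightarrow> dense_in B V"
  unfolding dense_in_def by blast

lemma dense_in_Int:
  assumes "dense_in A U" "dense_in B U" "open (U \<inter> A)" shows "dense_in (A \<inter> B) U"
  unfolding dense_in_def
proof (intro allI impI)
  fix V assume V: "open V" "V \<subseteq> U" "V \<noteq> {}"
  have "V \<inter> A = V \<inter> (U \<inter> A)" using V by blast
  then have "open (V \<inter> A)" using V assms by auto
  moreover have "V \<inter> A \<noteq> {}" using V assms unfolding dense_in_def by blast
  ultimately have "V \<inter> A \<inter> B \<noteq> {}" using V assms(2) unfolding dense_in_def by blast
  then show "V \<inter> (A \<inter> B) \<noteq> {}" by blast
qed

lemma holo_on_const: "holo_on (\<lambda>_. c) U"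
  unfolding holo_on_def by (auto intro!: exI[of _ "\<lambda>_. 0"])

lemma holo_on_add: "holo_on f U \<Longrightarrow> holo_on g U \<Longrightarrow> holo_on (\<lambda>x. f x + g x) U"
  unfolding holo_on_def
proof
  fix x assume "\<forall>x\<in>U. \<exists>D. (f has_derivative D) (at x) \<and> (\<forall>c v. D (c *s v) = c * D v)"
    "\<forall>x\<in>U. \<exists>D. (g has_derivative D) (at x) \<and> (\<forall>c v. D (c *s v) = c * D v)" "x \<in> U"
  then obtain D E where "(f has_derivative D) (at x)" "\<forall>c v. D (c *s v) = c * D v"
    "(g has_derivative E) (at x)" "\<forall>c v. E (c *s v) = c * E v" by meson
  then show "\<exists>D. ((\<lambda>x. f x + g x) has_derivative D) (at x) \<and> (\<forall>c v. D (c *s v) = c * D v)"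
    by (intro exI[of _ "\<lambda>v. D v + E v"]) (auto intro: has_derivative_add simp: algebra_simps)
qed

lemma holo_on_mult: "holo_on f U \<Longrightarrow> holo_on g U \<Longrightarrow> holo_on (\<lambda>x. f x * g x) U"
  unfolding holo_on_def
proof
  fix x assume "\<forall>x\<in>U. \<exists>D. (f has_derivative D) (at x) \<and> (\<forall>c v. D (c *s v) = c * D v)"
    "\<forall>x\<in>U. \<exists>D. (g has_derivative D) (at x) \<and> (\<forall>c v. D (c *s v) = c * D v)" "x \<in> U"
  then obtain D E where *: "(f has_derivative D) (at x)" "\<forall>c v. D (c *s v) = c * D v"
    "(g has_derivative E) (at x)" "\<forall>c v. E (c *s v) = c * E v" by meson
  from has_derivative_mult[OF *(1,3)] *(2,4)
  show "\<exists>D. ((\<lambda>x. f x * g x) has_derivative D) (at x) \<and> (\<forall>c v. D (c *s v) = c * D v)"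
    by (intro exI[of _ "\<lambda>v. f x * E v + D v * g x"] conjI) (assumption, simp add: algebra_simps)
qed

lemma holo_on_subset: "holo_on f U \<Longrightarrow> V \<subseteq> U \<Longrightarrow> holo_on f V"
  unfolding holo_on_def by blast

lemma holo_on_continuous: "holo_on f U \<Longrightarrow> continuous_on U f"
  unfolding holo_on_def
  by (meson continuous_at_imp_continuous_on has_derivative_continuous)

lemma holo_on_open:
  assumes "holo_on f U" "open U" shows "open {x\<in>U. f x \<noteq> 0}"
proof -
  have "open (U \<inter> f -` (- {0}))"
    using continuous_open_preimage[OF holo_on_continuous[OF assms(1)] assms(2) open_delete[OF open_UNIV, of 0]]
    by (simp add: Compl_eq_Diff_UNIV)
  moreover have "U \<inter> f -` (- {0}) = {x\<in>U. f x \<noteq> 0}" by auto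
  ultimately show ?thesis by simp
qed

lemma holo_on_identity:
  assumes g: "holo_on g (ball p e)" and V: "open V" "V \<noteq> {}" "V \<subseteq> ball p e"
    and zero: "\<And>x. x \<in> V \<Longrightarrow> g x = 0" and y: "y \<in> ball p e"
  shows "g y = 0"
proof -
  obtain x where x: "x \<in> V" using V by blast
  define L where "L = (\<lambda>z::complex. x + z *s (y - x))"
  have Lder: "(L has_derivative (\<lambda>w. w *s (y - x))) (at z)" for z
  proof -
    have "bounded_linear (\<lambda>w::complex. w *s (y - x))"
      by (auto intro!: linear_conv_bounded_linear[THEN iffD1] linearI
          simp: vec_eq_iff algebra_simps)
    from bounded_linear_imp_has_derivative[OF this]
    have "((\<lambda>w::complex. w *s (y - x)) has_derivative (\<lambda>w. w *s (y - x))) (at z)" .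
    from has_derivative_add[OF has_derivative_const[of x] this] show ?thesis
      by (simp add: L_def)
  qed
  have Lcont: "continuous_on A L" for A
    using Lder by (meson continuous_at_imp_continuous_on has_derivative_continuous)
  define S where "S = L -` ball p e"
  have S: "open S" unfolding S_def using Lcont open_vimage by blast
  have T: "open (L -` V)" using Lcont open_vimage V by blast
  have "convex S"
  proof (rule convexI)
    fix a b u v assume *: "a \<in> S" "b \<in> S" "0 \<le> (u::real)" "0 \<le> v" "u + v = 1"
    have "L (u *\<^sub>R a + v *\<^sub>R b) = u *\<^sub>R L a + v *\<^sub>R L b"
    proof -
      have "x = (u + v) *\<^sub>R x" using * by simp
      then have "x = u *\<^sub>R x + v *\<^sub>R x" by (simp only: scaleR_add_left)
      then have "L (u *\<^sub>R a + v *\<^sub>R b) = u *\<^sub>R x + v *\<^sub>R x + (u *\<^sub>R a + v *\<^sub>R b) *s (y - x)"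
        unfolding L_def by simp
      also have "\<dots> = u *\<^sub>R L a + v *\<^sub>R L b"
        unfolding L_def by (simp add: vec_eq_iff algebra_simps)
      finally show ?thesis .
    qed
    moreover have "u *\<^sub>R L a + v *\<^sub>R L b \<in> ball p e"
      using * convex_ball[of p e] unfolding S_def convex_def by auto
    ultimately show "u *\<^sub>R a + v *\<^sub>R b \<in> S" by (simp add: S_def)
  qed
  have hol: "(g \<circ> L) holomorphic_on S"
    unfolding holomorphic_on_open[OF S]
  proof
    fix z assume "z \<in> S"
    then obtain D where D: "(g has_derivative D) (at (L z))" "\<forall>c v. D (c *s v) = c * D v"
      using bspec[OF g[unfolded holo_on_def], of "L z"] \<open>z \<in> S\<close> unfolding S_def by blast
    from diff_chain_at[OF Lder D(1)]
    have "(g \<circ> L has_derivative (\<lambda>w. w * D (y - x))) (at z)"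
      by (simp only: o_def D(2)[rule_format])
    moreover have "(\<lambda>w. w * D (y - x)) = (*) (D (y - x))" by (rule ext) (rule mult.commute)
    ultimately have "(g \<circ> L has_field_derivative D (y - x)) (at z)"
      unfolding has_field_derivative_def by simp
    then show "\<exists>f'. (g \<circ> L has_field_derivative f') (at z)" ..
  qed
  have L0: "L 0 = x" and L1: "L 1 = y" by (simp_all add: L_def)
  have "(g \<circ> L) 1 = 0"
  proof (rule analytic_continuation[OF hol S, of "L -` V" 0])
    show "connected S" using \<open>convex S\<close> convex_connected by blast
    show "L -` V \<subseteq> S" using V by (auto simp: S_def)
    show "0 \<in> S" using V x L0 by (auto simp: S_def)
    show "0 islimpt L -` V"
      using T x L0 by (intro interior_limit_point) (simp add: interior_open)
    show "1 \<in> S" using y L1 by (auto simp: S_def)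
  qed (use zero in auto)
  then show ?thesis using L1 by simp
qed

lemma meromorphic_repE:
  assumes "meromorphic_rep f"
  obtains e g h where "e > 0" "holo_on g (ball p e)" "holo_on h (ball p e)"
    "dense_in {x\<in>ball p e. h x \<noteq> 0} (ball p e)" "\<And>x. x \<in> ball p e \<Longrightarrow> h x \<noteq> 0 \<Longrightarrow> f x = g x / h x"
proof -
  from assms[unfolded meromorphic_rep_def, THEN spec, of p]
  obtain U g h where *: "open U" "p \<in> U" "holo_on g U" "holo_on h U"
    "U \<subseteq> closure {x\<in>U. h x \<noteq> 0}" "\<forall>x\<in>U. h x \<noteq> 0 \<longrightarrow> f x = g x / h x"
    by (elim exE conjE)
  obtain e where e: "e > 0" "ball p e \<subseteq> U"
    using *(1,2) by (elim openE)
  have "dense_in {x\<in>U. h x \<noteq> 0} U" using *(1,5) by (simp add: dense_in_iff_closure)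
  then have "dense_in {x\<in>ball p e. h x \<noteq> 0} (ball p e)"
    using e(2) by (elim dense_in_mono) auto
  moreover have "f x = g x / h x" if "x \<in> ball p e" "h x \<noteq> 0" for x
    using that e(2) *(6) by blast
  ultimately show ?thesis
    using that e *(3,4) holo_on_subset by blast
qed

lemma meromorphic_repI:
  assumes "\<And>p. \<exists>U g h. open U \<and> p \<in> U \<and> holo_on g U \<and> holo_on h U \<and>
        dense_in {x\<in>U. h x \<noteq> 0} U \<and> (\<forall>x\<in>U. h x \<noteq> 0 \<longrightarrow> f x = g x / h x)"
  shows "meromorphic_rep f"
  unfolding meromorphic_rep_def
proof
  fix p
  from assms[of p] obtain U g h where *: "open U" "p \<in> U" "holo_on g U" "holo_on h U"
    "dense_in {x\<in>U. h x \<noteq> 0} U" "\<forall>x\<in>U. h x \<noteq> 0 \<longrightarrow> f x = g x / h x"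
    by (elim exE conjE)
  then show "\<exists>U g h. open U \<and> p \<in> U \<and> holo_on g U \<and> holo_on h U \<and>
        U \<subseteq> closure {x\<in>U. h x \<noteq> 0} \<and> (\<forall>x\<in>U. h x \<noteq> 0 \<longrightarrow> f x = g x / h x)"
    by (intro exI[of _ U] exI[of _ g] exI[of _ h]) (simp add: dense_in_iff_closure)
qed

lemma meromorphic_rep_holo: "holo_on f UNIV \<Longrightarrow> meromorphic_rep f"
  by (rule meromorphic_repI, rule exI[of _ UNIV], rule exI[of _ f], rule exI[of _ "\<lambda>_. 1"])
     (auto simp: holo_on_const dense_in_def)

lemma meromorphic_rep_arith:
  assumes "meromorphic_rep f" "meromorphic_rep g"
  shows "meromorphic_rep (\<lambda>x. f x + g x)" "meromorphic_rep (\<lambda>x. f x * g x)"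
proof -
  have "\<exists>U G H K. open U \<and> p \<in> U \<and> holo_on G U \<and> holo_on H U \<and> holo_on K U \<and>
        dense_in {x\<in>U. H x \<noteq> 0} U \<and> (\<forall>x\<in>U. H x \<noteq> 0 \<longrightarrow> f x + g x = G x / H x) \<and>
        (\<forall>x\<in>U. H x \<noteq> 0 \<longrightarrow> f x * g x = K x / H x)" for p
  proof -
    obtain e a b where 1: "e > 0" "holo_on a (ball p e)" "holo_on b (ball p e)"
      "dense_in {x\<in>ball p e. b x \<noteq> 0} (ball p e)" "\<And>x. x \<in> ball p e \<Longrightarrow> b x \<noteq> 0 \<Longrightarrow> f x = a x / b x"
      by (rule meromorphic_repE[OF assms(1), of p]) (assumption | blast)+
    obtain d c k where 2: "d > 0" "holo_on c (ball p d)" "holo_on k (ball p d)"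
      "dense_in {x\<in>ball p d. k x \<noteq> 0} (ball p d)" "\<And>x. x \<in> ball p d \<Longrightarrow> k x \<noteq> 0 \<Longrightarrow> g x = c x / k x"
      by (rule meromorphic_repE[OF assms(2), of p]) (assumption | blast)+
    define U where "U = ball p (min e d)"
    have U: "open U" "p \<in> U" "U \<subseteq> ball p e" "U \<subseteq> ball p d" using 1(1) 2(1) by (auto simp: U_def)
    have h: "holo_on a U" "holo_on b U" "holo_on c U" "holo_on k U"
      using 1 2 U holo_on_subset by metis+
    have "dense_in ({x\<in>U. b x \<noteq> 0} \<inter> {x\<in>U. k x \<noteq> 0}) U"
    proof (rule dense_in_Int)
      show "dense_in {x\<in>U. b x \<noteq> 0} U" using 1(4) U(3) by (elim dense_in_mono) auto
      show "dense_in {x\<in>U. k x \<noteq> 0} U" using 2(4) U(4) by (elim dense_in_mono) auto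
      show "open (U \<inter> {x\<in>U. b x \<noteq> 0})" using holo_on_open[OF h(2) U(1)] U(1) by auto
    qed
    moreover have "{x\<in>U. b x \<noteq> 0} \<inter> {x\<in>U. k x \<noteq> 0} = {x\<in>U. b x * k x \<noteq> 0}" by auto
    ultimately have "dense_in {x\<in>U. b x * k x \<noteq> 0} U" by simp
    moreover have "f x + g x = (a x * k x + c x * b x) / (b x * k x)"
      "f x * g x = (a x * c x) / (b x * k x)" if "x \<in> U" "b x * k x \<noteq> 0" for x
    proof -
      have "f x = a x / b x" "g x = c x / k x" using that 1(5) 2(5) U by auto
      then show "f x + g x = (a x * k x + c x * b x) / (b x * k x)"
        "f x * g x = (a x * c x) / (b x * k x)" using that by (auto simp: field_simps)
    qed
    ultimately show ?thesis using h U(1,2)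
      by (intro exI[of _ U] exI[of _ "\<lambda>x. a x * k x + c x * b x"] exI[of _ "\<lambda>x. b x * k x"]
            exI[of _ "\<lambda>x. a x * c x"]) (auto intro!: holo_on_add holo_on_mult)
  qed
  then show "meromorphic_rep (\<lambda>x. f x + g x)" "meromorphic_rep (\<lambda>x. f x * g x)"
    by (auto intro!: meromorphic_repI) meson+
qed

lemma meromorphic_rep_const: "meromorphic_rep (\<lambda>_. c)"
  by (intro meromorphic_rep_holo holo_on_const)

lemma meromorphic_rep_uminus: "meromorphic_rep f \<Longrightarrow> meromorphic_rep (\<lambda>x. - f x)"
  using meromorphic_rep_arith(2)[OF meromorphic_rep_const[of "-1"], of f] by simp

lemma meromorphic_rep_dichotomy:
  assumes "holo_on g (ball p e)"
  shows "(\<forall>x\<in>ball p e. g x = 0) \<or> dense_in {x\<in>ball p e. g x \<noteq> 0} (ball p e)"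
  using holo_on_identity[OF assms] unfolding dense_in_def by blast

lemma quotient_repr_inverse:
  assumes "e > 0" "holo_on g (ball p e)" "holo_on h (ball p e)"
    "dense_in {x\<in>ball p e. h x \<noteq> 0} (ball p e)" "dense_in {x\<in>ball p e. g x \<noteq> 0} (ball p e)"
  shows "dense_in {x\<in>ball p e. g x * h x \<noteq> 0} (ball p e)"
proof -
  have "dense_in ({x\<in>ball p e. g x \<noteq> 0} \<inter> {x\<in>ball p e. h x \<noteq> 0}) (ball p e)"
    using assms holo_on_open[OF assms(2)] by (intro dense_in_Int) auto
  moreover have "{x\<in>ball p e. g x \<noteq> 0} \<inter> {x\<in>ball p e. h x \<noteq> 0} = {x\<in>ball p e. g x * h x \<noteq> 0}"
    by auto
  ultimately show ?thesis by simp
qed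

lemma meromorphic_rep_inverse:
  assumes "meromorphic_rep f" shows "meromorphic_rep (\<lambda>x. inverse (f x))"
proof (rule meromorphic_repI)
  fix p
  obtain e g h where *: "e > 0" "holo_on g (ball p e)" "holo_on h (ball p e)"
    "dense_in {x\<in>ball p e. h x \<noteq> 0} (ball p e)" "\<And>x. x \<in> ball p e \<Longrightarrow> h x \<noteq> 0 \<Longrightarrow> f x = g x / h x"
    by (rule meromorphic_repE[OF assms, of p]) (assumption | blast)+
  from meromorphic_rep_dichotomy[OF *(2)]
  show "\<exists>U g h. open U \<and> p \<in> U \<and> holo_on g U \<and> holo_on h U \<and>
        dense_in {x\<in>U. h x \<noteq> 0} U \<and> (\<forall>x\<in>U. h x \<noteq> 0 \<longrightarrow> inverse (f x) = g x / h x)"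
  proof
    assume "\<forall>x\<in>ball p e. g x = 0"
    then show ?thesis using *
      by (intro exI[of _ "ball p e"] exI[of _ g] exI[of _ h]) auto
  next
    assume "dense_in {x\<in>ball p e. g x \<noteq> 0} (ball p e)"
    note 1 = quotient_repr_inverse[OF *(1-4) this]
    have "inverse (f x) = (h x * h x) / (g x * h x)" if "x \<in> ball p e" "g x * h x \<noteq> 0" for x
    proof -
      have "h x \<noteq> 0" using that(2) by simp
      then show ?thesis using *(5)[OF that(1)] by simp
    qed
    then have 2: "\<forall>x\<in>ball p e. g x * h x \<noteq> 0 \<longrightarrow> inverse (f x) = (h x * h x) / (g x * h x)"
      by blast
    show ?thesis
      using 1 2 *(1) holo_on_mult[OF *(3,3)] holo_on_mult[OF *(2,3)]
      by (intro exI[of _ "ball p e"] exI[of _ "\<lambda>x. h x * h x"] exI[of _ "\<lambda>x. g x * h x"] conjI)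
         (assumption | simp)+
  qed
qed

lemma meromorphic_rep_zero_or_unit:
  assumes f: "meromorphic_rep (f :: complex ^ 'n \<Rightarrow> complex)"
  shows "mero_eq f (\<lambda>_. 0) \<or> mero_eq (\<lambda>x. f x * inverse (f x)) (\<lambda>_. 1)"
proof -
  define N where "N = {p. \<exists>e>0. \<exists>D. open D \<and> dense_in D (ball p e) \<and> (\<forall>x\<in>D. f x = 0)}"
  have smaller: "\<exists>e'>0. ball y e' \<subseteq> ball p e" if "y \<in> ball p e" for y p :: "complex ^ 'n" and e
    using that open_contains_ball by blast
  have "open N"
    unfolding open_contains_ball
  proof
    fix p assume "p \<in> N"
    then obtain e D where *: "e > 0" "open D" "dense_in D (ball p e)" "\<forall>x\<in>D. f x = 0"
      unfolding N_def by blast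
    have "ball p e \<subseteq> N"
    proof
      fix y assume "y \<in> ball p e"
      then obtain e' where "e' > 0" "ball y e' \<subseteq> ball p e" using smaller by blast
      moreover have "dense_in D (ball y e')" using *(3) calculation(2) by (elim dense_in_mono) auto
      ultimately show "y \<in> N" using * unfolding N_def by blast
    qed
    then show "\<exists>e>0. ball p e \<subseteq> N" using * by blast
  qed
  have out: "\<exists>e>0. (\<exists>D. open D \<and> dense_in D (ball p e) \<and> (\<forall>x\<in>D. f x \<noteq> 0))"
    if "p \<notin> N" for p
  proof -
    obtain e g h where *: "e > 0" "holo_on g (ball p e)" "holo_on h (ball p e)"
      "dense_in {x\<in>ball p e. h x \<noteq> 0} (ball p e)" "\<And>x. x \<in> ball p e \<Longrightarrow> h x \<noteq> 0 \<Longrightarrow> f x = g x / h x"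
      by (rule meromorphic_repE[OF f, of p]) (assumption | blast)+
    have o: "open {x\<in>ball p e. h x \<noteq> 0}" using holo_on_open[OF *(3)] by simp
    have "\<not> (\<forall>x\<in>ball p e. g x = 0)"
    proof
      assume "\<forall>x\<in>ball p e. g x = 0"
      then have "\<forall>x\<in>{x\<in>ball p e. h x \<noteq> 0}. f x = 0" using *(5) by auto
      then show False using that *(1,4) o unfolding N_def by blast
    qed
    then have "dense_in {x\<in>ball p e. g x \<noteq> 0} (ball p e)"
      using meromorphic_rep_dichotomy[OF *(2)] by blast
    from quotient_repr_inverse[OF *(1-4) this]
    have "dense_in {x\<in>ball p e. g x * h x \<noteq> 0} (ball p e)" .
    moreover have "open {x\<in>ball p e. g x * h x \<noteq> 0}"
      using holo_on_open[OF holo_on_mult[OF *(2,3)]] by simp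
    moreover have "\<forall>x\<in>{x\<in>ball p e. g x * h x \<noteq> 0}. f x \<noteq> 0" using *(5) by auto
    ultimately show ?thesis using *(1) by blast
  qed
  have "open (- N)"
    unfolding open_contains_ball
  proof
    fix p assume "p \<in> - N"
    then obtain e D where *: "e > 0" "open D" "dense_in D (ball p e)" "\<forall>x\<in>D. f x \<noteq> 0"
      using out by blast
    have "ball p e \<subseteq> - N"
    proof
      fix y assume y: "y \<in> ball p e"
      show "y \<in> - N"
      proof
        assume "y \<in> N"
        then obtain d C where c: "d > 0" "open C" "dense_in C (ball y d)" "\<forall>x\<in>C. f x = 0"
          unfolding N_def by blast
        have "ball y d \<inter> ball p e \<inter> D \<noteq> {}"
          using y c(1) *(3) unfolding dense_in_def
          by (metis Int_iff Int_lower2 centre_in_ball empty_iff open_Int open_ball)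
        then have "ball y d \<inter> ball p e \<inter> D \<inter> C \<noteq> {}"
          using c(3) *(2) unfolding dense_in_def
          by (meson Int_lower1 le_infI1 open_Int open_ball)
        then show False using * c by blast
      qed
    qed
    then show "\<exists>e>0. ball p e \<subseteq> - N" using * by blast
  qed
  then have "N = {} \<or> N = UNIV"
    using \<open>open N\<close> clopen[of N] by (simp add: closed_def)
  then have "\<exists>P\<in>{\<lambda>x. f x = 0, \<lambda>x. f x \<noteq> 0}.
      \<forall>p. \<exists>e>0. \<exists>D. open D \<and> dense_in D (ball p e) \<and> (\<forall>x\<in>D. P x)"
  proof
    assume "N = {}"
    then show ?thesis using out by (intro bexI[of _ "\<lambda>x. f x \<noteq> 0"]) blast+
  next
    assume "N = UNIV"
    then have "\<forall>p. p \<in> N" by blast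
    then show ?thesis unfolding N_def mem_Collect_eq
      by (intro bexI[of _ "\<lambda>x. f x = 0"]) blast+
  qed
  then obtain P where P: "P \<in> {\<lambda>x. f x = 0, \<lambda>x. f x \<noteq> 0}"
    "\<And>p. \<exists>e>0. \<exists>D. open D \<and> dense_in D (ball p e) \<and> (\<forall>x\<in>D. P x)" by blast
  define E where "E = \<Union>{D. open D \<and> (\<forall>x\<in>D. P x)}"
  have E: "open E" "\<forall>x\<in>E. P x" unfolding E_def by auto
  have "dense_in E UNIV"
    unfolding dense_in_def
  proof (intro allI impI)
    fix V :: "(complex ^ 'n) set" assume V: "open V" "V \<noteq> {}"
    then obtain p where "p \<in> V" by blast
    obtain e D where *: "e > 0" "open D" "dense_in D (ball p e)" "\<forall>x\<in>D. P x" using P by blast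
    have "open (V \<inter> ball p e)" "V \<inter> ball p e \<subseteq> ball p e" "V \<inter> ball p e \<noteq> {}"
      using V *(1) \<open>p \<in> V\<close> by (auto intro: exI[of _ p])
    then have "V \<inter> ball p e \<inter> D \<noteq> {}" using *(3) unfolding dense_in_def by blast
    then show "V \<inter> E \<noteq> {}" using * unfolding E_def by blast
  qed
  then have "closure E = UNIV" by (simp add: dense_in_UNIV)
  with E P(1) f show ?thesis
    unfolding mero_eq_def
    by (auto intro!: meromorphic_rep_arith meromorphic_rep_inverse meromorphic_rep_const)
qed

lemma mero_eq_refl: "meromorphic_rep f \<Longrightarrow> mero_eq f f"
  unfolding mero_eq_def by (metis closure_UNIV open_UNIV)

lemma mero_eq_open_dense_Int:
  assumes "open D" "closure D = UNIV" "open E" "closure E = UNIV"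
  shows "open (D \<inter> E)" "closure (D \<inter> E) = UNIV"
  using assms dense_in_Int[of D UNIV E] by (auto simp: dense_in_UNIV)

lemma mero_eqI2:
  assumes "mero_eq f f'" "mero_eq g g'"
    "meromorphic_rep (\<lambda>x. F (f x) (g x))" "meromorphic_rep (\<lambda>x. F (f' x) (g' x))"
  shows "mero_eq (\<lambda>x. F (f x) (g x)) (\<lambda>x. F (f' x) (g' x))"
proof -
  obtain D E where "open D" "closure D = UNIV" "\<forall>x\<in>D. f x = f' x"
    "open E" "closure E = UNIV" "\<forall>x\<in>E. g x = g' x"
    using assms(1,2) unfolding mero_eq_def by blast
  with mero_eq_open_dense_Int[of D E] assms(3,4) show ?thesis
    unfolding mero_eq_def by (intro conjI exI[of _ "D \<inter> E"]) auto
qed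

lemma mero_eqI1:
  assumes "mero_eq f f'"
    "meromorphic_rep (\<lambda>x. F (f x))" "meromorphic_rep (\<lambda>x. F (f' x))"
  shows "mero_eq (\<lambda>x. F (f x)) (\<lambda>x. F (f' x))"
  using mero_eqI2[OF assms(1,1), of "\<lambda>a b. F a"] assms(2,3) by simp

quotient_type 'n mero = "complex ^ 'n \<Rightarrow> complex" / partial: mero_eq
proof (rule part_equivpI)
  show "\<exists>f. mero_eq f f" using mero_eq_refl meromorphic_rep_const by blast
  show "symp mero_eq" unfolding symp_def mero_eq_def by metis
  show "transp mero_eq"
    unfolding transp_def
  proof (intro allI impI)
    fix f g h :: "complex ^ 'a \<Rightarrow> complex" assume *: "mero_eq f g" "mero_eq g h"
    then obtain D E where "open D" "closure D = UNIV" "\<forall>x\<in>D. f x = g x"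
      "open E" "closure E = UNIV" "\<forall>x\<in>E. g x = h x"
      unfolding mero_eq_def by blast
    with mero_eq_open_dense_Int[of D E] * show "mero_eq f h"
      unfolding mero_eq_def by (intro conjI exI[of _ "D \<inter> E"]) auto
  qed
qed

lemma mero_eq_rep: "mero_eq f g \<Longrightarrow> meromorphic_rep f" "mero_eq f g \<Longrightarrow> meromorphic_rep g"
  unfolding mero_eq_def by auto

instantiation mero :: (finite) field
begin


lift_definition zero_mero :: "'a mero" is "\<lambda>_. 0"
  by (intro mero_eq_refl meromorphic_rep_const)

lift_definition one_mero :: "'a mero" is "\<lambda>_. 1"
  by (intro mero_eq_refl meromorphic_rep_const)

lift_definition plus_mero :: "'a mero \<Rightarrow> 'a mero \<Rightarrow> 'a mero" is "\<lambda>f g x. f x + g x"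
  by (rule mero_eqI2) (auto intro: meromorphic_rep_arith mero_eq_rep)

lift_definition times_mero :: "'a mero \<Rightarrow> 'a mero \<Rightarrow> 'a mero" is "\<lambda>f g x. f x * g x"
  by (rule mero_eqI2) (auto intro: meromorphic_rep_arith mero_eq_rep)

lift_definition uminus_mero :: "'a mero \<Rightarrow> 'a mero" is "\<lambda>f x. - f x"
  by (rule mero_eqI1) (auto intro: meromorphic_rep_uminus mero_eq_rep)

lift_definition inverse_mero :: "'a mero \<Rightarrow> 'a mero" is "\<lambda>f x. inverse (f x)"
  by (rule mero_eqI1)
     (auto intro: meromorphic_rep_inverse mero_eq_rep)

definition minus_mero :: "'a mero \<Rightarrow> 'a mero \<Rightarrow> 'a mero" where
  "minus_mero f g = f + - g"

definition divide_mero :: "'a mero \<Rightarrow> 'a mero \<Rightarrow> 'a mero" where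
  "divide_mero f g = f * inverse g"

instance
proof
  have eq: "mero_eq f g" if "meromorphic_rep f" "f = g" for f g :: "complex ^ 'a \<Rightarrow> complex"
    using that mero_eq_refl by auto
  note I = meromorphic_rep_arith
  fix a b c :: "'a mero"
  show "a * b * c = a * (b * c)"
    by transfer (rule eq, (rule I | erule mero_eq_rep)+, simp add: fun_eq_iff algebra_simps)
  show "a * b = b * a"
    by transfer (rule eq, (rule I | erule mero_eq_rep)+, simp add: fun_eq_iff algebra_simps)
  show "1 * a = a"
    by transfer simp
  show "a + b + c = a + (b + c)"
    by transfer (rule eq, (rule I | erule mero_eq_rep)+, simp add: fun_eq_iff algebra_simps)
  show "a + b = b + a"
    by transfer (rule eq, (rule I | erule mero_eq_rep)+, simp add: fun_eq_iff algebra_simps)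
  show "0 + a = a"
    by transfer simp
  show "- a + a = 0"
    by transfer (simp add: mero_eq_refl meromorphic_rep_const)
  show "a - b = a + - b"
    by (simp add: minus_mero_def)
  show "(a + b) * c = a * c + b * c"
    by transfer (rule eq, (rule I | erule mero_eq_rep)+, simp add: fun_eq_iff algebra_simps)
  show "(0 :: 'a mero) \<noteq> 1"
    by transfer (auto simp: mero_eq_def)
  show "a \<noteq> 0 \<Longrightarrow> inverse a * a = 1"
  proof transfer
    fix a :: "complex ^ 'a \<Rightarrow> complex"
    assume a: "mero_eq a a" "\<not> mero_eq a (\<lambda>_. 0)"
    then show "mero_eq (\<lambda>x. inverse (a x) * a x) (\<lambda>_. 1)"
      using meromorphic_rep_zero_or_unit[OF mero_eq_rep(1)[OF a(1)]] by (simp add: mult.commute)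
  qed
  show "a div b = a * inverse b"
    by (simp add: divide_mero_def)
  show "inverse (0 :: 'a mero) = 0"
    by transfer (simp add: mero_eq_refl meromorphic_rep_const)
qed

end

lift_definition mconst :: "complex \<Rightarrow> 'n::finite mero" is "\<lambda>c _. c"
  by (intro mero_eq_refl meromorphic_rep_const)

lemma holo_on_shift:
  assumes "holo_on g U" shows "holo_on (\<lambda>x. g (x + a)) ((\<lambda>x. x + a) -` U)"
  unfolding holo_on_def
proof
  fix x assume "x \<in> (\<lambda>x. x + a) -` U"
  then obtain D where D: "(g has_derivative D) (at (x + a))" "\<forall>c v. D (c *s v) = c * D v"
    using assms unfolding holo_on_def by auto
  have "((\<lambda>x. x + a) has_derivative (\<lambda>v. v)) (at x)" by (auto intro!: derivative_eq_intros)
  from diff_chain_at[OF this D(1)] D(2)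
  show "\<exists>D. ((\<lambda>x. g (x + a)) has_derivative D) (at x) \<and> (\<forall>c v. D (c *s v) = c * D v)"
    by (auto simp: o_def)
qed

lemma dense_in_shift:
  fixes a :: "'a::real_normed_vector"
  assumes "dense_in A U" shows "dense_in ((\<lambda>x. x + a) -` A) ((\<lambda>x. x + a) -` U)"
  unfolding dense_in_def
proof (intro allI impI)
  fix V assume V: "open V" "V \<subseteq> (\<lambda>x. x + a) -` U" "V \<noteq> {}"
  have "open ((\<lambda>x. x + a) ` V)" using open_translation[OF V(1), of a] by (simp add: add.commute)
  moreover have "(\<lambda>x. x + a) ` V \<subseteq> U" "(\<lambda>x. x + a) ` V \<noteq> {}" using V by auto
  ultimately have "(\<lambda>x. x + a) ` V \<inter> A \<noteq> {}" using assms unfolding dense_in_def by blast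
  then show "V \<inter> (\<lambda>x. x + a) -` A \<noteq> {}" by auto
qed

lemma open_shift: "open U \<Longrightarrow> open ((\<lambda>x::'a::real_normed_vector. x + a) -` U)"
  by (rule open_vimage) (auto intro!: continuous_intros)

lemma meromorphic_rep_shift:
  assumes "meromorphic_rep f" shows "meromorphic_rep (\<lambda>x. f (x + a))"
proof (rule meromorphic_repI)
  fix p
  obtain e g h where *: "e > 0" "holo_on g (ball (p + a) e)" "holo_on h (ball (p + a) e)"
    "dense_in {x\<in>ball (p + a) e. h x \<noteq> 0} (ball (p + a) e)"
    "\<And>x. x \<in> ball (p + a) e \<Longrightarrow> h x \<noteq> 0 \<Longrightarrow> f x = g x / h x"
    by (rule meromorphic_repE[OF assms, of "p + a"]) (assumption | blast)+
  let ?U = "(\<lambda>x. x + a) -` ball (p + a) e"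
  have "dense_in {x\<in>?U. h (x + a) \<noteq> 0} ?U"
    using dense_in_shift[OF *(4), of a] by (simp add: vimage_def)
  moreover have "\<forall>x\<in>?U. h (x + a) \<noteq> 0 \<longrightarrow> f (x + a) = g (x + a) / h (x + a)"
    using *(5) by blast
  moreover have "p \<in> ?U" using *(1) by simp
  ultimately show "\<exists>U g h. open U \<and> p \<in> U \<and> holo_on g U \<and> holo_on h U \<and>
        dense_in {x\<in>U. h x \<noteq> 0} U \<and> (\<forall>x\<in>U. h x \<noteq> 0 \<longrightarrow> f (x + a) = g x / h x)"
    using open_shift[OF open_ball] holo_on_shift[OF *(2)] holo_on_shift[OF *(3)]
    by (intro exI[of _ ?U] exI[of _ "\<lambda>x. g (x + a)"] exI[of _ "\<lambda>x. h (x + a)"] conjI)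
qed

lift_definition mshift :: "complex ^ 'n \<Rightarrow> 'n::finite mero \<Rightarrow> 'n mero" is "\<lambda>a f x. f (x + a)"
proof -
  fix a and f g :: "complex ^ 'n \<Rightarrow> complex" assume "mero_eq f g"
  then obtain D where D: "meromorphic_rep f" "meromorphic_rep g"
    "open D" "closure D = UNIV" "\<forall>x\<in>D. f x = g x"
    unfolding mero_eq_def by blast
  then have "open ((\<lambda>x. x + a) -` D)" "closure ((\<lambda>x. x + a) -` D) = UNIV"
    using open_shift[of D a] dense_in_shift[of D UNIV a] by (auto simp: dense_in_UNIV)
  with D show "mero_eq (\<lambda>x. f (x + a)) (\<lambda>x. g (x + a))"
    unfolding mero_eq_def
    by (intro conjI exI[of _ "(\<lambda>x. x + a) -` D"]) (simp_all add: meromorphic_rep_shift)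
qed

section \<open>Algebras by generators and relations\<close>

text \<open>
  The monoid algebra \<open>\<complex>[G]\<close>. For the free monoid on a set of generators this is the free unital
  associative \<open>\<complex>\<close>-algebra.
\<close>

definition monoid_algebra :: "('g, 'm) monoid_scheme \<Rightarrow> ('g \<Rightarrow>\<^sub>0 complex) ring" where
  "monoid_algebra G =
     \<lparr>carrier = {p. Poly_Mapping.keys p \<subseteq> carrier G},
      monoid.mult = (\<lambda>p r. \<Sum>x\<in>Poly_Mapping.keys p. \<Sum>y\<in>Poly_Mapping.keys r.
        Poly_Mapping.single (x \<otimes>\<^bsub>G\<^esub> y) (Poly_Mapping.lookup p x * Poly_Mapping.lookup r y)),
      one = Poly_Mapping.single \<one>\<^bsub>G\<^esub> 1,
      zero = 0,
      add = (+)\<rparr>"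

lemma monoid_algebra_mult_superset:
  assumes "finite A" "Poly_Mapping.keys p \<subseteq> A" "finite B" "Poly_Mapping.keys r \<subseteq> B"
  shows "p \<otimes>\<^bsub>monoid_algebra G\<^esub> r = (\<Sum>x\<in>A. \<Sum>y\<in>B.
    Poly_Mapping.single (x \<otimes>\<^bsub>G\<^esub> y) (Poly_Mapping.lookup p x * Poly_Mapping.lookup r y))"
proof -
  have "(\<Sum>y\<in>Poly_Mapping.keys r.
      Poly_Mapping.single (x \<otimes>\<^bsub>G\<^esub> y) (Poly_Mapping.lookup p x * Poly_Mapping.lookup r y)) =
    (\<Sum>y\<in>B. Poly_Mapping.single (x \<otimes>\<^bsub>G\<^esub> y) (Poly_Mapping.lookup p x * Poly_Mapping.lookup r y))"
    for x
    using assms by (intro sum.mono_neutral_left) (auto simp: in_keys_iff)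
  then show ?thesis
    unfolding monoid_algebra_def using assms
    by simp (intro sum.mono_neutral_left, auto simp: in_keys_iff)
qed

lemma monoid_algebra_distrib:
  "(p + p') \<otimes>\<^bsub>monoid_algebra G\<^esub> r = p \<otimes>\<^bsub>monoid_algebra G\<^esub> r + p' \<otimes>\<^bsub>monoid_algebra G\<^esub> r"
  "p \<otimes>\<^bsub>monoid_algebra G\<^esub> (r + r') = p \<otimes>\<^bsub>monoid_algebra G\<^esub> r + p \<otimes>\<^bsub>monoid_algebra G\<^esub> r'"
proof -
  let ?A = "Poly_Mapping.keys p \<union> Poly_Mapping.keys p'"
  let ?B = "Poly_Mapping.keys r \<union> Poly_Mapping.keys r'"
  note S = monoid_algebra_mult_superset
  have "(p + p') \<otimes>\<^bsub>monoid_algebra G\<^esub> r = (\<Sum>x\<in>?A. \<Sum>y\<in>Poly_Mapping.keys r. Poly_Mapping.single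
      (x \<otimes>\<^bsub>G\<^esub> y) (Poly_Mapping.lookup (p + p') x * Poly_Mapping.lookup r y))"
    by (rule S) (auto dest: subsetD[OF Poly_Mapping.keys_add])
  also have "\<dots> = p \<otimes>\<^bsub>monoid_algebra G\<^esub> r + p' \<otimes>\<^bsub>monoid_algebra G\<^esub> r"
    by (subst (1 2) S[of ?A _ "Poly_Mapping.keys r"])
       (auto simp: lookup_add distrib_right single_add sum.distrib)
  finally show "(p + p') \<otimes>\<^bsub>monoid_algebra G\<^esub> r =
    p \<otimes>\<^bsub>monoid_algebra G\<^esub> r + p' \<otimes>\<^bsub>monoid_algebra G\<^esub> r" .
  have "p \<otimes>\<^bsub>monoid_algebra G\<^esub> (r + r') = (\<Sum>x\<in>Poly_Mapping.keys p. \<Sum>y\<in>?B. Poly_Mapping.single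
      (x \<otimes>\<^bsub>G\<^esub> y) (Poly_Mapping.lookup p x * Poly_Mapping.lookup (r + r') y))"
    by (rule S) (auto dest: subsetD[OF Poly_Mapping.keys_add])
  also have "\<dots> = p \<otimes>\<^bsub>monoid_algebra G\<^esub> r + p \<otimes>\<^bsub>monoid_algebra G\<^esub> r'"
    by (subst (1 2) S[of "Poly_Mapping.keys p" _ ?B])
       (auto simp: lookup_add distrib_left single_add sum.distrib)
  finally show "p \<otimes>\<^bsub>monoid_algebra G\<^esub> (r + r') =
    p \<otimes>\<^bsub>monoid_algebra G\<^esub> r + p \<otimes>\<^bsub>monoid_algebra G\<^esub> r'" .
qed

lemma monoid_algebra_mult_zero:
  "0 \<otimes>\<^bsub>monoid_algebra G\<^esub> r = 0" "p \<otimes>\<^bsub>monoid_algebra G\<^esub> 0 = 0"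
  by (auto simp: monoid_algebra_def)

lemma monoid_algebra_mult_sum:
  "(\<Sum>i\<in>A. f i) \<otimes>\<^bsub>monoid_algebra G\<^esub> r = (\<Sum>i\<in>A. f i \<otimes>\<^bsub>monoid_algebra G\<^esub> r)"
  "p \<otimes>\<^bsub>monoid_algebra G\<^esub> (\<Sum>i\<in>A. f i) = (\<Sum>i\<in>A. p \<otimes>\<^bsub>monoid_algebra G\<^esub> f i)"
  by (induction A rule: infinite_finite_induct)
     (simp_all add: monoid_algebra_mult_zero monoid_algebra_distrib)

lemma monoid_algebra_mult_single:
  "Poly_Mapping.single x a \<otimes>\<^bsub>monoid_algebra G\<^esub> Poly_Mapping.single y b =
    Poly_Mapping.single (x \<otimes>\<^bsub>G\<^esub> y) (a * b)"
  by (subst monoid_algebra_mult_superset[of "{x}" _ "{y}"]) (auto simp: keys_single)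

lemma poly_mapping_sum_single:
  "(\<Sum>x\<in>Poly_Mapping.keys p. Poly_Mapping.single x (Poly_Mapping.lookup p x)) = p"
proof (rule poly_mapping_eqI)
  fix k
  have "(\<Sum>x\<in>Poly_Mapping.keys p. Poly_Mapping.lookup p x when x = k) = Poly_Mapping.lookup p k"
    by (cases "k \<in> Poly_Mapping.keys p")
       (auto simp: when_def sum.delta' in_keys_iff sum.delta)
  then show "Poly_Mapping.lookup (\<Sum>x\<in>Poly_Mapping.keys p.
      Poly_Mapping.single x (Poly_Mapping.lookup p x)) k = Poly_Mapping.lookup p k"
    by (simp add: lookup_sum lookup_single)
qed

lemma monoid_algebra_ring:
  assumes "monoid G" shows "ring (monoid_algebra G)"
proof (rule ringI)
  interpret monoid G by fact
  have C: "carrier (monoid_algebra G) = {p. Poly_Mapping.keys p \<subseteq> carrier G}"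
    "\<one>\<^bsub>monoid_algebra G\<^esub> = Poly_Mapping.single \<one>\<^bsub>G\<^esub> 1" "\<zero>\<^bsub>monoid_algebra G\<^esub> = 0"
    "\<And>p r. p \<oplus>\<^bsub>monoid_algebra G\<^esub> r = p + r"
    by (simp_all add: monoid_algebra_def)
  show "abelian_group (monoid_algebra G)"
  proof (rule abelian_groupI)
    fix x y assume xy: "x \<in> carrier (monoid_algebra G)" "y \<in> carrier (monoid_algebra G)"
    then show "x \<oplus>\<^bsub>monoid_algebra G\<^esub> y \<in> carrier (monoid_algebra G)"
      using Poly_Mapping.keys_add[of x y] by (auto simp: C)
    show "\<exists>y\<in>carrier (monoid_algebra G). y \<oplus>\<^bsub>monoid_algebra G\<^esub> x = \<zero>\<^bsub>monoid_algebra G\<^esub>"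
      using xy by (intro bexI[of _ "- x"]) (auto simp: C)
  qed (auto simp: C algebra_simps)
  show "Group.monoid (monoid_algebra G)"
  proof (rule monoidI)
    fix p r s assume p: "p \<in> carrier (monoid_algebra G)" and r: "r \<in> carrier (monoid_algebra G)"
    have "Poly_Mapping.keys (p \<otimes>\<^bsub>monoid_algebra G\<^esub> r) \<subseteq>
        (\<Union>x\<in>Poly_Mapping.keys p. \<Union>y\<in>Poly_Mapping.keys r. {x \<otimes>\<^bsub>G\<^esub> y})"
      unfolding monoid_algebra_def
      by simp (intro order.trans[OF keys_sum] UN_mono order.refl, auto)
    then show "p \<otimes>\<^bsub>monoid_algebra G\<^esub> r \<in> carrier (monoid_algebra G)"
      using p r by (auto simp: C)
    assume s: "s \<in> carrier (monoid_algebra G)"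
    let ?S = "\<lambda>p x. Poly_Mapping.single x (Poly_Mapping.lookup p x)"
    have "p \<otimes>\<^bsub>monoid_algebra G\<^esub> r \<otimes>\<^bsub>monoid_algebra G\<^esub> s =
       (\<Sum>x\<in>Poly_Mapping.keys p. ?S p x) \<otimes>\<^bsub>monoid_algebra G\<^esub> (\<Sum>y\<in>Poly_Mapping.keys r. ?S r y)
         \<otimes>\<^bsub>monoid_algebra G\<^esub> (\<Sum>z\<in>Poly_Mapping.keys s. ?S s z)"
      by (simp only: poly_mapping_sum_single)
    also have "\<dots> = (\<Sum>x\<in>Poly_Mapping.keys p. ?S p x) \<otimes>\<^bsub>monoid_algebra G\<^esub>
        ((\<Sum>y\<in>Poly_Mapping.keys r. ?S r y) \<otimes>\<^bsub>monoid_algebra G\<^esub> (\<Sum>z\<in>Poly_Mapping.keys s. ?S s z))"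
    proof -
      have "x \<in> carrier G" if "x \<in> Poly_Mapping.keys p" for x using p that by (auto simp: C)
      moreover have "x \<in> carrier G" if "x \<in> Poly_Mapping.keys r" for x using r that by (auto simp: C)
      moreover have "x \<in> carrier G" if "x \<in> Poly_Mapping.keys s" for x using s that by (auto simp: C)
      ultimately show ?thesis
        unfolding monoid_algebra_mult_sum
        by (intro sum.cong refl) (simp add: monoid_algebra_mult_single m_assoc mult.assoc)
    qed
    also have "\<dots> = p \<otimes>\<^bsub>monoid_algebra G\<^esub> (r \<otimes>\<^bsub>monoid_algebra G\<^esub> s)"
      by (simp only: poly_mapping_sum_single)
    finally show "p \<otimes>\<^bsub>monoid_algebra G\<^esub> r \<otimes>\<^bsub>monoid_algebra G\<^esub> s =
      p \<otimes>\<^bsub>monoid_algebra G\<^esub> (r \<otimes>\<^bsub>monoid_algebra G\<^esub> s)" .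
  next
    show "\<one>\<^bsub>monoid_algebra G\<^esub> \<in> carrier (monoid_algebra G)"
      by (auto simp: C keys_single)
  next
    fix p assume p: "p \<in> carrier (monoid_algebra G)"
    have *: "x \<in> carrier G" if "x \<in> Poly_Mapping.keys p" for x using p that by (auto simp: C)
    have "\<one>\<^bsub>monoid_algebra G\<^esub> \<otimes>\<^bsub>monoid_algebra G\<^esub>
      (\<Sum>x\<in>Poly_Mapping.keys p. Poly_Mapping.single x (Poly_Mapping.lookup p x)) =
      (\<Sum>x\<in>Poly_Mapping.keys p. Poly_Mapping.single x (Poly_Mapping.lookup p x))"
      unfolding monoid_algebra_mult_sum C(2)
      using * by (intro sum.cong refl) (simp add: monoid_algebra_mult_single)
    then show "\<one>\<^bsub>monoid_algebra G\<^esub> \<otimes>\<^bsub>monoid_algebra G\<^esub> p = p"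
      by (simp only: poly_mapping_sum_single)
    have "(\<Sum>x\<in>Poly_Mapping.keys p. Poly_Mapping.single x (Poly_Mapping.lookup p x))
      \<otimes>\<^bsub>monoid_algebra G\<^esub> \<one>\<^bsub>monoid_algebra G\<^esub> =
      (\<Sum>x\<in>Poly_Mapping.keys p. Poly_Mapping.single x (Poly_Mapping.lookup p x))"
      unfolding monoid_algebra_mult_sum C(2)
      using * by (intro sum.cong refl) (simp add: monoid_algebra_mult_single)
    then show "p \<otimes>\<^bsub>monoid_algebra G\<^esub> \<one>\<^bsub>monoid_algebra G\<^esub> = p"
      by (simp only: poly_mapping_sum_single)
  qed
qed (simp_all add: monoid_algebra_distrib[simplified] monoid_algebra_def[THEN arg_cong[of _ _ add]])

definition free_monoid :: "'g list monoid" where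
  "free_monoid = \<lparr>carrier = UNIV, monoid.mult = (@), one = []\<rparr>"

abbreviation mon :: "'g list \<Rightarrow> 'g list \<Rightarrow>\<^sub>0 complex" where
  "mon xs \<equiv> Poly_Mapping.single xs 1"

definition presented_ideal :: "('g list \<Rightarrow>\<^sub>0 complex) set \<Rightarrow> ('g list \<Rightarrow>\<^sub>0 complex) set" where
  "presented_ideal rels = Idl\<^bsub>monoid_algebra free_monoid\<^esub> rels"

definition presented :: "('g list \<Rightarrow>\<^sub>0 complex) set \<Rightarrow> ('g list \<Rightarrow>\<^sub>0 complex) set ring" where
  "presented rels = monoid_algebra free_monoid Quot presented_ideal rels"

definition pclass :: "('g list \<Rightarrow>\<^sub>0 complex) set \<Rightarrow> ('g list \<Rightarrow>\<^sub>0 complex) \<Rightarrow> ('g list \<Rightarrow>\<^sub>0 complex) set" where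
  "pclass rels p = presented_ideal rels +>\<^bsub>monoid_algebra free_monoid\<^esub> p"

text \<open>The component of degree \<open>d\<close>, where \<open>deg\<close> gives the degrees of the generators.\<close>

definition graded ::
  "('g \<Rightarrow> 'd::comm_monoid_add) \<Rightarrow> ('g list \<Rightarrow>\<^sub>0 complex) set \<Rightarrow> 'd \<Rightarrow> ('g list \<Rightarrow>\<^sub>0 complex) set set" where
  "graded deg rels d =
     pclass rels ` {p. \<forall>u\<in>Poly_Mapping.keys p. sum_list (map deg u) = d}"

section \<open>The tensor products \<open>\<otimes>~\<close>\<close>

text \<open>
  \<open>A\<close> is graded by \<open>gA \<alpha> \<gamma>\<close> with right moment map \<open>rA\<close>, and \<open>B\<close> by \<open>gB \<gamma> \<beta>\<close> with left moment
  map \<open>lB\<close>; the index types of \<open>\<alpha>\<close> and \<open>\<beta>\<close> are left open, so that \<open>A\<close> may carry a single grading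
  (index type \<^typ>\<open>unit\<close>). The complex vector space \<open>\<Oplus> A\<^bsub>\<alpha>\<gamma>\<^esub> \<otimes> B\<^bsub>\<gamma>\<beta>\<^esub>\<close> is spanned by the symbols
  \<open>a \<otimes> b\<close> with \<open>(a, b)\<close> in \<open>tensor_pairs\<close>. These are multiplied componentwise, so this span is
  the monoid algebra of \<open>tensor_pairs\<close>. The relations are closed, up to linear combinations, under
  multiplication by symbols, hence dividing by the ideal they generate is the same as dividing
  by their span. Scalars act on \<open>A\<close> and \<open>B\<close> through the constant functions.
\<close>

definition tensor_pairs :: "('i \<Rightarrow> 'h \<Rightarrow> 'a set) \<Rightarrow> ('h \<Rightarrow> 'j \<Rightarrow> 'b set) \<Rightarrow> ('a \<times> 'b) set" where
  "tensor_pairs gA gB = {(a, b). \<exists>\<alpha> \<gamma> \<beta>. a \<in> gA \<alpha> \<gamma> \<and> b \<in> gB \<gamma> \<beta>}"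

definition tensor_free ::
  "('a, 'x) ring_scheme \<Rightarrow> ('i \<Rightarrow> 'h \<Rightarrow> 'a set) \<Rightarrow> ('b, 'y) ring_scheme \<Rightarrow> ('h \<Rightarrow> 'j \<Rightarrow> 'b set) \<Rightarrow>
   ('a \<times> 'b \<Rightarrow>\<^sub>0 complex) ring" where
  "tensor_free A gA B gB = monoid_algebra ((A \<times>\<times> B)\<lparr>carrier := tensor_pairs gA gB\<rparr>)"

inductive_set tensor_rels ::
  "('a, 'x) ring_scheme \<Rightarrow> ('i \<Rightarrow> 'h \<Rightarrow> 'a set) \<Rightarrow> ('n::finite mero \<Rightarrow> 'a) \<Rightarrow>
   ('b, 'y) ring_scheme \<Rightarrow> ('h \<Rightarrow> 'j \<Rightarrow> 'b set) \<Rightarrow> ('n mero \<Rightarrow> 'b) \<Rightarrow> ('a \<times> 'b \<Rightarrow>\<^sub>0 complex) set"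
  for A gA rA B gB lB where
  add_left: "\<lbrakk>a \<in> gA \<alpha> \<gamma>; a' \<in> gA \<alpha> \<gamma>; b \<in> gB \<gamma> \<beta>\<rbrakk> \<Longrightarrow>
    Poly_Mapping.single (a \<oplus>\<^bsub>A\<^esub> a', b) 1 - Poly_Mapping.single (a, b) 1 - Poly_Mapping.single (a', b) 1
      \<in> tensor_rels A gA rA B gB lB"
| add_right: "\<lbrakk>a \<in> gA \<alpha> \<gamma>; b \<in> gB \<gamma> \<beta>; b' \<in> gB \<gamma> \<beta>\<rbrakk> \<Longrightarrow>
    Poly_Mapping.single (a, b \<oplus>\<^bsub>B\<^esub> b') 1 - Poly_Mapping.single (a, b) 1 - Poly_Mapping.single (a, b') 1
      \<in> tensor_rels A gA rA B gB lB"
| scalar: "\<lbrakk>a \<in> gA \<alpha> \<gamma>; b \<in> gB \<gamma> \<beta>\<rbrakk> \<Longrightarrow>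
    Poly_Mapping.single (rA (mconst c) \<otimes>\<^bsub>A\<^esub> a, b) 1 - Poly_Mapping.single (a, b) c
      \<in> tensor_rels A gA rA B gB lB"
| balance: "\<lbrakk>a \<in> gA \<alpha> \<gamma>; b \<in> gB \<gamma> \<beta>\<rbrakk> \<Longrightarrow>
    Poly_Mapping.single (rA f \<otimes>\<^bsub>A\<^esub> a, b) 1 - Poly_Mapping.single (a, lB f \<otimes>\<^bsub>B\<^esub> b) 1
      \<in> tensor_rels A gA rA B gB lB"

definition tensor_ideal where
  "tensor_ideal A gA rA B gB lB = Idl\<^bsub>tensor_free A gA B gB\<^esub> (tensor_rels A gA rA B gB lB)"

definition tensor where
  "tensor A gA rA B gB lB = tensor_free A gA B gB Quot tensor_ideal A gA rA B gB lB"

text \<open>Meaningful only for \<open>(a, b)\<close> in \<open>tensor_pairs gA gB\<close>.\<close>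

definition pure_tensor where
  "pure_tensor A gA rA B gB lB a b =
     tensor_ideal A gA rA B gB lB +>\<^bsub>tensor_free A gA B gB\<^esub> Poly_Mapping.single (a, b) 1"

section \<open>The \<open>\<hh>\<close>-bialgebroid \<open>\<F>\<^sub>R(M(n))\<close>\<close>

text \<open>
  The index set \<open>{1,\<dots>,n}\<close> is a finite linearly ordered type \<^typ>\<open>'n\<close>, and \<open>\<hh>\<^sup>* = \<complex>\<^sup>n\<close> is
  \<open>complex ^ 'n\<close>. The parameter \<open>l\<close> is the chosen logarithm of \<open>q\<close>.
\<close>

definition wt :: "'n \<Rightarrow> complex ^ 'n::finite" where
  "wt i = axis i 1"

definition wts :: "'n set \<Rightarrow> complex ^ 'n::finite" where
  "wts I = (\<Sum>i\<in>I. wt i)"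

definition qpow :: "complex \<Rightarrow> complex \<Rightarrow> complex" where
  "qpow l z = exp (z * l)"

text \<open>The function \<open>q\<close> to the power \<open>-2(\<lambda>\<^sub>a - \<lambda>\<^sub>b)\<close>.\<close>

lift_definition Qab :: "complex \<Rightarrow> 'n \<Rightarrow> 'n \<Rightarrow> 'n::finite mero"
  is "\<lambda>l a b x. qpow l (- 2 * (vec_nth x a - vec_nth x b))"
proof (intro mero_eq_refl meromorphic_rep_holo)
  fix l :: complex and a b :: 'n
  define c where "c = - 2 * l"
  have "holo_on (\<lambda>x. exp (c * (vec_nth x a - vec_nth x b))) UNIV"
    unfolding holo_on_def
  proof
    fix x :: "complex ^ 'n"
    have 1: "((\<lambda>x. c * (vec_nth x a - vec_nth x b)) has_derivative
        (\<lambda>v. c * (vec_nth v a - vec_nth v b))) (at x)"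
      by (intro has_derivative_mult_right has_derivative_diff bounded_linear_imp_has_derivative
          bounded_linear_vec_nth)
    have 2: "(exp has_derivative (\<lambda>v. exp (c * (vec_nth x a - vec_nth x b)) * v))
        (at (c * (vec_nth x a - vec_nth x b)))"
      using DERIV_exp[unfolded has_field_derivative_def] by blast
    show "\<exists>D. ((\<lambda>x. exp (c * (vec_nth x a - vec_nth x b))) has_derivative D) (at x) \<and>
        (\<forall>k v. D (k *s v) = k * D v)"
      by (rule exI, rule conjI, rule has_derivative_compose[OF 1 2])
         (simp add: algebra_simps)
  qed
  then show "holo_on (\<lambda>x. qpow l (- 2 * (vec_nth x a - vec_nth x b))) UNIV"
    by (simp add: c_def qpow_def algebra_simps)
qed

text \<open>\<open>h0_at l a b\<close>, \<open>g_at l a b\<close>, \<open>h_at l a b\<close> are \<open>h\<^sub>0\<close>, \<open>g\<close>, \<open>h\<close> at \<open>\<lambda>\<^sub>a - \<lambda>\<^sub>b\<close>, for \<open>a \<noteq> b\<close>.\<close>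

definition h0_at :: "complex \<Rightarrow> 'n \<Rightarrow> 'n \<Rightarrow> 'n::finite mero" where
  "h0_at l a b = mconst (qpow l (-1) - qpow l 1) / (Qab l a b - 1)"

definition g_at :: "complex \<Rightarrow> 'n \<Rightarrow> 'n \<Rightarrow> 'n::finite mero" where
  "g_at l a b =
     (Qab l a b - mconst (qpow l (-2))) * (Qab l a b - mconst (qpow l 2)) / (Qab l a b - 1)^2"

definition h_at :: "complex \<Rightarrow> 'n \<Rightarrow> 'n \<Rightarrow> 'n::finite mero" where
  "h_at l a b = mconst (qpow l 1) - h0_at l a b"

text \<open>\<open>Rmat l x y a c\<close> is the entry with upper indices \<open>x y\<close> and lower indices \<open>a c\<close>.\<close>

definition Rmat :: "complex \<Rightarrow> 'n \<Rightarrow> 'n \<Rightarrow> 'n \<Rightarrow> 'n \<Rightarrow> 'n::{finite,linorder} mero" where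
  "Rmat l x y a c =
     (if x = y \<and> a = x \<and> c = x then mconst (qpow l 1)
      else if x < y \<and> a = x \<and> c = y then 1
      else if x > y \<and> a = x \<and> c = y then g_at l x y
      else if x \<noteq> y \<and> a = y \<and> c = x then h0_at l x y
      else 0)"

datatype 'n F_gen = Tgen 'n 'n | LamFn "'n mero" | MuFn "'n mero"

text \<open>The first three rules for each of \<open>LamFn\<close> and \<open>MuFn\<close> say that it is a homomorphism of unital
  \<open>\<complex>\<close>-algebras from the field of meromorphic functions.\<close>

inductive_set F_rels :: "complex \<Rightarrow> ('n::{finite,linorder} F_gen list \<Rightarrow>\<^sub>0 complex) set" for l where
  "mon [LamFn (f + g)] - mon [LamFn f] - mon [LamFn g] \<in> F_rels l"
| "mon [LamFn (f * g)] - mon [LamFn f, LamFn g] \<in> F_rels l"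
| "mon [LamFn (mconst c)] - Poly_Mapping.single [] c \<in> F_rels l"
| "mon [MuFn (f + g)] - mon [MuFn f] - mon [MuFn g] \<in> F_rels l"
| "mon [MuFn (f * g)] - mon [MuFn f, MuFn g] \<in> F_rels l"
| "mon [MuFn (mconst c)] - Poly_Mapping.single [] c \<in> F_rels l"
| "mon [LamFn f, MuFn g] - mon [MuFn g, LamFn f] \<in> F_rels l"
| "mon [LamFn f, Tgen i j] - mon [Tgen i j, LamFn (mshift (wt i) f)] \<in> F_rels l"
| "mon [MuFn f, Tgen i j] - mon [Tgen i j, MuFn (mshift (wt j) f)] \<in> F_rels l"
| RLL: "(\<Sum>x\<in>UNIV. \<Sum>y\<in>UNIV. mon [LamFn (Rmat l x y a c), Tgen x b, Tgen y d])
    - (\<Sum>x\<in>UNIV. \<Sum>y\<in>UNIV. mon [MuFn (Rmat l b d x y), Tgen c y, Tgen a x]) \<in> F_rels l"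

type_synonym 'n F = "('n F_gen list \<Rightarrow>\<^sub>0 complex) set"

definition F_alg :: "complex \<Rightarrow> 'n::{finite,linorder} F ring" where
  "F_alg l = presented (F_rels l)"

definition t_el :: "complex \<Rightarrow> 'n \<Rightarrow> 'n \<Rightarrow> 'n::{finite,linorder} F" where
  "t_el l i j = pclass (F_rels l) (mon [Tgen i j])"

definition mu_l :: "complex \<Rightarrow> 'n mero \<Rightarrow> 'n::{finite,linorder} F" where
  "mu_l l f = pclass (F_rels l) (mon [LamFn f])"

definition mu_r :: "complex \<Rightarrow> 'n mero \<Rightarrow> 'n::{finite,linorder} F" where
  "mu_r l f = pclass (F_rels l) (mon [MuFn f])"

fun F_gen_deg :: "'n F_gen \<Rightarrow> (complex ^ 'n::finite) \<times> (complex ^ 'n)" where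
  "F_gen_deg (Tgen i j) = (wt i, wt j)"
| "F_gen_deg (LamFn f) = 0"
| "F_gen_deg (MuFn f) = 0"

definition F_deg :: "complex \<Rightarrow> complex ^ 'n::{finite,linorder} \<Rightarrow> complex ^ 'n::{finite,linorder} \<Rightarrow>
    'n::{finite,linorder} F set" where
  "F_deg l \<alpha> \<beta> = graded F_gen_deg (F_rels l) (\<alpha>, \<beta>)"

definition FF :: "complex \<Rightarrow> ('n F \<times> 'n::{finite,linorder} F \<Rightarrow>\<^sub>0 complex) set ring" where
  "FF l = tensor (F_alg l) (F_deg l) (mu_r l) (F_alg l) (F_deg l) (mu_l l)"

definition tensor_FF :: "complex \<Rightarrow> 'n F \<Rightarrow> 'n F \<Rightarrow> ('n F \<times> 'n::{finite,linorder} F \<Rightarrow>\<^sub>0 complex) set" where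
  "tensor_FF l = pure_tensor (F_alg l) (F_deg l) (mu_r l) (F_alg l) (F_deg l) (mu_l l)"

definition D_alg :: "('n::finite mero \<Rightarrow> 'n mero) ring" where
  "D_alg =
     \<lparr>carrier = {D. \<exists>S f. finite S \<and> D = (\<lambda>u. \<Sum>\<beta>\<in>S. f \<beta> * mshift \<beta> u)},
      monoid.mult = (\<circ>), one = id, zero = (\<lambda>_. 0), add = (\<lambda>D E u. D u + E u)\<rparr>"

text \<open>
  \<open>\<complex>\<close>-linearity of the homomorphisms below follows from their values on the constant functions.
\<close>

definition is_comultiplication ::
  "complex \<Rightarrow> ('n F \<Rightarrow> ('n F \<times> 'n::{finite,linorder} F \<Rightarrow>\<^sub>0 complex) set) \<Rightarrow> bool" where
  "is_comultiplication l \<Delta> \<longleftrightarrow>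
     \<Delta> \<in> ring_hom (F_alg l) (FF l) \<and>
     (\<forall>i j. \<Delta> (t_el l i j) = (\<Oplus>\<^bsub>FF l\<^esub>k\<in>UNIV. tensor_FF l (t_el l i k) (t_el l k j))) \<and>
     (\<forall>f. \<Delta> (mu_l l f) = tensor_FF l (mu_l l f) \<one>\<^bsub>F_alg l\<^esub>) \<and>
     (\<forall>f. \<Delta> (mu_r l f) = tensor_FF l \<one>\<^bsub>F_alg l\<^esub> (mu_r l f))"

definition is_counit :: "complex \<Rightarrow> ('n F \<Rightarrow> 'n mero \<Rightarrow> 'n::{finite,linorder} mero) \<Rightarrow> bool" where
  "is_counit l \<epsilon> \<longleftrightarrow>
     \<epsilon> \<in> ring_hom (F_alg l) D_alg \<and>
     (\<forall>i j. \<epsilon> (t_el l i j) = (if i = j then mshift (- wt i) else \<zero>\<^bsub>D_alg\<^esub>)) \<and>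
     (\<forall>f. \<epsilon> (mu_l l f) = (*) f) \<and>
     (\<forall>f. \<epsilon> (mu_r l f) = (*) f)"

section \<open>The algebra \<open>W\<close> and the elements \<open>\<xi>\<close>\<close>

datatype 'n W_gen = Wgen 'n | WFn "'n mero"

inductive_set W_rels :: "complex \<Rightarrow> ('n::{finite,linorder} W_gen list \<Rightarrow>\<^sub>0 complex) set" for l where
  "mon [WFn (f + g)] - mon [WFn f] - mon [WFn g] \<in> W_rels l"
| "mon [WFn (f * g)] - mon [WFn f, WFn g] \<in> W_rels l"
| "mon [WFn (mconst c)] - Poly_Mapping.single [] c \<in> W_rels l"
| "mon [Wgen i, Wgen i] \<in> W_rels l"
| "i < j \<Longrightarrow> mon [Wgen j, Wgen i] + mon [WFn (h_at l j i), Wgen i, Wgen j] \<in> W_rels l"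
| "mon [WFn f, Wgen i] - mon [Wgen i, WFn (mshift (wt i) f)] \<in> W_rels l"

type_synonym 'n W = "('n W_gen list \<Rightarrow>\<^sub>0 complex) set"

definition W_alg :: "complex \<Rightarrow> 'n::{finite,linorder} W ring" where
  "W_alg l = presented (W_rels l)"

definition w_el :: "complex \<Rightarrow> 'n \<Rightarrow> 'n::{finite,linorder} W" where
  "w_el l i = pclass (W_rels l) (mon [Wgen i])"

definition mu_W :: "complex \<Rightarrow> 'n mero \<Rightarrow> 'n::{finite,linorder} W" where
  "mu_W l f = pclass (W_rels l) (mon [WFn f])"

fun W_gen_deg :: "'n W_gen \<Rightarrow> complex ^ 'n::finite" where
  "W_gen_deg (Wgen i) = wt i"
| "W_gen_deg (WFn f) = 0"

definition W_deg :: "complex \<Rightarrow> unit \<Rightarrow> complex ^ 'n::{finite,linorder} \<Rightarrow> 'n W set" where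
  "W_deg l _ \<alpha> = graded W_gen_deg (W_rels l) \<alpha>"

definition WF :: "complex \<Rightarrow> ('n W \<times> 'n::{finite,linorder} F \<Rightarrow>\<^sub>0 complex) set ring" where
  "WF l = tensor (W_alg l) (W_deg l) (mu_W l) (F_alg l) (F_deg l) (mu_l l)"

definition tensor_WF :: "complex \<Rightarrow> 'n W \<Rightarrow> 'n F \<Rightarrow> ('n W \<times> 'n::{finite,linorder} F \<Rightarrow>\<^sub>0 complex) set" where
  "tensor_WF l = pure_tensor (W_alg l) (W_deg l) (mu_W l) (F_alg l) (F_deg l) (mu_l l)"

text \<open>Ordered subsets are sets of indices, listed increasingly by \<^const>\<open>sorted_list_of_set\<close>.\<close>

definition w_set :: "complex \<Rightarrow> 'n set \<Rightarrow> 'n::{finite,linorder} W" where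
  "w_set l I = foldr (\<lambda>i v. w_el l i \<otimes>\<^bsub>W_alg l\<^esub> v) (sorted_list_of_set I) \<one>\<^bsub>W_alg l\<^esub>"

definition W_sub :: "complex \<Rightarrow> nat \<Rightarrow> 'n::{finite,linorder} W set" where
  "W_sub l r = range (\<lambda>c. \<Oplus>\<^bsub>W_alg l\<^esub>I\<in>{I. card I = r}. mu_W l (c I) \<otimes>\<^bsub>W_alg l\<^esub> w_set l I)"

text \<open>\<open>W\<^sup>r \<otimes>~ F\<close>, as the subspace of \<open>W \<otimes>~ F\<close> spanned by its pure tensors.\<close>

definition WF_sub :: "complex \<Rightarrow> nat \<Rightarrow> ('n W \<times> 'n::{finite,linorder} F \<Rightarrow>\<^sub>0 complex) set set" where
  "WF_sub l r = generate (add_monoid (WF l))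
     {tensor_WF l v a | v a \<alpha> \<beta>. v \<in> W_sub l r \<inter> W_deg l () \<alpha> \<and> a \<in> F_deg l \<alpha> \<beta>}"

definition is_coaction ::
  "complex \<Rightarrow> ('n W \<Rightarrow> ('n W \<times> 'n::{finite,linorder} F \<Rightarrow>\<^sub>0 complex) set) \<Rightarrow> bool" where
  "is_coaction l R \<longleftrightarrow>
     R \<in> ring_hom (W_alg l) (WF l) \<and>
     (\<forall>i. R (w_el l i) = (\<Oplus>\<^bsub>WF l\<^esub>j\<in>UNIV. tensor_WF l (w_el l j) (t_el l j i))) \<and>
     (\<forall>f. \<forall>v\<in>carrier (W_alg l).
        R (mu_W l f \<otimes>\<^bsub>W_alg l\<^esub> v) = tensor_WF l \<one>\<^bsub>W_alg l\<^esub> (mu_r l f) \<otimes>\<^bsub>WF l\<^esub> R v)"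

text \<open>
  \<open>\<xi> I J\<close> is the element with upper index \<open>I\<close> and lower index \<open>J\<close>. As \<open>w_set l I\<close> has degree
  \<open>wts I\<close>, the membership condition says that \<open>w_set l I \<otimes> \<xi> I J\<close> makes sense in \<open>W \<otimes>~ F\<close>.
\<close>

definition is_matrix_elements ::
  "complex \<Rightarrow> ('n W \<Rightarrow> ('n W \<times> 'n F \<Rightarrow>\<^sub>0 complex) set) \<Rightarrow>
   ('n set \<Rightarrow> 'n set \<Rightarrow> 'n::{finite,linorder} F) \<Rightarrow> bool" where
  "is_matrix_elements l R \<xi> \<longleftrightarrow>
     (\<forall>I J. card I = card J \<longrightarrow> (\<exists>\<beta>. \<xi> I J \<in> F_deg l (wts I) \<beta>)) \<and>
     (\<forall>I J. card I \<noteq> card J \<longrightarrow> \<xi> I J = \<zero>\<^bsub>F_alg l\<^esub>) \<and>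
     (\<forall>J. R (w_set l J) = (\<Oplus>\<^bsub>WF l\<^esub>I\<in>{I. card I = card J}. tensor_WF l (w_set l I) (\<xi> I J)))"

section \<open>The quotients are rings\<close>

text \<open>
  In particular all relations lie in the carriers of the rings in which they generate ideals,
  which \<^const>\<open>genideal\<close> presupposes.
\<close>

lemma free_monoid_monoid: "monoid free_monoid"
  by (rule monoidI) (auto simp: free_monoid_def)

lemma presented_ideal_ideal: "ideal (presented_ideal rels) (monoid_algebra free_monoid)"
  unfolding presented_ideal_def
  by (rule ring.genideal_ideal[OF monoid_algebra_ring[OF free_monoid_monoid]])
     (auto simp: monoid_algebra_def free_monoid_def)

lemma presented_ring: "ring (presented rels)"
  unfolding presented_def by (rule ideal.quotient_is_ring[OF presented_ideal_ideal])

lemma pclass_carrier: "pclass rels p \<in> carrier (presented rels)"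
  unfolding presented_def pclass_def FactRing_def A_RCOSETS_defs a_r_coset_def
  by (auto simp: monoid_algebra_def free_monoid_def)

lemma pclass_add: "pclass rels p \<oplus>\<^bsub>presented rels\<^esub> pclass rels r = pclass rels (p + r)"
proof -
  interpret ideal "presented_ideal rels" "monoid_algebra free_monoid" by (rule presented_ideal_ideal)
  show ?thesis
    using a_rcos_sum[of p r]
    unfolding presented_def pclass_def FactRing_def
    by (simp add: monoid_algebra_def free_monoid_def)
qed

lemma pclass_mult: "pclass rels p \<otimes>\<^bsub>presented rels\<^esub> pclass rels r =
    pclass rels (p \<otimes>\<^bsub>monoid_algebra free_monoid\<^esub> r)"
proof -
  have "p \<in> carrier (monoid_algebra free_monoid)" "r \<in> carrier (monoid_algebra free_monoid)"
    by (simp_all add: monoid_algebra_def free_monoid_def)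
  then show ?thesis
    using ideal.rcoset_mult_add[OF presented_ideal_ideal[of rels], of p r]
    unfolding presented_def pclass_def FactRing_def by simp
qed

lemma pclass_one: "\<one>\<^bsub>presented rels\<^esub> = pclass rels (mon [])"
  unfolding presented_def pclass_def FactRing_def
  by (simp add: monoid_algebra_def free_monoid_def)

lemma free_keys_mult:
  "Poly_Mapping.keys (p \<otimes>\<^bsub>monoid_algebra free_monoid\<^esub> r) \<subseteq>
     (\<Union>x\<in>Poly_Mapping.keys p. \<Union>y\<in>Poly_Mapping.keys r. {x @ y})"
  unfolding monoid_algebra_def free_monoid_def
  by simp (intro order.trans[OF keys_sum] UN_mono order.refl, auto)

lemma graded_carrier: "a \<in> graded deg rels d \<Longrightarrow> a \<in> carrier (presented rels)"
  using pclass_carrier unfolding graded_def by blast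

lemma graded_add: "\<lbrakk>a \<in> graded deg rels d; b \<in> graded deg rels d\<rbrakk> \<Longrightarrow> a \<oplus>\<^bsub>presented rels\<^esub> b \<in> graded deg rels d"
proof -
  assume "a \<in> graded deg rels d" "b \<in> graded deg rels d"
  then obtain p r where "a = pclass rels p" "b = pclass rels r"
    "\<forall>u\<in>Poly_Mapping.keys p. sum_list (map deg u) = d" "\<forall>u\<in>Poly_Mapping.keys r. sum_list (map deg u) = d"
    unfolding graded_def by blast
  then show ?thesis
    unfolding graded_def
    by (intro image_eqI[of _ _ "p + r"]) (auto simp: pclass_add dest!: subsetD[OF Poly_Mapping.keys_add])
qed

lemma graded_mult: "\<lbrakk>a \<in> graded deg rels d; b \<in> graded deg rels e\<rbrakk> \<Longrightarrow> a \<otimes>\<^bsub>presented rels\<^esub> b \<in> graded deg rels (d + e)"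
proof -
  assume "a \<in> graded deg rels d" "b \<in> graded deg rels e"
  then obtain p r where "a = pclass rels p" "b = pclass rels r"
    "\<forall>u\<in>Poly_Mapping.keys p. sum_list (map deg u) = d" "\<forall>u\<in>Poly_Mapping.keys r. sum_list (map deg u) = e"
    unfolding graded_def by blast
  then show ?thesis
    unfolding graded_def
    by (intro image_eqI[of _ _ "p \<otimes>\<^bsub>monoid_algebra free_monoid\<^esub> r"])
       (auto simp: pclass_mult dest!: subsetD[OF free_keys_mult])
qed

lemma graded_one: "\<one>\<^bsub>presented rels\<^esub> \<in> graded deg rels 0"
  unfolding graded_def pclass_one by (auto intro!: imageI simp: keys_single)

lemma tensor_ideal_gen:
  assumes A: "ring A" and B: "ring B"
    and cA: "\<And>\<alpha> \<gamma> a. a \<in> gA \<alpha> \<gamma> \<Longrightarrow> a \<in> carrier A" and cB: "\<And>\<gamma> \<beta> b. b \<in> gB \<gamma> \<beta> \<Longrightarrow> b \<in> carrier B"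
    and oA: "\<And>a c \<alpha> \<gamma> \<alpha>' \<gamma>'. \<lbrakk>a \<in> gA \<alpha> \<gamma>; c \<in> gA \<alpha>' \<gamma>'\<rbrakk> \<Longrightarrow> \<exists>\<alpha>''. a \<otimes>\<^bsub>A\<^esub> c \<in> gA \<alpha>'' (\<gamma> + \<gamma>')"
    and oB: "\<And>b d \<beta> \<gamma> \<beta>' \<gamma>'. \<lbrakk>b \<in> gB \<gamma> \<beta>; d \<in> gB \<gamma>' \<beta>'\<rbrakk> \<Longrightarrow> \<exists>\<beta>''. b \<otimes>\<^bsub>B\<^esub> d \<in> gB (\<gamma> + \<gamma>') \<beta>''"
    and 1: "\<exists>\<alpha>. \<one>\<^bsub>A\<^esub> \<in> gA \<alpha> (0::'h::comm_monoid_add)" "\<exists>\<beta>. \<one>\<^bsub>B\<^esub> \<in> gB 0 \<beta>"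
    and aA: "\<And>\<alpha> \<gamma> a c. \<lbrakk>a \<in> gA \<alpha> \<gamma>; c \<in> gA \<alpha> \<gamma>\<rbrakk> \<Longrightarrow> a \<oplus>\<^bsub>A\<^esub> c \<in> gA \<alpha> \<gamma>"
    and aB: "\<And>\<alpha> \<gamma> a c. \<lbrakk>a \<in> gB \<alpha> \<gamma>; c \<in> gB \<alpha> \<gamma>\<rbrakk> \<Longrightarrow> a \<oplus>\<^bsub>B\<^esub> c \<in> gB \<alpha> \<gamma>"
    and rA: "\<And>f \<alpha> \<gamma> a. a \<in> gA \<alpha> \<gamma> \<Longrightarrow> rA f \<otimes>\<^bsub>A\<^esub> a \<in> gA \<alpha> \<gamma>"
    and lB: "\<And>f \<alpha> \<gamma> a. a \<in> gB \<alpha> \<gamma> \<Longrightarrow> lB f \<otimes>\<^bsub>B\<^esub> a \<in> gB \<alpha> \<gamma>"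
  shows "ideal (tensor_ideal A gA rA B gB lB) (tensor_free A gA B gB)"
    "tensor_rels A gA rA B gB lB \<subseteq> tensor_ideal A gA rA B gB lB"
proof -
  interpret A: ring A by fact
  interpret B: ring B by fact
  have "monoid ((A \<times>\<times> B)\<lparr>carrier := tensor_pairs gA gB\<rparr>)"
  proof (rule monoidI)
    fix x y assume "x \<in> carrier ((A \<times>\<times> B)\<lparr>carrier := tensor_pairs gA gB\<rparr>)"
      "y \<in> carrier ((A \<times>\<times> B)\<lparr>carrier := tensor_pairs gA gB\<rparr>)"
    then show "x \<otimes>\<^bsub>(A \<times>\<times> B)\<lparr>carrier := tensor_pairs gA gB\<rparr>\<^esub> y \<in>
       carrier ((A \<times>\<times> B)\<lparr>carrier := tensor_pairs gA gB\<rparr>)"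
      using oA oB by (fastforce simp: tensor_pairs_def DirProd_def)
  next
    show "\<one>\<^bsub>(A \<times>\<times> B)\<lparr>carrier := tensor_pairs gA gB\<rparr>\<^esub> \<in> carrier ((A \<times>\<times> B)\<lparr>carrier := tensor_pairs gA gB\<rparr>)"
      using 1 by (auto simp: tensor_pairs_def DirProd_def)
  qed (auto simp: tensor_pairs_def DirProd_def A.m_assoc B.m_assoc dest!: cA cB)
  then interpret T: ring "tensor_free A gA B gB" unfolding tensor_free_def by (rule monoid_algebra_ring)
  have "x \<in> carrier (tensor_free A gA B gB)" if "x \<in> tensor_rels A gA rA B gB lB" for x
  proof -
    have C: "p - r \<in> carrier (tensor_free A gA B gB)" if "p \<in> carrier (tensor_free A gA B gB)" "r \<in> carrier (tensor_free A gA B gB)" for p r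
      using that keys_diff[of p r] by (auto simp: tensor_free_def monoid_algebra_def)
    have S: "Poly_Mapping.single (a, b) c \<in> carrier (tensor_free A gA B gB)" if "a \<in> gA \<alpha> \<gamma>" "b \<in> gB \<gamma> \<beta>" for a b c \<alpha> \<beta> \<gamma>
      using that by (auto simp: tensor_free_def monoid_algebra_def tensor_pairs_def keys_single)
    show ?thesis using that
      by cases (auto intro!: C intro: S aA aB rA lB)
  qed
  then show "ideal (tensor_ideal A gA rA B gB lB) (tensor_free A gA B gB)"
    "tensor_rels A gA rA B gB lB \<subseteq> tensor_ideal A gA rA B gB lB"
    unfolding tensor_ideal_def by (auto intro!: T.genideal_ideal T.genideal_self)
qed

lemma mu0: "mu_l l f \<in> graded F_gen_deg (F_rels l) 0" "mu_r l f \<in> graded F_gen_deg (F_rels l) 0"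
  "mu_W l f \<in> graded W_gen_deg (W_rels l) 0"
  unfolding mu_l_def mu_r_def mu_W_def graded_def by (auto intro!: imageI simp: keys_single)

lemma FF_ring: "ring (FF l)" and WF_ring: "ring (WF l)"
proof -
  have Fm: "a \<otimes>\<^bsub>F_alg l\<^esub> c \<in> F_deg l (\<alpha> + \<beta>) (\<gamma> + \<delta>)" if "a \<in> F_deg l \<alpha> \<gamma>" "c \<in> F_deg l \<beta> \<delta>" for a c \<alpha> \<beta> \<gamma> \<delta>
    using graded_mult that unfolding F_alg_def F_deg_def by fastforce
  have Wm: "a \<otimes>\<^bsub>W_alg l\<^esub> c \<in> W_deg l u (\<alpha> + \<beta>)" if "a \<in> W_deg l v \<alpha>" "c \<in> W_deg l w \<beta>" for a c \<alpha> \<beta> u v w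
    using graded_mult that unfolding W_alg_def W_deg_def by blast
  have m: "mu_l l f \<in> F_deg l 0 0" "mu_r l f \<in> F_deg l 0 0" "mu_W l f \<in> W_deg l u 0" for f u
    using mu0 by (auto simp: F_deg_def W_deg_def zero_prod_def[symmetric])
  have ml: "mu_l l f \<otimes>\<^bsub>F_alg l\<^esub> a \<in> F_deg l \<alpha> \<beta>" "mu_r l f \<otimes>\<^bsub>F_alg l\<^esub> a \<in> F_deg l \<alpha> \<beta>"
    if "a \<in> F_deg l \<alpha> \<beta>" for f a \<alpha> \<beta>
    using Fm[OF m(1) that] Fm[OF m(2) that] by simp_all
  have mW: "mu_W l f \<otimes>\<^bsub>W_alg l\<^esub> a \<in> W_deg l u \<beta>"
    if "a \<in> W_deg l u \<beta>" for f a u \<beta>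
    using Wm[OF m(3) that] by simp
  have c: "a \<in> F_deg l \<alpha> \<beta> \<Longrightarrow> a \<in> carrier (F_alg l)" "b \<in> W_deg l u \<beta> \<Longrightarrow> b \<in> carrier (W_alg l)" for a b \<alpha> \<beta> u
    unfolding F_alg_def W_alg_def F_deg_def W_deg_def by (rule graded_carrier; assumption)+
  have ad: "a \<in> F_deg l \<alpha> \<beta> \<Longrightarrow> a' \<in> F_deg l \<alpha> \<beta> \<Longrightarrow> a \<oplus>\<^bsub>F_alg l\<^esub> a' \<in> F_deg l \<alpha> \<beta>"
    "b \<in> W_deg l u \<beta> \<Longrightarrow> b' \<in> W_deg l u \<beta> \<Longrightarrow> b \<oplus>\<^bsub>W_alg l\<^esub> b' \<in> W_deg l u \<beta>" for a a' b b' \<alpha> \<beta> u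
    unfolding F_alg_def W_alg_def F_deg_def W_deg_def by (rule graded_add; assumption)+
  have o: "\<one>\<^bsub>F_alg l\<^esub> \<in> F_deg l 0 0" "\<one>\<^bsub>W_alg l\<^esub> \<in> W_deg l u 0" for u
    unfolding F_alg_def W_alg_def F_deg_def W_deg_def
    by (simp_all add: graded_one zero_prod_def[symmetric])
  have r: "ring (F_alg l)" "ring (W_alg l)" by (simp_all add: F_alg_def W_alg_def presented_ring)
  have "ideal (tensor_ideal (F_alg l) (F_deg l) (mu_r l) (F_alg l) (F_deg l) (mu_l l)) (tensor_free (F_alg l) (F_deg l) (F_alg l) (F_deg l))"
    by (rule tensor_ideal_gen(1)) (rule r | erule c | erule (1) ad | erule ml | rule exI, rule o | rule exI, erule (1) Fm)+
  then show "ring (FF l)" unfolding FF_def tensor_def by (rule ideal.quotient_is_ring)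
  have "ideal (tensor_ideal (W_alg l) (W_deg l) (mu_W l) (F_alg l) (F_deg l) (mu_l l)) (tensor_free (W_alg l) (W_deg l) (F_alg l) (F_deg l))"
    by (rule tensor_ideal_gen(1)) (rule r | erule c | erule (1) ad | erule ml mW | rule exI, rule o | rule exI, erule (1) Fm Wm)+
  then show "ring (WF l)" unfolding WF_def tensor_def by (rule ideal.quotient_is_ring)
qed

end

theory Submission
  imports Defs
begin

text \<open>
  The elements \<open>\<xi>\<^sup>I\<^sub>J\<close> satisfy a Laplace type recursion, obtained by expanding the product
  \<open>R(w\<^sub>j) R(w\<^sub>J)\<close> in the basis of the \<open>w\<^sub>I\<close>. Comparing \<open>R(w\<^sub>k w\<^sub>K)\<close> computed by this recursion with
  the normal form of \<open>w\<^sub>k w\<^sub>K\<close> in \<open>W\<close> gives a dual expansion with coefficients in the image of the right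
  moment map. Applying \<open>\<Delta>\<close> to the recursion and moving these coefficients across the balanced tensor
  product turns \<open>\<Delta>(\<xi>\<^sup>I\<^sub>J)\<close> into the sum over \<open>K\<close>. Coefficients can be compared because the
  coordinates on \<open>W\<close>, read off from an explicit action of \<open>W\<close>, induce maps \<open>v \<otimes> a \<mapsto> v\<^sub>I(\<lambda>) a\<close> from
  \<open>W \<otimes>~ F\<close> to \<open>F\<close>.
\<close>

section \<open>Meromorphic functions\<close>

text \<open>The customary argument compares coefficients in (Id \<otimes> \<Delta>)R = (R \<otimes>
  Id)R, an identity in a threefold product W \<otimes> F \<otimes> F. Here induction on the length
  of a word takes its place, so that twofold products suffice; for this the \<xi> are identified
  with an explicit recursive family \<open>minor\<close>, indexed by words of columns instead of
  sets. The recursion and its dual carry the same function \<open>w_factor\<close>, once as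
  \<open>mu_l\<close> in row indices and once as \<open>mu_r\<close> in column indices. That
  coincidence lets the relation mu_r(f) a \<otimes> b = a \<otimes> mu_l(f) b match the columns of a
  left factor with the rows of a right one. The dual expansion is a nontrivial identity in F,
  obtained from the multiplicativity of R instead of by manipulating the RLL-relations. The price is
  a uniqueness statement for coefficients of the w_I in a ring that is a quotient by a generated
  ideal, tested by coefficient maps that are merely additive. Hence the universal property for
  additive maps, and the concrete representation of W that separates the w_I.\<close>

lemma mero_eq_fun: "meromorphic_rep f \<Longrightarrow> f = g \<Longrightarrow> mero_eq f g"
  using mero_eq_refl by auto

lemma mshift_add [simp]: "mshift a (f + g) = mshift a f + mshift a g"
  by transfer (rule mero_eq_fun, (rule meromorphic_rep_arith meromorphic_rep_shift | erule mero_eq_rep)+, simp)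

lemma mshift_mult [simp]: "mshift a (f * g) = mshift a f * mshift a g"
  by transfer (rule mero_eq_fun, (rule meromorphic_rep_arith meromorphic_rep_shift | erule mero_eq_rep)+, simp)

lemma mshift_inverse [simp]: "mshift a (inverse f) = inverse (mshift a f)"
  by transfer (rule mero_eq_fun, (rule meromorphic_rep_inverse meromorphic_rep_shift | erule mero_eq_rep)+, simp)

lemma mshift_uminus [simp]: "mshift a (- f) = - mshift a f"
  by transfer (rule mero_eq_fun, (rule meromorphic_rep_uminus meromorphic_rep_shift | erule mero_eq_rep)+, simp)

lemma mshift_diff [simp]: "mshift a (f - g) = mshift a f - mshift a g"
  using mshift_add[of a f "- g"] by (simp del: mshift_add)

lemma mshift_divide [simp]: "mshift a (f / g) = mshift a f / mshift a g"
  by (simp add: divide_inverse)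

lemma mshift_mconst [simp]: "mshift a (mconst c) = mconst c"
  by transfer (rule mero_eq_fun, (rule meromorphic_rep_const)+, simp)

lemma mconst_0: "mconst 0 = 0" and mconst_1: "mconst 1 = 1"
  by (transfer, rule mero_eq_fun, (rule meromorphic_rep_const)+, simp)+

lemma mshift_0 [simp]: "mshift a 0 = 0" and mshift_1 [simp]: "mshift a 1 = 1"
  using mshift_mconst[of a 0] mshift_mconst[of a 1] by (simp_all add: mconst_0 mconst_1)

lemma mconst_add: "mconst (c + d) = mconst c + mconst d"
  and mconst_mult: "mconst (c * d) = mconst c * mconst d"
  by (transfer, rule mero_eq_fun, (rule meromorphic_rep_const)+, simp)+

lemma mshift_mshift [simp]: "mshift a (mshift b f) = mshift (a + b) f"
  by transfer (rule mero_eq_fun, (rule meromorphic_rep_shift | erule mero_eq_rep)+, simp add: add.assoc)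

lemma mshift_zero [simp]: "mshift 0 f = f"
  by transfer simp

lemma mshift_prod: "mshift a (\<Prod>i\<in>S. f i) = (\<Prod>i\<in>S. mshift a (f i))"
  by (induction S rule: infinite_finite_induct) simp_all

lemma mshift_Qab:
  assumes "vec_nth v a = vec_nth v b"
  shows "mshift v (Qab l a b) = Qab l a b"
  using assms
proof transfer
  fix v :: "complex ^ 'a" and a b l
  assume v: "vec_nth v a = vec_nth v b"
  \<comment> \<open>The meromorphy proved inside the \<open>lift_definition\<close> is recovered
    from the respectfulness theorem \<open>Qab.rsp\<close>.\<close>
  have "meromorphic_rep (\<lambda>x. qpow l (- 2 * (vec_nth x a - vec_nth x b)))"
    using Qab.rsp[unfolded rel_fun_def, rule_format, OF refl refl refl, of l a b]
    by (rule mero_eq_rep)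
  then have "meromorphic_rep (\<lambda>x. qpow l (- 2 * (vec_nth (x + v) a - vec_nth (x + v) b)))"
    by (rule meromorphic_rep_shift)
  then show "mero_eq (\<lambda>x. qpow l (- 2 * (vec_nth (x + v) a - vec_nth (x + v) b)))
      (\<lambda>x. qpow l (- 2 * (vec_nth x a - vec_nth x b)))"
    by (rule mero_eq_fun) (simp add: v)
qed

text \<open>The function depends only on the difference of the coordinates a and b, which a
  translation along a third axis preserves. This is why straightening coefficients can be moved past
  letters w_k without a dynamical shift.\<close>

lemma mshift_h_at:
  assumes "k \<noteq> a" "k \<noteq> b"
  shows "mshift (- wt k) (h_at l a b) = h_at l a b"
proof -
  have "mshift (- wt k) (Qab l a b) = Qab l a b"
    using assms by (intro mshift_Qab) (simp add: wt_def axis_def)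
  then show ?thesis by (simp add: h_at_def h0_at_def)
qed

section \<open>Algebras by generators and relations\<close>

lemma presented_ring_hom: "pclass rels \<in> ring_hom (monoid_algebra free_monoid) (presented rels)"
  using ideal.rcos_ring_hom[OF presented_ideal_ideal[of rels]]
  unfolding presented_def pclass_def[abs_def] .

lemma free_carrier [simp]: "p \<in> carrier (monoid_algebra free_monoid)"
  and free_add [simp]: "p \<oplus>\<^bsub>monoid_algebra free_monoid\<^esub> r = p + r"
  and free_zero [simp]: "\<zero>\<^bsub>monoid_algebra free_monoid\<^esub> = 0"
  by (simp_all add: monoid_algebra_def free_monoid_def)

lemma free_mult_single [simp]:
  "Poly_Mapping.single u a \<otimes>\<^bsub>monoid_algebra free_monoid\<^esub> Poly_Mapping.single v b =
   Poly_Mapping.single (u @ v) (a * b)"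
  by (simp add: monoid_algebra_mult_single) (simp add: free_monoid_def)

lemma presented_zero: "\<zero>\<^bsub>presented rels\<^esub> = pclass rels 0"
  by (rule ring_hom_zero[OF presented_ring_hom monoid_algebra_ring[OF free_monoid_monoid] presented_ring,
      unfolded free_zero, symmetric])

lemma pclass_surj: "x \<in> carrier (presented rels) \<Longrightarrow> \<exists>p. x = pclass rels p"
  unfolding presented_def pclass_def FactRing_def A_RCOSETS_def'
  by auto

lemma pclass_ideal: "p \<in> presented_ideal rels \<Longrightarrow> pclass rels p = \<zero>\<^bsub>presented rels\<^esub>"
proof -
  interpret ideal "presented_ideal rels" "monoid_algebra free_monoid" by (rule presented_ideal_ideal)
  show "p \<in> presented_ideal rels \<Longrightarrow> pclass rels p = \<zero>\<^bsub>presented rels\<^esub>"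
    unfolding pclass_def presented_def FactRing_def by (simp add: a_rcos_const)
qed

lemma rels_ideal: "rels \<subseteq> presented_ideal rels"
  unfolding presented_ideal_def
  by (rule ring.genideal_self[OF monoid_algebra_ring[OF free_monoid_monoid]]) auto

lemma pclass_eqI: "p - r \<in> rels \<Longrightarrow> pclass rels p = pclass rels r"
proof -
  interpret ring "presented rels" by (rule presented_ring)
  assume "p - r \<in> rels"
  then have "pclass rels (p - r) = \<zero>\<^bsub>presented rels\<^esub>" using rels_ideal pclass_ideal by blast
  then show ?thesis using pclass_add[of rels "p - r" r] by (simp add: pclass_carrier)
qed

lemma pclass_mon_append: "pclass rels (mon (u @ v)) = pclass rels (mon u) \<otimes>\<^bsub>presented rels\<^esub> pclass rels (mon v)"
  by (simp add: pclass_mult)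

lemma pclass_mon_Cons: "pclass rels (mon (x # v)) = pclass rels (mon [x]) \<otimes>\<^bsub>presented rels\<^esub> pclass rels (mon v)"
  using pclass_mon_append[of rels "[x]" v] by simp

lemma keys_induct:
  fixes p :: "'a \<Rightarrow>\<^sub>0 complex"
  assumes "Poly_Mapping.keys p \<subseteq> S" "P 0"
    and "\<And>u c p. u \<in> S \<Longrightarrow> P p \<Longrightarrow> P (Poly_Mapping.single u c + p)"
  shows "P p"
proof -
  have "P (\<Sum>x\<in>X. Poly_Mapping.single x (Poly_Mapping.lookup p x))" if "finite X" "X \<subseteq> S" for X
    using that by (induction X rule: finite_induct) (auto intro: assms)
  from this[OF finite_keys assms(1)] show ?thesis by (simp only: poly_mapping_sum_single)
qed

lemma graded_zero: "\<zero>\<^bsub>presented rels\<^esub> \<in> graded deg rels d"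
  unfolding presented_zero graded_def by (rule imageI) simp

lemma graded_single: "sum_list (map deg u) = d \<Longrightarrow> pclass rels (Poly_Mapping.single u c) \<in> graded deg rels d"
  unfolding graded_def by (auto intro!: imageI simp: keys_single)

text \<open>By the definition of \<open>graded\<close>, a homogeneous element has a representative
  all of whose words have the right degree. Its partial sums stay homogeneous, so membership is
  available in the inductive step.\<close>

lemma graded_induct [consumes 1, case_names zero add]:
  assumes "a \<in> graded deg rels d" "P \<zero>\<^bsub>presented rels\<^esub>"
    and "\<And>u c b. sum_list (map deg u) = d \<Longrightarrow> b \<in> graded deg rels d \<Longrightarrow> P b \<Longrightarrow>
      P (pclass rels (Poly_Mapping.single u c) \<oplus>\<^bsub>presented rels\<^esub> b)"
  shows "P a"
proof -
  obtain p where p: "a = pclass rels p" "Poly_Mapping.keys p \<subseteq> {u. sum_list (map deg u) = d}"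
    using assms(1) unfolding graded_def by blast
  from p(2) have "pclass rels p \<in> graded deg rels d \<and> P (pclass rels p)"
    by (rule keys_induct)
       (use assms(2,3) in \<open>auto simp flip: presented_zero pclass_add intro: graded_zero graded_add graded_single\<close>)
  then show ?thesis using p by simp
qed

lemma pclass_eqD: "pclass rels p = pclass rels r \<Longrightarrow> p - r \<in> presented_ideal rels"
proof -
  interpret ideal "presented_ideal rels" "monoid_algebra free_monoid" by (rule presented_ideal_ideal)
  assume "pclass rels p = pclass rels r"
  then have "p \<in> presented_ideal rels +>\<^bsub>monoid_algebra free_monoid\<^esub> r"
    using a_rcos_self[of p] by (simp add: pclass_def)
  then show ?thesis by (auto simp: a_r_coset_def')
qed

section \<open>Coordinates on \<open>W\<close>\<close>

text \<open>Complex-linear extension from words to the free algebra. With \<open>F\<close> sending a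
  word to one coordinate of its action on a fixed vector, this is that coordinate for an arbitrary
  element of the free algebra.\<close>

definition lin :: "('g \<Rightarrow> 'n mero) \<Rightarrow> ('g \<Rightarrow>\<^sub>0 complex) \<Rightarrow> 'n::finite mero" where
  "lin F p = (\<Sum>u\<in>Poly_Mapping.keys p. mconst (Poly_Mapping.lookup p u) * F u)"

lemma lin_superset:
  assumes "finite S" "Poly_Mapping.keys p \<subseteq> S"
  shows "lin F p = (\<Sum>u\<in>S. mconst (Poly_Mapping.lookup p u) * F u)"
  unfolding lin_def using assms
  by (intro sum.mono_neutral_left) (auto simp: in_keys_iff mconst_0)

lemma lin_zero [simp]: "lin F 0 = 0" by (simp add: lin_def)

lemma lin_add [simp]: "lin F (p + r) = lin F p + lin F r"
proof -
  let ?S = "Poly_Mapping.keys p \<union> Poly_Mapping.keys r"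
  have "lin F (p + r) = (\<Sum>u\<in>?S. mconst (Poly_Mapping.lookup (p + r) u) * F u)"
    by (rule lin_superset) (auto dest: subsetD[OF Poly_Mapping.keys_add])
  also have "\<dots> = lin F p + lin F r"
    by (subst (1 2) lin_superset[of ?S]) (auto simp: lookup_add mconst_add distrib_right sum.distrib)
  finally show ?thesis .
qed

lemma lin_single [simp]: "lin F (Poly_Mapping.single u c) = mconst c * F u"
  by (simp add: lin_def mconst_0)

lemma lin_diff [simp]: "lin F (p - r) = lin F p - lin F r"
  using lin_add[of F "p - r" r] by (simp del: lin_add)

lemma lin_uminus [simp]: "lin F (- p) = - lin F p"
  using lin_diff[of F 0 p] by (simp del: lin_diff)

text \<open>The factor with \<open>w\<^sub>i w\<^sub>K = w_factor l i K w\<close>, \<open>w\<close> being the basis element of \<open>K \<union> {i}\<close>, for \<open>i\<close> outside \<open>K\<close>.\<close>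

definition w_factor :: "complex \<Rightarrow> 'n \<Rightarrow> 'n set \<Rightarrow> 'n::{finite,linorder} mero" where
  "w_factor l i K = (\<Prod>j\<in>{j\<in>K. j < i}. - h_at l i j)"

lemma mshift_w_factor: "k \<noteq> i \<Longrightarrow> k \<notin> K \<Longrightarrow> mshift (- wt k) (w_factor l i K) = w_factor l i K"
  unfolding w_factor_def mshift_prod by (intro prod.cong refl) (metis (no_types, lifting) mem_Collect_eq mshift_h_at mshift_uminus)

lemma w_factor_remove: "i \<in> K \<Longrightarrow> i < j \<Longrightarrow> w_factor l j K = - h_at l j i * w_factor l j (K - {i})"
proof -
  assume "i \<in> K" "i < j"
  moreover have "{k\<in>K - {i}. k < j} = {k\<in>K. k < j} - {i}" by auto
  ultimately show ?thesis unfolding w_factor_def by (simp add: prod.remove[of "{k\<in>K. k < j}" i])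
qed

lemma w_factor_remove_ge: "\<not> k < i \<Longrightarrow> w_factor l i (K - {k}) = w_factor l i K"
  unfolding w_factor_def by (rule prod.cong) auto

lemma w_factor_eq_1: "(\<And>j. j \<in> K \<Longrightarrow> i \<le> j) \<Longrightarrow> w_factor l i K = 1"
  unfolding w_factor_def by (subst prod.neutral) force+

text \<open>Left multiplication on \<open>W\<close> in terms of coordinates with respect to the \<open>w\<^sub>K\<close>.\<close>

fun W_act :: "complex \<Rightarrow> 'n::{finite,linorder} W_gen \<Rightarrow> ('n set \<Rightarrow> 'n mero) \<Rightarrow> 'n set \<Rightarrow> 'n mero" where
  "W_act l (Wgen i) \<phi> K = (if i \<in> K then w_factor l i (K - {i}) * mshift (- wt i) (\<phi> (K - {i})) else 0)"
| "W_act l (WFn f) \<phi> K = f * \<phi> K"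

abbreviation W_word_act :: "complex \<Rightarrow> 'n::{finite,linorder} W_gen list \<Rightarrow> ('n set \<Rightarrow> 'n mero) \<Rightarrow> 'n set \<Rightarrow> 'n mero" where
  "W_word_act l u \<equiv> foldr (W_act l) u"

text \<open>Only constants come out: \<open>Wgen i\<close> shifts the coefficients, so the action is
  complex-linear but not linear over the meromorphic functions.\<close>

lemma W_act_linear: "W_act l x (\<lambda>K. mconst c * \<phi> K + \<psi> K) = (\<lambda>K. mconst c * W_act l x \<phi> K + W_act l x \<psi> K)"
  by (cases x) (auto simp: fun_eq_iff algebra_simps)

lemma W_word_act_linear:
  "W_word_act l u (\<lambda>K. mconst c * \<phi> K + \<psi> K) K = mconst c * W_word_act l u \<phi> K + W_word_act l u \<psi> K"
proof -
  have "W_word_act l u (\<lambda>K. mconst c * \<phi> K + \<psi> K) = (\<lambda>K. mconst c * W_word_act l u \<phi> K + W_word_act l u \<psi> K)"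
    by (induction u) (simp_all add: W_act_linear)
  then show ?thesis by simp
qed

lemma W_word_act_zero: "W_word_act l u (\<lambda>K. 0) K = 0"
proof -
  have "W_word_act l u (\<lambda>K. 0) = (\<lambda>K. 0)"
  proof (induction u)
    case (Cons x u)
    then show ?case by (cases x) (auto simp: fun_eq_iff)
  qed simp
  then show ?thesis by simp
qed

lemma W_act_mult_single:
  "lin (\<lambda>u. W_word_act l u \<phi> K) (Poly_Mapping.single u c \<otimes>\<^bsub>monoid_algebra free_monoid\<^esub> r) =
   mconst c * W_word_act l u (\<lambda>K. lin (\<lambda>u. W_word_act l u \<phi> K) r) K"
  by (rule keys_induct[of r UNIV])
     (auto simp: monoid_algebra_mult_zero monoid_algebra_distrib W_word_act_zero W_word_act_linear mconst_mult
       algebra_simps)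

text \<open>Concatenation of words acts by composition, so the free algebra is represented; the
  right factor \<open>r\<close> acts first.\<close>

lemma W_act_mult:
  "lin (\<lambda>u. W_word_act l u \<phi> K) (p \<otimes>\<^bsub>monoid_algebra free_monoid\<^esub> r) =
   lin (\<lambda>u. W_word_act l u (\<lambda>K. lin (\<lambda>u. W_word_act l u \<phi> K) r) K) p"
  by (rule keys_induct[of p UNIV])
     (auto simp: monoid_algebra_mult_zero monoid_algebra_distrib W_act_mult_single)

lemma W_act_rels:
  assumes "p \<in> W_rels l"
  shows "lin (\<lambda>u. W_word_act l u \<phi> K) p = 0"
  using assms
proof cases
  \<comment> \<open>The exchange relation, with i < j. Both orders lead from K - {i} - {j} to K. If
    w_i acts first, w_j meets the smaller index i and picks up -h(\<lambda>_j - \<lambda>_i); in the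
    other order w_i ignores the larger j. The shifts do not affect the remaining factors. If i or j
    is missing from K, both terms vanish.\<close>
  case (5 i j)
  let ?L = "K - {i} - {j}"
  have e: "K - {j} - {i} = ?L" by auto
  show ?thesis
  proof (cases "i \<in> K \<and> j \<in> K")
    case True
    have "w_factor l j (K - {j}) = - h_at l j i * w_factor l j ?L"
      using 5 True w_factor_remove[of i "K - {j}" j l] by (simp add: e)
    moreover have "w_factor l i (K - {i}) = w_factor l i ?L"
      using 5 by (simp add: w_factor_remove_ge)
    moreover have "mshift (- wt j) (w_factor l i ?L) = w_factor l i ?L" "mshift (- wt i) (w_factor l j ?L) = w_factor l j ?L"
      using 5 by (auto intro!: mshift_w_factor)
    ultimately show ?thesis using 5 True by (simp add: mconst_1 e algebra_simps)
  qed (use 5 in \<open>auto simp: mconst_1\<close>)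
qed (simp_all add: mconst_1 ring_distribs mult_ac)

lemma W_act_ideal:
  fixes p :: "'n::{finite,linorder} W_gen list \<Rightarrow>\<^sub>0 complex"
  assumes "p \<in> presented_ideal (W_rels l)"
  shows "lin (\<lambda>u. W_word_act l u \<phi> K) p = 0"
proof -
  interpret R: ring "monoid_algebra free_monoid :: ('n W_gen list \<Rightarrow>\<^sub>0 complex) ring"
    by (rule monoid_algebra_ring[OF free_monoid_monoid])
  \<comment> \<open>Quantifying over all \<phi>, and not just the coordinates of 1, makes
    \<open>N\<close> closed under multiplication on the right: there p acts on r applied to
    \<phi>.\<close>
  define N where "N = {p :: 'n W_gen list \<Rightarrow>\<^sub>0 complex. \<forall>\<phi> K. lin (\<lambda>u. W_word_act l u \<phi> K) p = 0}"
  have "ideal N (monoid_algebra free_monoid)"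
  proof (rule idealI[OF R.ring_axioms])
    show "subgroup N (add_monoid (monoid_algebra free_monoid))"
    proof (rule R.add.subgroupI)
      show "\<ominus>\<^bsub>monoid_algebra free_monoid\<^esub> p \<in> N" if "p \<in> N" for p
      proof -
        have "\<ominus>\<^bsub>monoid_algebra free_monoid\<^esub> p = - p"
          by (rule R.minus_equality) auto
        then show ?thesis using that by (auto simp: N_def)
      qed
    qed (auto simp: N_def intro: exI[of _ 0])
  qed (auto simp: N_def W_act_mult W_word_act_zero, auto simp: lin_def)
  moreover have "W_rels l \<subseteq> N" using W_act_rels by (auto simp: N_def)
  ultimately have "presented_ideal (W_rels l) \<subseteq> N"
    unfolding presented_ideal_def by (rule R.genideal_minimal)
  then show ?thesis using assms by (auto simp: N_def)
qed

text \<open>The vector acted upon is the coordinate vector of 1 = w_\<emptyset>, so the result is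
  the coordinate vector of v. The choice of a representative is harmless because the ideal of
  relations acts by zero.\<close>

definition w_coord :: "complex \<Rightarrow> 'n W \<Rightarrow> 'n set \<Rightarrow> 'n::{finite,linorder} mero" where
  "w_coord l v K = lin (\<lambda>u. W_word_act l u (\<lambda>I. if I = {} then 1 else 0) K) (SOME p. v = pclass (W_rels l) p)"

lemma w_coord_pclass:
  "w_coord l (pclass (W_rels l) p) K = lin (\<lambda>u. W_word_act l u (\<lambda>I. if I = {} then 1 else 0) K) p"
proof -
  have "pclass (W_rels l) p = pclass (W_rels l) (SOME r. pclass (W_rels l) p = pclass (W_rels l) r)"
    by (rule someI) simp
  from W_act_ideal[OF pclass_eqD[OF this]] show ?thesis unfolding w_coord_def by simp
qed

lemma w_coord_add:
  "v \<in> carrier (W_alg l) \<Longrightarrow> w \<in> carrier (W_alg l) \<Longrightarrow>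
   w_coord l (v \<oplus>\<^bsub>W_alg l\<^esub> w) K = w_coord l v K + w_coord l w K"
  unfolding W_alg_def by (auto dest!: pclass_surj simp: w_coord_pclass pclass_add)

lemma w_coord_mu_W: "v \<in> carrier (W_alg l) \<Longrightarrow> w_coord l (mu_W l f \<otimes>\<^bsub>W_alg l\<^esub> v) K = f * w_coord l v K"
  unfolding W_alg_def mu_W_def
  by (auto dest!: pclass_surj simp: w_coord_pclass pclass_mult W_act_mult mconst_1)

lemma w_coord_w_el:
  "v \<in> carrier (W_alg l) \<Longrightarrow> w_coord l (w_el l i \<otimes>\<^bsub>W_alg l\<^esub> v) K =
   (if i \<in> K then w_factor l i (K - {i}) * mshift (- wt i) (w_coord l v (K - {i})) else 0)"
  unfolding W_alg_def w_el_def
  by (auto dest!: pclass_surj simp: w_coord_pclass pclass_mult W_act_mult mconst_1)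

lemma w_coord_one: "w_coord l \<one>\<^bsub>W_alg l\<^esub> K = (if K = {} then 1 else 0)"
  by (simp add: W_alg_def pclass_one w_coord_pclass mconst_1)

section \<open>Relations in \<open>W\<close> and \<open>\<F>\<^sub>R(M(n))\<close>\<close>

lemma W_ring: "ring (W_alg l)" and F_ring: "ring (F_alg l)"
  by (simp_all add: W_alg_def F_alg_def presented_ring)

global_interpretation W: ring "W_alg l" for l by (rule W_ring)
global_interpretation F: ring "F_alg l" for l by (rule F_ring)
global_interpretation FF: ring "FF l" for l by (rule FF_ring)
global_interpretation WF: ring "WF l" for l by (rule WF_ring)

lemma W_carrier [simp]: "mu_W l f \<in> carrier (W_alg l)" "w_el l i \<in> carrier (W_alg l)"
  by (simp_all add: W_alg_def mu_W_def w_el_def pclass_carrier)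

lemma F_carrier [simp]: "mu_l l f \<in> carrier (F_alg l)" "mu_r l f \<in> carrier (F_alg l)" "t_el l i j \<in> carrier (F_alg l)"
  by (simp_all add: F_alg_def mu_l_def mu_r_def t_el_def pclass_carrier)

lemma mu_W_add: "mu_W l (f + g) = mu_W l f \<oplus>\<^bsub>W_alg l\<^esub> mu_W l g"
  unfolding mu_W_def W_alg_def pclass_add
  by (rule pclass_eqI) (simp add: diff_diff_add[symmetric] W_rels.intros)

lemma mu_W_mult: "mu_W l (f * g) = mu_W l f \<otimes>\<^bsub>W_alg l\<^esub> mu_W l g"
  unfolding mu_W_def W_alg_def pclass_mult
  by (rule pclass_eqI) (simp add: W_rels.intros)

lemma mu_W_mconst: "mu_W l (mconst c) = pclass (W_rels l) (Poly_Mapping.single [] c)"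
  unfolding mu_W_def by (rule pclass_eqI) (simp add: W_rels.intros)

lemma mu_W_1: "mu_W l 1 = \<one>\<^bsub>W_alg l\<^esub>"
  using mu_W_mconst[of l 1] by (simp add: mconst_1 W_alg_def pclass_one)

lemma mu_W_0: "mu_W l 0 = \<zero>\<^bsub>W_alg l\<^esub>"
  using mu_W_mconst[of l 0] by (simp add: mconst_0 W_alg_def presented_zero)

lemma w_el_sq: "w_el l i \<otimes>\<^bsub>W_alg l\<^esub> w_el l i = \<zero>\<^bsub>W_alg l\<^esub>"
  unfolding w_el_def W_alg_def pclass_mult presented_zero
  by (rule pclass_eqI) (simp add: W_rels.intros)

lemma w_el_swap:
  assumes "i < j"
  shows "w_el l j \<otimes>\<^bsub>W_alg l\<^esub> w_el l i =
    mu_W l (- h_at l j i) \<otimes>\<^bsub>W_alg l\<^esub> (w_el l i \<otimes>\<^bsub>W_alg l\<^esub> w_el l j)"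
proof -
  let ?x = "w_el l j \<otimes>\<^bsub>W_alg l\<^esub> w_el l i" and ?y = "w_el l i \<otimes>\<^bsub>W_alg l\<^esub> w_el l j"
  have "?x \<oplus>\<^bsub>W_alg l\<^esub> mu_W l (h_at l j i) \<otimes>\<^bsub>W_alg l\<^esub> ?y = \<zero>\<^bsub>W_alg l\<^esub>"
    unfolding w_el_def mu_W_def W_alg_def pclass_mult pclass_add presented_zero
    using assms by (intro pclass_eqI) (simp add: W_rels.intros)
  moreover have "mu_W l (- h_at l j i) \<otimes>\<^bsub>W_alg l\<^esub> ?y \<oplus>\<^bsub>W_alg l\<^esub> mu_W l (h_at l j i) \<otimes>\<^bsub>W_alg l\<^esub> ?y = \<zero>\<^bsub>W_alg l\<^esub>"
    using mu_W_add[of l "- h_at l j i" "h_at l j i"] by (simp add: mu_W_0 flip: W.l_distr) (metis W.l_null W.m_closed W_carrier(2))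
  ultimately show ?thesis
    by (metis W.add.right_cancel W.m_closed W_carrier)
qed

lemma w_el_mu_W: "w_el l i \<otimes>\<^bsub>W_alg l\<^esub> mu_W l f = mu_W l (mshift (- wt i) f) \<otimes>\<^bsub>W_alg l\<^esub> w_el l i"
  unfolding w_el_def mu_W_def W_alg_def pclass_mult
  using W_rels.intros(6)[of "mshift (- wt i) f" i l] by (intro pclass_eqI[symmetric]) simp

lemma mu_add: "mu_l l (f + g) = mu_l l f \<oplus>\<^bsub>F_alg l\<^esub> mu_l l g" "mu_r l (f + g) = mu_r l f \<oplus>\<^bsub>F_alg l\<^esub> mu_r l g"
  unfolding mu_l_def mu_r_def F_alg_def pclass_add
  by (rule pclass_eqI, simp add: diff_diff_add[symmetric] F_rels.intros)+

lemma mu_mult: "mu_l l (f * g) = mu_l l f \<otimes>\<^bsub>F_alg l\<^esub> mu_l l g" "mu_r l (f * g) = mu_r l f \<otimes>\<^bsub>F_alg l\<^esub> mu_r l g"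
  unfolding mu_l_def mu_r_def F_alg_def pclass_mult
  by (rule pclass_eqI, simp add: F_rels.intros)+

lemma mu_mconst: "mu_l l (mconst c) = pclass (F_rels l) (Poly_Mapping.single [] c)"
    "mu_r l (mconst c) = pclass (F_rels l) (Poly_Mapping.single [] c)"
  unfolding mu_l_def mu_r_def by (rule pclass_eqI, simp add: F_rels.intros)+

lemma mu_1: "mu_l l 1 = \<one>\<^bsub>F_alg l\<^esub>" "mu_r l 1 = \<one>\<^bsub>F_alg l\<^esub>"
  using mu_mconst[of l 1] by (simp_all add: mconst_1 F_alg_def pclass_one)

lemma mu_0: "mu_l l 0 = \<zero>\<^bsub>F_alg l\<^esub>" "mu_r l 0 = \<zero>\<^bsub>F_alg l\<^esub>"
  using mu_mconst[of l 0] by (simp_all add: mconst_0 F_alg_def presented_zero)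

lemma mu_commute: "mu_l l f \<otimes>\<^bsub>F_alg l\<^esub> mu_r l g = mu_r l g \<otimes>\<^bsub>F_alg l\<^esub> mu_l l f"
  unfolding mu_l_def mu_r_def F_alg_def pclass_mult by (rule pclass_eqI) (simp add: F_rels.intros)

lemma t_el_mu:
  "t_el l i j \<otimes>\<^bsub>F_alg l\<^esub> mu_l l f = mu_l l (mshift (- wt i) f) \<otimes>\<^bsub>F_alg l\<^esub> t_el l i j"
  "t_el l i j \<otimes>\<^bsub>F_alg l\<^esub> mu_r l f = mu_r l (mshift (- wt j) f) \<otimes>\<^bsub>F_alg l\<^esub> t_el l i j"
  unfolding t_el_def mu_l_def mu_r_def F_alg_def pclass_mult
  using F_rels.intros(8)[of "mshift (- wt i) f" i j l] F_rels.intros(9)[of "mshift (- wt j) f" i j l]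
  by (intro pclass_eqI[symmetric]; simp)+

text \<open>Stated once for all three moment maps: \<open>deg\<close> is the full grading, while
  \<open>d\<close> records the part of the degree by which the moment map \<open>m\<close> is
  shifted. Shifts add up along a word, and degree \<delta> determines the total shift
  \<gamma>.\<close>

lemma graded_commute:
  fixes d :: "'g \<Rightarrow> complex ^ 'n::finite"
  assumes a: "a \<in> graded deg rels \<delta>"
    and d: "\<And>u. sum_list (map deg u) = \<delta> \<Longrightarrow> sum_list (map d u) = \<gamma>"
    and m: "\<And>f. m f \<in> carrier (presented rels)" "\<And>f g. m (f * g) = m f \<otimes>\<^bsub>presented rels\<^esub> m g"
      "\<And>c. m (mconst c) = pclass rels (Poly_Mapping.single [] c)"
    and gen: "\<And>x f. pclass rels (mon [x]) \<otimes>\<^bsub>presented rels\<^esub> m f =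
      m (mshift (- d x) f) \<otimes>\<^bsub>presented rels\<^esub> pclass rels (mon [x])"
  shows "a \<otimes>\<^bsub>presented rels\<^esub> m f = m (mshift (- \<gamma>) f) \<otimes>\<^bsub>presented rels\<^esub> a"
proof -
  interpret ring "presented rels" by (rule presented_ring)
  note c [simp] = pclass_carrier[of rels] m(1)
  have w: "pclass rels (mon u) \<otimes>\<^bsub>presented rels\<^esub> m f =
    m (mshift (- sum_list (map d u)) f) \<otimes>\<^bsub>presented rels\<^esub> pclass rels (mon u)" for u f
  proof (induction u)
    case Nil
    then show ?case by (simp flip: pclass_one)
  next
    case (Cons x u)
    let ?x = "pclass rels (mon [x])" and ?u = "pclass rels (mon u)"
    let ?f = "mshift (- sum_list (map d u)) f"
    have "?x \<otimes>\<^bsub>presented rels\<^esub> ?u \<otimes>\<^bsub>presented rels\<^esub> m f = ?x \<otimes>\<^bsub>presented rels\<^esub> m ?f \<otimes>\<^bsub>presented rels\<^esub> ?u"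
      by (simp add: m_assoc Cons)
    also have "\<dots> = m (mshift (- sum_list (map d (x # u))) f) \<otimes>\<^bsub>presented rels\<^esub> (?x \<otimes>\<^bsub>presented rels\<^esub> ?u)"
      by (simp add: m_assoc gen)
    finally show ?case by (simp only: pclass_mon_Cons[of rels x u])
  qed
  show ?thesis
    using a
  proof (induction rule: graded_induct)
    case (add u k b)
    then have b [simp]: "b \<in> carrier (presented rels)" using graded_carrier by blast
    \<comment> \<open>The scalar is written as a value of \<open>m\<close>; such values commute
      among themselves, and a constant is not shifted.\<close>
    have s: "pclass rels (Poly_Mapping.single u k) = m (mconst k) \<otimes>\<^bsub>presented rels\<^esub> pclass rels (mon u)"
      by (simp add: m(3) pclass_mult)
    have k: "m (mconst k) \<otimes>\<^bsub>presented rels\<^esub> m g = m g \<otimes>\<^bsub>presented rels\<^esub> m (mconst k)" for g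
      by (simp add: m(2)[symmetric] mult.commute)
    have "pclass rels (Poly_Mapping.single u k) \<otimes>\<^bsub>presented rels\<^esub> m f =
      m (mconst k) \<otimes>\<^bsub>presented rels\<^esub> m (mshift (- \<gamma>) f) \<otimes>\<^bsub>presented rels\<^esub> pclass rels (mon u)"
      using w[of u f] d[OF add(1)] unfolding s by (simp add: m_assoc)
    also have "\<dots> = m (mshift (- \<gamma>) f) \<otimes>\<^bsub>presented rels\<^esub> pclass rels (Poly_Mapping.single u k)"
      unfolding s k by (simp add: m_assoc)
    finally show ?case using add(3) by (simp add: l_distr r_distr)
  qed simp
qed

lemma W_deg_commute:
  assumes "v \<in> W_deg l u \<alpha>"
  shows "v \<otimes>\<^bsub>W_alg l\<^esub> mu_W l f = mu_W l (mshift (- \<alpha>) f) \<otimes>\<^bsub>W_alg l\<^esub> v"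
  unfolding W_alg_def
proof (rule graded_commute[where d = W_gen_deg])
  fix x f
  show "pclass (W_rels l) (mon [x]) \<otimes>\<^bsub>presented (W_rels l)\<^esub> mu_W l f =
      mu_W l (mshift (- W_gen_deg x) f) \<otimes>\<^bsub>presented (W_rels l)\<^esub> pclass (W_rels l) (mon [x])"
    by (cases x) (simp_all add: w_el_mu_W mu_W_mult[symmetric] mult.commute
      flip: w_el_def mu_W_def W_alg_def)
qed (use assms in \<open>auto simp: mu_W_mconst mu_W_mult W_deg_def simp flip: W_alg_def\<close>)

text \<open>Both moment maps use the same bidegree; \<open>d\<close> is its first component for
  \<open>mu_l\<close> and its second for \<open>mu_r\<close>.\<close>

lemma F_deg_commute:
  assumes "a \<in> F_deg l \<alpha> \<beta>"
  shows "a \<otimes>\<^bsub>F_alg l\<^esub> mu_l l f = mu_l l (mshift (- \<alpha>) f) \<otimes>\<^bsub>F_alg l\<^esub> a"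
    and "a \<otimes>\<^bsub>F_alg l\<^esub> mu_r l f = mu_r l (mshift (- \<beta>) f) \<otimes>\<^bsub>F_alg l\<^esub> a"
proof -
  have d: "sum_list (map (\<lambda>x. fst (F_gen_deg x)) u) = fst (sum_list (map F_gen_deg u))"
    "sum_list (map (\<lambda>x. snd (F_gen_deg x)) u) = snd (sum_list (map F_gen_deg u))" for u :: "'a F_gen list"
    by (induction u) simp_all
  have g: "pclass (F_rels l) (mon [x]) \<otimes>\<^bsub>F_alg l\<^esub> mu_l l f =
      mu_l l (mshift (- fst (F_gen_deg x)) f) \<otimes>\<^bsub>F_alg l\<^esub> pclass (F_rels l) (mon [x])"
    "pclass (F_rels l) (mon [x]) \<otimes>\<^bsub>F_alg l\<^esub> mu_r l f =
      mu_r l (mshift (- snd (F_gen_deg x)) f) \<otimes>\<^bsub>F_alg l\<^esub> pclass (F_rels l) (mon [x])" for x f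
    by (cases x; simp add: t_el_mu mu_commute mu_mult[symmetric] mult.commute
        flip: t_el_def mu_l_def mu_r_def)+
  show "a \<otimes>\<^bsub>F_alg l\<^esub> mu_l l f = mu_l l (mshift (- \<alpha>) f) \<otimes>\<^bsub>F_alg l\<^esub> a"
    unfolding F_alg_def
    by (rule graded_commute[where deg = F_gen_deg and \<delta> = "(\<alpha>, \<beta>)", OF _ _ _ _ _ g(1)[unfolded F_alg_def]])
       (use assms in \<open>auto simp: mu_mconst mu_mult F_deg_def d simp flip: F_alg_def\<close>)
  show "a \<otimes>\<^bsub>F_alg l\<^esub> mu_r l f = mu_r l (mshift (- \<beta>) f) \<otimes>\<^bsub>F_alg l\<^esub> a"
    unfolding F_alg_def
    by (rule graded_commute[where deg = F_gen_deg and \<delta> = "(\<alpha>, \<beta>)", OF _ _ _ _ _ g(2)[unfolded F_alg_def]])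
       (use assms in \<open>auto simp: mu_mconst mu_mult F_deg_def d simp flip: F_alg_def\<close>)
qed

section \<open>The tensor products\<close>

lemma additive_zero:
  assumes "abelian_group G" "abelian_group H" "h \<in> carrier G \<rightarrow> carrier H"
    "\<And>x y. x \<in> carrier G \<Longrightarrow> y \<in> carrier G \<Longrightarrow> h (x \<oplus>\<^bsub>G\<^esub> y) = h x \<oplus>\<^bsub>H\<^esub> h y"
  shows "h \<zero>\<^bsub>G\<^esub> = \<zero>\<^bsub>H\<^esub>"
proof -
  interpret G: abelian_group G by fact
  interpret H: abelian_group H by fact
  have "h \<zero>\<^bsub>G\<^esub> \<oplus>\<^bsub>H\<^esub> h \<zero>\<^bsub>G\<^esub> = h \<zero>\<^bsub>G\<^esub>"
    using assms(4)[of "\<zero>\<^bsub>G\<^esub>" "\<zero>\<^bsub>G\<^esub>"] by simp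
  then show ?thesis using assms(3) by (metis G.zero_closed H.add.l_cancel_one funcset_mem)
qed

text \<open>Formulated for additive maps because the coefficient maps from W \<otimes> F to F, to
  which it is applied, are not given as ring homomorphisms.\<close>

lemma additive_finsum:
  assumes "abelian_group G" "abelian_group H" "h \<in> carrier G \<rightarrow> carrier H"
    "\<And>x y. x \<in> carrier G \<Longrightarrow> y \<in> carrier G \<Longrightarrow> h (x \<oplus>\<^bsub>G\<^esub> y) = h x \<oplus>\<^bsub>H\<^esub> h y"
    and "f \<in> S \<rightarrow> carrier G"
  shows "h (\<Oplus>\<^bsub>G\<^esub>i\<in>S. f i) = (\<Oplus>\<^bsub>H\<^esub>i\<in>S. h (f i))"
proof -
  interpret G: abelian_group G by fact
  interpret H: abelian_group H by fact
  show ?thesis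
    using assms(5)
  proof (induction S rule: infinite_finite_induct)
    case (insert x S)
    then have "f \<in> S \<rightarrow> carrier G" "f x \<in> carrier G" by auto
    moreover from this have "(\<lambda>i. h (f i)) \<in> S \<rightarrow> carrier H" "h (f x) \<in> carrier H" using assms(3) by auto
    ultimately show ?case using insert by (simp add: assms(4))
  qed (simp_all add: additive_zero[OF assms(1-4)])
qed

lemma ring_hom_finsum:
  assumes "ring G" "ring H" "h \<in> ring_hom G H" "f \<in> S \<rightarrow> carrier G"
  shows "h (\<Oplus>\<^bsub>G\<^esub>i\<in>S. f i) = (\<Oplus>\<^bsub>H\<^esub>i\<in>S. h (f i))"
  using assms(3,4)
  by (intro additive_finsum ring.is_abelian_group assms(1,2)) (auto simp: ring_hom_def)

section \<open>Interchange and restriction of finite sums\<close>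

lemma (in abelian_monoid) finsum_swap:
  assumes "finite S" "finite T" "\<And>i j. i \<in> S \<Longrightarrow> j \<in> T \<Longrightarrow> f i j \<in> carrier G"
  shows "(\<Oplus>i\<in>S. \<Oplus>j\<in>T. f i j) = (\<Oplus>j\<in>T. \<Oplus>i\<in>S. f i j)"
  using assms(1,3)
proof (induction S rule: finite_induct)
  case (insert x S)
  have "(\<Oplus>j\<in>T. \<Oplus>i\<in>insert x S. f i j) = (\<Oplus>j\<in>T. f x j \<oplus> (\<Oplus>i\<in>S. f i j))"
    using insert by (intro finsum_cong') (auto intro!: finsum_closed)
  also have "\<dots> = (\<Oplus>j\<in>T. f x j) \<oplus> (\<Oplus>j\<in>T. \<Oplus>i\<in>S. f i j)"
    using insert by (intro finsum_addf) (auto intro!: finsum_closed)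
  finally show ?case using insert by (simp add: finsum_closed Pi_def)
qed (simp add: finsum_zero)

lemma (in abelian_monoid) finsum_if:
  assumes "finite S" "\<And>i. i \<in> S \<Longrightarrow> P i \<Longrightarrow> f i \<in> carrier G"
  shows "(\<Oplus>i\<in>S. if P i then f i else \<zero>) = (\<Oplus>i\<in>{i\<in>S. P i}. f i)"
  using assms by (intro add.finprod_mono_neutral_cong_right) auto

text \<open>Covers F \<otimes> F and W \<otimes> F at once. In \<open>gA_mult\<close> and
  \<open>gB_mult\<close> the resulting degree is chosen before the factors, so products with all
  elements of one component land in one component, where additivity can be used.
  \<open>rA_commute\<close> and \<open>lB_commute\<close> shift by the same middle degree \<gamma>;
  hence a balancing relation multiplied by a symbol is again one.\<close>

locale balanced_tensor = A: ring A + B: ring B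
  for A :: "('a, 'x) ring_scheme" (structure) and B :: "('b, 'y) ring_scheme" (structure) +
  fixes gA :: "'i \<Rightarrow> complex ^ 'n::finite \<Rightarrow> 'a set" and rA :: "'n mero \<Rightarrow> 'a"
    and gB :: "complex ^ 'n \<Rightarrow> 'j \<Rightarrow> 'b set" and lB :: "'n mero \<Rightarrow> 'b"
  assumes gA_carrier: "a \<in> gA \<alpha> \<gamma> \<Longrightarrow> a \<in> carrier A"
    and gB_carrier: "b \<in> gB \<gamma> \<beta> \<Longrightarrow> b \<in> carrier B"
    and gA_mult: "\<exists>\<alpha>''. \<forall>a\<in>gA \<alpha> \<gamma>. \<forall>c\<in>gA \<alpha>' \<gamma>'. a \<otimes>\<^bsub>A\<^esub> c \<in> gA \<alpha>'' (\<gamma> + \<gamma>')"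
    and gB_mult: "\<exists>\<beta>''. \<forall>b\<in>gB \<gamma> \<beta>. \<forall>d\<in>gB \<gamma>' \<beta>'. b \<otimes>\<^bsub>B\<^esub> d \<in> gB (\<gamma> + \<gamma>') \<beta>''"
    and gA_one: "\<exists>\<alpha>. \<one>\<^bsub>A\<^esub> \<in> gA \<alpha> 0" and gB_one: "\<exists>\<beta>. \<one>\<^bsub>B\<^esub> \<in> gB 0 \<beta>"
    and gA_zero: "\<zero>\<^bsub>A\<^esub> \<in> gA \<alpha> \<gamma>" and gB_zero: "\<zero>\<^bsub>B\<^esub> \<in> gB \<gamma> \<beta>"
    and gA_add: "\<lbrakk>a \<in> gA \<alpha> \<gamma>; c \<in> gA \<alpha> \<gamma>\<rbrakk> \<Longrightarrow> a \<oplus>\<^bsub>A\<^esub> c \<in> gA \<alpha> \<gamma>"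
    and gB_add: "\<lbrakk>b \<in> gB \<gamma> \<beta>; d \<in> gB \<gamma> \<beta>\<rbrakk> \<Longrightarrow> b \<oplus>\<^bsub>B\<^esub> d \<in> gB \<gamma> \<beta>"
    and gA_rA: "a \<in> gA \<alpha> \<gamma> \<Longrightarrow> rA f \<otimes>\<^bsub>A\<^esub> a \<in> gA \<alpha> \<gamma>"
    and gB_lB: "b \<in> gB \<gamma> \<beta> \<Longrightarrow> lB f \<otimes>\<^bsub>B\<^esub> b \<in> gB \<gamma> \<beta>"
    and rA_carrier [simp]: "rA f \<in> carrier A" and lB_carrier [simp]: "lB f \<in> carrier B"
    and rA_add: "rA (f + g) = rA f \<oplus>\<^bsub>A\<^esub> rA g"
    and rA_mult: "rA (f * g) = rA f \<otimes>\<^bsub>A\<^esub> rA g"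
    and rA_one: "rA 1 = \<one>\<^bsub>A\<^esub>"
    and rA_commute: "a \<in> gA \<alpha> \<gamma> \<Longrightarrow> a \<otimes>\<^bsub>A\<^esub> rA f = rA (mshift (- \<gamma>) f) \<otimes>\<^bsub>A\<^esub> a"
    and lB_commute: "b \<in> gB \<gamma> \<beta> \<Longrightarrow> b \<otimes>\<^bsub>B\<^esub> lB f = lB (mshift (- \<gamma>) f) \<otimes>\<^bsub>B\<^esub> b"
begin

abbreviation "TF \<equiv> tensor_free A gA B gB"
abbreviation "T \<equiv> tensor A gA rA B gB lB"
abbreviation "cls p \<equiv> tensor_ideal A gA rA B gB lB +>\<^bsub>TF\<^esub> p"
abbreviation pure (infix "\<boxtimes>" 75) where "a \<boxtimes> b \<equiv> pure_tensor A gA rA B gB lB a b"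
abbreviation "sg a b \<equiv> Poly_Mapping.single (a, b)"

lemma pairsI: "a \<in> gA \<alpha> \<gamma> \<Longrightarrow> b \<in> gB \<gamma> \<beta> \<Longrightarrow> (a, b) \<in> tensor_pairs gA gB"
  by (auto simp: tensor_pairs_def)

lemma ideal_T: "ideal (tensor_ideal A gA rA B gB lB) TF"
  and rels_T: "tensor_rels A gA rA B gB lB \<subseteq> tensor_ideal A gA rA B gB lB"
  by (rule tensor_ideal_gen; (rule A.ring_axioms B.ring_axioms gA_one gB_one | erule gA_carrier gB_carrier | erule (1) gA_add gB_add | erule gA_rA gB_lB | use gA_mult gB_mult in blast))+

sublocale I: ideal "tensor_ideal A gA rA B gB lB" TF by (rule ideal_T)
sublocale T: ring T unfolding tensor_def by (rule I.quotient_is_ring)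

lemma TF_simps: "carrier TF = {p. Poly_Mapping.keys p \<subseteq> tensor_pairs gA gB}" "p \<oplus>\<^bsub>TF\<^esub> r = p + r"
  "\<zero>\<^bsub>TF\<^esub> = 0" "\<one>\<^bsub>TF\<^esub> = sg \<one>\<^bsub>A\<^esub> \<one>\<^bsub>B\<^esub> 1"
  by (simp_all add: tensor_free_def monoid_algebra_def)

lemma sg_carrier: "(a, b) \<in> tensor_pairs gA gB \<Longrightarrow> sg a b c \<in> carrier TF"
  by (simp add: TF_simps keys_single)

lemma sg_mult: "sg a b c \<otimes>\<^bsub>TF\<^esub> sg a' b' c' = sg (a \<otimes>\<^bsub>A\<^esub> a') (b \<otimes>\<^bsub>B\<^esub> b') (c * c')"
  by (simp add: tensor_free_def monoid_algebra_mult_single)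

lemma cls_hom: "(\<lambda>p. cls p) \<in> ring_hom TF T"
  using I.rcos_ring_hom unfolding tensor_def .

lemma cls_eqI:
  assumes "p - r \<in> tensor_rels A gA rA B gB lB" "r \<in> carrier TF"
  shows "cls p = cls r"
proof -
  have i: "p - r \<in> tensor_ideal A gA rA B gB lB" using assms rels_T by blast
  then have "p - r \<in> carrier TF" by (rule I.a_Hcarr)
  then have "cls ((p - r) \<oplus>\<^bsub>TF\<^esub> r) = cls (p - r) \<oplus>\<^bsub>T\<^esub> cls r"
    using ring_hom_add[OF cls_hom] assms(2) by blast
  moreover have "cls (p - r) = \<zero>\<^bsub>T\<^esub>"
    using I.a_rcos_const[OF i] by (simp add: tensor_def FactRing_def)
  moreover have "cls r \<in> carrier T" using ring_hom_closed[OF cls_hom assms(2)] .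
  ultimately show ?thesis by (simp add: TF_simps)
qed

lemma pure_carrier [intro]: "a \<in> gA \<alpha> \<gamma> \<Longrightarrow> b \<in> gB \<gamma> \<beta> \<Longrightarrow> a \<boxtimes> b \<in> carrier T"
  unfolding pure_tensor_def by (intro ring_hom_closed[OF cls_hom] sg_carrier pairsI)

lemma pure_add_left:
  assumes "a \<in> gA \<alpha> \<gamma>" "a' \<in> gA \<alpha> \<gamma>" "b \<in> gB \<gamma> \<beta>"
  shows "(a \<oplus>\<^bsub>A\<^esub> a') \<boxtimes> b = a \<boxtimes> b \<oplus>\<^bsub>T\<^esub> a' \<boxtimes> b"
proof -
  have c: "sg a b 1 \<in> carrier TF" "sg a' b 1 \<in> carrier TF" using assms by (auto intro!: sg_carrier pairsI)
  have "cls (sg (a \<oplus>\<^bsub>A\<^esub> a') b 1) = cls (sg a b 1 \<oplus>\<^bsub>TF\<^esub> sg a' b 1)"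
    by (rule cls_eqI) (use c tensor_rels.add_left[where gA = gA and gB = gB, OF assms] in \<open>auto simp: TF_simps diff_diff_add dest!: subsetD[OF Poly_Mapping.keys_add]\<close>)
  then show ?thesis using ring_hom_add[OF cls_hom c] by (simp add: pure_tensor_def)
qed

lemma pure_add_right:
  assumes "a \<in> gA \<alpha> \<gamma>" "b \<in> gB \<gamma> \<beta>" "b' \<in> gB \<gamma> \<beta>"
  shows "a \<boxtimes> (b \<oplus>\<^bsub>B\<^esub> b') = a \<boxtimes> b \<oplus>\<^bsub>T\<^esub> a \<boxtimes> b'"
proof -
  have c: "sg a b 1 \<in> carrier TF" "sg a b' 1 \<in> carrier TF" using assms by (auto intro!: sg_carrier pairsI)
  have "cls (sg a (b \<oplus>\<^bsub>B\<^esub> b') 1) = cls (sg a b 1 \<oplus>\<^bsub>TF\<^esub> sg a b' 1)"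
    by (rule cls_eqI) (use c tensor_rels.add_right[where gA = gA and gB = gB, OF assms] in \<open>auto simp: TF_simps diff_diff_add dest!: subsetD[OF Poly_Mapping.keys_add]\<close>)
  then show ?thesis using ring_hom_add[OF cls_hom c] by (simp add: pure_tensor_def)
qed

lemma pure_balance:
  assumes "a \<in> gA \<alpha> \<gamma>" "b \<in> gB \<gamma> \<beta>"
  shows "(rA f \<otimes>\<^bsub>A\<^esub> a) \<boxtimes> b = a \<boxtimes> (lB f \<otimes>\<^bsub>B\<^esub> b)"
  unfolding pure_tensor_def
  by (rule cls_eqI) (use assms in \<open>auto intro!: tensor_rels.balance sg_carrier pairsI gB_lB\<close>)

lemma pure_mult:
  assumes "a \<in> gA \<alpha> \<gamma>" "b \<in> gB \<gamma> \<beta>" "a' \<in> gA \<alpha>' \<gamma>'" "b' \<in> gB \<gamma>' \<beta>'"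
  shows "a \<boxtimes> b \<otimes>\<^bsub>T\<^esub> a' \<boxtimes> b' = (a \<otimes>\<^bsub>A\<^esub> a') \<boxtimes> (b \<otimes>\<^bsub>B\<^esub> b')"
  unfolding pure_tensor_def
  using ring_hom_mult[OF cls_hom, of "sg a b 1" "sg a' b' 1"] assms
  by (auto simp: sg_mult intro!: sg_carrier pairsI)

lemma pure_one: "\<one>\<^bsub>A\<^esub> \<boxtimes> \<one>\<^bsub>B\<^esub> = \<one>\<^bsub>T\<^esub>"
  unfolding pure_tensor_def using ring_hom_one[OF cls_hom] by (simp add: TF_simps)

lemma pure_zero_left: "b \<in> gB \<gamma> \<beta> \<Longrightarrow> \<zero>\<^bsub>A\<^esub> \<boxtimes> b = \<zero>\<^bsub>T\<^esub>"
  using pure_add_left[OF gA_zero gA_zero, of b \<gamma> \<beta>] pure_carrier[OF gA_zero, of b \<gamma> \<beta>]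
  by (metis A.r_zero A.zero_closed T.add.l_cancel_one)

lemma pure_zero_right: "a \<in> gA \<alpha> \<gamma> \<Longrightarrow> a \<boxtimes> \<zero>\<^bsub>B\<^esub> = \<zero>\<^bsub>T\<^esub>"
  using pure_add_right[OF _ gB_zero gB_zero, of a \<alpha> \<gamma>] pure_carrier[OF _ gB_zero, of a \<alpha> \<gamma>]
  by (metis B.r_zero B.zero_closed T.add.l_cancel_one)

lemma gA_finsum: "(\<And>i. i \<in> S \<Longrightarrow> f i \<in> gA \<alpha> \<gamma>) \<Longrightarrow> (\<Oplus>\<^bsub>A\<^esub>i\<in>S. f i) \<in> gA \<alpha> \<gamma>"
proof (induction S rule: infinite_finite_induct)
  case (insert x S)
  then show ?case by (subst A.finsum_insert) (auto intro: gA_add dest: gA_carrier)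
qed (simp_all add: gA_zero)

lemma gB_finsum: "(\<And>i. i \<in> S \<Longrightarrow> f i \<in> gB \<gamma> \<beta>) \<Longrightarrow> (\<Oplus>\<^bsub>B\<^esub>i\<in>S. f i) \<in> gB \<gamma> \<beta>"
proof (induction S rule: infinite_finite_induct)
  case (insert x S)
  then show ?case by (subst B.finsum_insert) (auto intro: gB_add dest: gB_carrier)
qed (simp_all add: gB_zero)

lemma pure_finsum_left:
  assumes "b \<in> gB \<gamma> \<beta>" "\<And>i. i \<in> S \<Longrightarrow> f i \<in> gA \<alpha> \<gamma>"
  shows "(\<Oplus>\<^bsub>A\<^esub>i\<in>S. f i) \<boxtimes> b = (\<Oplus>\<^bsub>T\<^esub>i\<in>S. f i \<boxtimes> b)"
  using assms(2)
proof (induction S rule: infinite_finite_induct)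
  case (insert x S)
  then have "f \<in> S \<rightarrow> carrier A" "f x \<in> carrier A" "(\<lambda>i. f i \<boxtimes> b) \<in> S \<rightarrow> carrier T" "f x \<boxtimes> b \<in> carrier T"
    using assms(1) by (auto intro: gA_carrier)
  then show ?case
    using insert assms(1) by (simp add: pure_add_left[of _ \<alpha> \<gamma> _ _ \<beta>] gA_finsum)
qed (simp_all add: pure_zero_left[OF assms(1)])

lemma pure_finsum_right:
  assumes "a \<in> gA \<alpha> \<gamma>" "\<And>i. i \<in> S \<Longrightarrow> f i \<in> gB \<gamma> \<beta>"
  shows "a \<boxtimes> (\<Oplus>\<^bsub>B\<^esub>i\<in>S. f i) = (\<Oplus>\<^bsub>T\<^esub>i\<in>S. a \<boxtimes> f i)"
  using assms(2)
proof (induction S rule: infinite_finite_induct)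
  case (insert x S)
  then have "f \<in> S \<rightarrow> carrier B" "f x \<in> carrier B" "(\<lambda>i. a \<boxtimes> f i) \<in> S \<rightarrow> carrier T" "a \<boxtimes> f x \<in> carrier T"
    using assms(1) by (auto intro: gB_carrier)
  then show ?case
    using insert assms(1) by (simp add: pure_add_right[of _ \<alpha> \<gamma> _ \<beta>] gB_finsum)
qed (simp_all add: pure_zero_right[OF assms(1)])

text \<open>Universal property for balanced biadditive maps into an abelian group. Since \<phi> need
  not be multiplicative, the kernel of its extension \<Psi> is a priori no ideal, although the
  tensor product divides by a generated ideal. The way out is \<open>N\<close>, the largest
  two-sided ideal inside that kernel: it suffices that the generators lie in it.\<close>

lemma tensor_lift:
  assumes X: "abelian_group X"
    and c: "\<And>\<alpha> \<gamma> \<beta> a b. a \<in> gA \<alpha> \<gamma> \<Longrightarrow> b \<in> gB \<gamma> \<beta> \<Longrightarrow> \<phi> a b \<in> carrier X"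
    and l: "\<And>\<alpha> \<gamma> \<beta> a a' b. \<lbrakk>a \<in> gA \<alpha> \<gamma>; a' \<in> gA \<alpha> \<gamma>; b \<in> gB \<gamma> \<beta>\<rbrakk> \<Longrightarrow> \<phi> (a \<oplus>\<^bsub>A\<^esub> a') b = \<phi> a b \<oplus>\<^bsub>X\<^esub> \<phi> a' b"
    and r: "\<And>\<alpha> \<gamma> \<beta> a b b'. \<lbrakk>a \<in> gA \<alpha> \<gamma>; b \<in> gB \<gamma> \<beta>; b' \<in> gB \<gamma> \<beta>\<rbrakk> \<Longrightarrow> \<phi> a (b \<oplus>\<^bsub>B\<^esub> b') = \<phi> a b \<oplus>\<^bsub>X\<^esub> \<phi> a b'"
    and bal: "\<And>\<alpha> \<gamma> \<beta> a b f. \<lbrakk>a \<in> gA \<alpha> \<gamma>; b \<in> gB \<gamma> \<beta>\<rbrakk> \<Longrightarrow> \<phi> (rA f \<otimes>\<^bsub>A\<^esub> a) b = \<phi> a (lB f \<otimes>\<^bsub>B\<^esub> b)"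
  obtains \<Phi> where "\<Phi> \<in> carrier T \<rightarrow> carrier X"
    "\<And>x y. x \<in> carrier T \<Longrightarrow> y \<in> carrier T \<Longrightarrow> \<Phi> (x \<oplus>\<^bsub>T\<^esub> y) = \<Phi> x \<oplus>\<^bsub>X\<^esub> \<Phi> y"
    "\<And>\<alpha> \<gamma> \<beta> a b. a \<in> gA \<alpha> \<gamma> \<Longrightarrow> b \<in> gB \<gamma> \<beta> \<Longrightarrow> \<Phi> (a \<boxtimes> b) = \<phi> a b"
proof -
  interpret X: abelian_group X by fact
  \<comment> \<open>The group \<open>X\<close> carries no scalars, so a complex coefficient k is
    absorbed into the left tensor factor as \<open>rA (mconst k)\<close>.\<close>
  define m where "m z k = \<phi> (rA (mconst k) \<otimes>\<^bsub>A\<^esub> fst z) (snd z)" for z k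
  have m_closed: "m z k \<in> carrier X" if "z \<in> tensor_pairs gA gB" for z k
    using that unfolding m_def tensor_pairs_def by (auto intro!: c[OF gA_rA])
  have m_add: "m z (k + k') = m z k \<oplus>\<^bsub>X\<^esub> m z k'" if z: "z \<in> tensor_pairs gA gB" for z k k'
  proof -
    obtain \<alpha> \<gamma> \<beta> where "fst z \<in> gA \<alpha> \<gamma>" "snd z \<in> gB \<gamma> \<beta>" using z by (auto simp: tensor_pairs_def)
    then show ?thesis
      by (simp add: m_def mconst_add rA_add A.l_distr gA_carrier l[OF gA_rA gA_rA])
  qed
  have m_0: "m z 0 = \<zero>\<^bsub>X\<^esub>" if z: "z \<in> tensor_pairs gA gB" for z
    using m_add[OF z, of 0 0] m_closed[OF z, of 0] by (metis X.add.l_cancel_one add_0)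
  define \<Psi> where "\<Psi> p = (\<Oplus>\<^bsub>X\<^esub>z\<in>Poly_Mapping.keys p. m z (Poly_Mapping.lookup p z))" for p
  have sup: "\<Psi> p = (\<Oplus>\<^bsub>X\<^esub>z\<in>S. m z (Poly_Mapping.lookup p z))"
    if "finite S" "Poly_Mapping.keys p \<subseteq> S" "S \<subseteq> tensor_pairs gA gB" for p S
    unfolding \<Psi>_def using that m_closed
    by (intro X.add.finprod_mono_neutral_cong_left) (auto simp: in_keys_iff m_0)
  have \<Psi>_closed: "\<Psi> p \<in> carrier X" if "p \<in> carrier TF" for p
    using that m_closed unfolding \<Psi>_def TF_simps by (intro X.finsum_closed) auto
  have \<Psi>_add: "\<Psi> (p + s) = \<Psi> p \<oplus>\<^bsub>X\<^esub> \<Psi> s" if ps: "p \<in> carrier TF" "s \<in> carrier TF" for p s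
  proof -
    let ?S = "Poly_Mapping.keys p \<union> Poly_Mapping.keys s"
    have S: "finite ?S" "?S \<subseteq> tensor_pairs gA gB" using ps by (auto simp: TF_simps)
    have "\<Psi> (p + s) = (\<Oplus>\<^bsub>X\<^esub>z\<in>?S. m z (Poly_Mapping.lookup p z) \<oplus>\<^bsub>X\<^esub> m z (Poly_Mapping.lookup s z))"
      unfolding sup[OF S(1) Poly_Mapping.keys_add S(2)]
      using m_closed S(2) by (intro X.finsum_cong') (auto simp: lookup_add intro!: m_add)
    also have "\<dots> = \<Psi> p \<oplus>\<^bsub>X\<^esub> \<Psi> s"
      using m_closed S by (subst X.finsum_addf) (auto simp: sup[OF S(1) _ S(2)])
    finally show ?thesis .
  qed
  have \<Psi>_sg: "\<Psi> (sg a b k) = \<phi> (rA (mconst k) \<otimes>\<^bsub>A\<^esub> a) b" if "(a, b) \<in> tensor_pairs gA gB" for a b k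
    using that m_closed[OF that, of k] by (subst sup[of "{(a, b)}"]) (auto simp: m_def)
  have \<Psi>_0: "\<Psi> 0 = \<zero>\<^bsub>X\<^esub>" by (simp add: \<Psi>_def)
  note distrib = I.l_distr[unfolded TF_simps(2)] I.r_distr[unfolded TF_simps(2)]
  have dist3: "x \<otimes>\<^bsub>TF\<^esub> (p + s) \<otimes>\<^bsub>TF\<^esub> y = x \<otimes>\<^bsub>TF\<^esub> p \<otimes>\<^bsub>TF\<^esub> y + x \<otimes>\<^bsub>TF\<^esub> s \<otimes>\<^bsub>TF\<^esub> y"
    if "x \<in> carrier TF" "p \<in> carrier TF" "s \<in> carrier TF" "y \<in> carrier TF" for x p s y
    using that by (simp add: distrib)
  \<comment> \<open>By additivity it is enough to test symbols on both sides; first y is decomposed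
    with a fixed symbol on the left, then x.\<close>
  have sandwich: "\<Psi> (x \<otimes>\<^bsub>TF\<^esub> p \<otimes>\<^bsub>TF\<^esub> y) = \<Psi> (x \<otimes>\<^bsub>TF\<^esub> s \<otimes>\<^bsub>TF\<^esub> y)"
    if ps: "p \<in> carrier TF" "s \<in> carrier TF" and xy: "x \<in> carrier TF" "y \<in> carrier TF"
      and e: "\<And>a b a' b' k k'. (a, b) \<in> tensor_pairs gA gB \<Longrightarrow> (a', b') \<in> tensor_pairs gA gB \<Longrightarrow>
        \<Psi> (sg a b k \<otimes>\<^bsub>TF\<^esub> p \<otimes>\<^bsub>TF\<^esub> sg a' b' k') = \<Psi> (sg a b k \<otimes>\<^bsub>TF\<^esub> s \<otimes>\<^bsub>TF\<^esub> sg a' b' k')" for p s x y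
  proof -
    have 1: "y \<in> carrier TF \<and> \<Psi> (sg a b k \<otimes>\<^bsub>TF\<^esub> p \<otimes>\<^bsub>TF\<^esub> y) = \<Psi> (sg a b k \<otimes>\<^bsub>TF\<^esub> s \<otimes>\<^bsub>TF\<^esub> y)"
      if ab: "(a, b) \<in> tensor_pairs gA gB" for a b k
    proof (rule keys_induct[of y "tensor_pairs gA gB"])
      show "Poly_Mapping.keys y \<subseteq> tensor_pairs gA gB" using xy by (simp add: TF_simps)
      show "0 \<in> carrier TF \<and> \<Psi> (sg a b k \<otimes>\<^bsub>TF\<^esub> p \<otimes>\<^bsub>TF\<^esub> 0) = \<Psi> (sg a b k \<otimes>\<^bsub>TF\<^esub> s \<otimes>\<^bsub>TF\<^esub> 0)"
        using I.r_null[unfolded TF_simps(3)] ps sg_carrier[OF ab] I.zero_closed[unfolded TF_simps(3)] by simp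
      fix u k' y assume "u \<in> tensor_pairs gA gB"
        and y: "y \<in> carrier TF \<and> \<Psi> (sg a b k \<otimes>\<^bsub>TF\<^esub> p \<otimes>\<^bsub>TF\<^esub> y) = \<Psi> (sg a b k \<otimes>\<^bsub>TF\<^esub> s \<otimes>\<^bsub>TF\<^esub> y)"
      then show "Poly_Mapping.single u k' + y \<in> carrier TF \<and> \<Psi> (sg a b k \<otimes>\<^bsub>TF\<^esub> p \<otimes>\<^bsub>TF\<^esub> (Poly_Mapping.single u k' + y))
         = \<Psi> (sg a b k \<otimes>\<^bsub>TF\<^esub> s \<otimes>\<^bsub>TF\<^esub> (Poly_Mapping.single u k' + y))"
        using ps sg_carrier[OF ab] sg_carrier e[OF ab] I.a_closed[unfolded TF_simps(2)]
        by (cases u) (simp add: distrib \<Psi>_add)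
    qed
    have "x \<in> carrier TF \<and> \<Psi> (x \<otimes>\<^bsub>TF\<^esub> p \<otimes>\<^bsub>TF\<^esub> y) = \<Psi> (x \<otimes>\<^bsub>TF\<^esub> s \<otimes>\<^bsub>TF\<^esub> y)"
    proof (rule keys_induct[of x "tensor_pairs gA gB"])
      show "Poly_Mapping.keys x \<subseteq> tensor_pairs gA gB" using xy by (simp add: TF_simps)
      show "0 \<in> carrier TF \<and> \<Psi> (0 \<otimes>\<^bsub>TF\<^esub> p \<otimes>\<^bsub>TF\<^esub> y) = \<Psi> (0 \<otimes>\<^bsub>TF\<^esub> s \<otimes>\<^bsub>TF\<^esub> y)"
        using I.l_null[unfolded TF_simps(3)] ps xy I.zero_closed[unfolded TF_simps(3)] by simp
      fix u k x assume "u \<in> tensor_pairs gA gB"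
        and "x \<in> carrier TF \<and> \<Psi> (x \<otimes>\<^bsub>TF\<^esub> p \<otimes>\<^bsub>TF\<^esub> y) = \<Psi> (x \<otimes>\<^bsub>TF\<^esub> s \<otimes>\<^bsub>TF\<^esub> y)"
      then show "Poly_Mapping.single u k + x \<in> carrier TF \<and> \<Psi> ((Poly_Mapping.single u k + x) \<otimes>\<^bsub>TF\<^esub> p \<otimes>\<^bsub>TF\<^esub> y)
         = \<Psi> ((Poly_Mapping.single u k + x) \<otimes>\<^bsub>TF\<^esub> s \<otimes>\<^bsub>TF\<^esub> y)"
        using ps xy sg_carrier 1 I.a_closed[unfolded TF_simps(2)]
        by (cases u) (simp add: distrib \<Psi>_add)
    qed
    then show ?thesis ..
  qed
  \<comment> \<open>The sandwich makes \<open>N\<close> an ideal for free; the relations lie in it because multiplying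
    a relation by symbols on both sides gives again a relation, up to a scalar.\<close>
  define N where "N = {p \<in> carrier TF. \<forall>x\<in>carrier TF. \<forall>y\<in>carrier TF. \<Psi> (x \<otimes>\<^bsub>TF\<^esub> p \<otimes>\<^bsub>TF\<^esub> y) = \<zero>\<^bsub>X\<^esub>}"
  have NI: "p - s \<in> N" if ps: "p \<in> carrier TF" "s \<in> carrier TF"
      and e: "\<And>a b a' b' k k'. (a, b) \<in> tensor_pairs gA gB \<Longrightarrow> (a', b') \<in> tensor_pairs gA gB \<Longrightarrow>
        \<Psi> (sg a b k \<otimes>\<^bsub>TF\<^esub> p \<otimes>\<^bsub>TF\<^esub> sg a' b' k') = \<Psi> (sg a b k \<otimes>\<^bsub>TF\<^esub> s \<otimes>\<^bsub>TF\<^esub> sg a' b' k')" for p s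
  proof -
    have d: "p - s \<in> carrier TF" using ps keys_diff[of p s] by (auto simp: TF_simps)
    have "\<Psi> (x \<otimes>\<^bsub>TF\<^esub> (p - s) \<otimes>\<^bsub>TF\<^esub> y) = \<zero>\<^bsub>X\<^esub>" if xy: "x \<in> carrier TF" "y \<in> carrier TF" for x y
    proof -
      have "x \<otimes>\<^bsub>TF\<^esub> p \<otimes>\<^bsub>TF\<^esub> y = x \<otimes>\<^bsub>TF\<^esub> ((p - s) + s) \<otimes>\<^bsub>TF\<^esub> y" by simp
      also have "\<dots> = x \<otimes>\<^bsub>TF\<^esub> (p - s) \<otimes>\<^bsub>TF\<^esub> y + x \<otimes>\<^bsub>TF\<^esub> s \<otimes>\<^bsub>TF\<^esub> y"
        by (rule dist3[OF xy(1) d ps(2) xy(2)])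
      finally have "\<Psi> (x \<otimes>\<^bsub>TF\<^esub> p \<otimes>\<^bsub>TF\<^esub> y) = \<Psi> (x \<otimes>\<^bsub>TF\<^esub> (p - s) \<otimes>\<^bsub>TF\<^esub> y) \<oplus>\<^bsub>X\<^esub> \<Psi> (x \<otimes>\<^bsub>TF\<^esub> s \<otimes>\<^bsub>TF\<^esub> y)"
        using d ps xy by (simp add: \<Psi>_add)
      then show ?thesis
        using sandwich[OF ps xy e] d ps xy by (simp add: \<Psi>_closed)
    qed
    then show ?thesis using d by (simp add: N_def)
  qed
  have N: "ideal N TF"
  proof (rule idealI[OF I.ring_axioms])
    show "subgroup N (add_monoid TF)"
    proof (rule I.add.subgroupI)
      show "N \<noteq> {}"
        using \<Psi>_0 by (auto simp: N_def simp flip: TF_simps(3) intro!: exI[of _ "\<zero>\<^bsub>TF\<^esub>"])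
      fix p assume p: "p \<in> N"
      show "\<ominus>\<^bsub>TF\<^esub> p \<in> N"
        unfolding N_def
      proof (intro CollectI conjI ballI)
        show c: "\<ominus>\<^bsub>TF\<^esub> p \<in> carrier TF" using p by (simp add: N_def)
        fix x y assume xy: "x \<in> carrier TF" "y \<in> carrier TF"
        have "x \<otimes>\<^bsub>TF\<^esub> (\<ominus>\<^bsub>TF\<^esub> p) \<otimes>\<^bsub>TF\<^esub> y = (\<ominus>\<^bsub>TF\<^esub> x) \<otimes>\<^bsub>TF\<^esub> p \<otimes>\<^bsub>TF\<^esub> y"
          using p xy by (simp add: N_def I.l_minus I.r_minus)
        then show "\<Psi> (x \<otimes>\<^bsub>TF\<^esub> (\<ominus>\<^bsub>TF\<^esub> p) \<otimes>\<^bsub>TF\<^esub> y) = \<zero>\<^bsub>X\<^esub>" using p xy by (simp add: N_def)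
      qed
    next
      fix p s assume "p \<in> N" "s \<in> N"
      then show "p \<oplus>\<^bsub>TF\<^esub> s \<in> N" using I.a_closed[of p s] by (auto simp: N_def TF_simps(2) distrib \<Psi>_add)
    qed (auto simp: N_def)
    fix p x assume p: "p \<in> N" and x: "x \<in> carrier TF"
    have "y \<otimes>\<^bsub>TF\<^esub> (x \<otimes>\<^bsub>TF\<^esub> p) \<otimes>\<^bsub>TF\<^esub> z = (y \<otimes>\<^bsub>TF\<^esub> x) \<otimes>\<^bsub>TF\<^esub> p \<otimes>\<^bsub>TF\<^esub> z"
      "y \<otimes>\<^bsub>TF\<^esub> (p \<otimes>\<^bsub>TF\<^esub> x) \<otimes>\<^bsub>TF\<^esub> z = y \<otimes>\<^bsub>TF\<^esub> p \<otimes>\<^bsub>TF\<^esub> (x \<otimes>\<^bsub>TF\<^esub> z)"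
      if "y \<in> carrier TF" "z \<in> carrier TF" for y z using that p x by (simp_all add: N_def I.m_assoc)
    then show "x \<otimes>\<^bsub>TF\<^esub> p \<in> N" "p \<otimes>\<^bsub>TF\<^esub> x \<in> N" using p x by (simp_all add: N_def)
  qed
  have "tensor_rels A gA rA B gB lB \<subseteq> N"
  proof
    fix p assume "p \<in> tensor_rels A gA rA B gB lB"
    \<comment> \<open>A single f' serves both factors: x and x' share their middle degree, and that
      degree shifts f on either side. The degrees found for x a y and x' b y' likewise share the
      middle component, so the sandwiched pairs are admissible symbols.\<close>
    have sand: "\<exists>\<alpha>' \<delta> \<beta>'. (\<forall>a\<in>gA \<alpha> \<gamma>. x \<otimes>\<^bsub>A\<^esub> a \<otimes>\<^bsub>A\<^esub> y \<in> gA \<alpha>' \<delta>) \<and> (\<forall>b\<in>gB \<gamma> \<beta>. x' \<otimes>\<^bsub>B\<^esub> b \<otimes>\<^bsub>B\<^esub> y' \<in> gB \<delta> \<beta>') \<and>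
        x \<in> carrier A \<and> y \<in> carrier A \<and> x' \<in> carrier B \<and> y' \<in> carrier B \<and>
        (\<forall>f. \<exists>f'. x \<otimes>\<^bsub>A\<^esub> rA f = rA f' \<otimes>\<^bsub>A\<^esub> x \<and> x' \<otimes>\<^bsub>B\<^esub> lB f = lB f' \<otimes>\<^bsub>B\<^esub> x') \<and>
        (\<forall>k. x \<otimes>\<^bsub>A\<^esub> rA (mconst k) = rA (mconst k) \<otimes>\<^bsub>A\<^esub> x)"
      if z: "(x, x') \<in> tensor_pairs gA gB" "(y, y') \<in> tensor_pairs gA gB" for x x' y y' \<alpha> \<beta> \<gamma>
    proof -
      obtain \<alpha>1 \<gamma>1 \<beta>1 \<alpha>2 \<gamma>2 \<beta>2 where m: "x \<in> gA \<alpha>1 \<gamma>1" "x' \<in> gB \<gamma>1 \<beta>1" "y \<in> gA \<alpha>2 \<gamma>2" "y' \<in> gB \<gamma>2 \<beta>2"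
        using z by (auto simp: tensor_pairs_def)
      obtain \<alpha>3 \<beta>3 where 3: "\<forall>a\<in>gA \<alpha> \<gamma>. x \<otimes>\<^bsub>A\<^esub> a \<in> gA \<alpha>3 (\<gamma>1 + \<gamma>)" "\<forall>b\<in>gB \<gamma> \<beta>. x' \<otimes>\<^bsub>B\<^esub> b \<in> gB (\<gamma>1 + \<gamma>) \<beta>3"
        using gA_mult[of \<alpha>1 \<gamma>1 \<alpha> \<gamma>] gB_mult[of \<gamma>1 \<beta>1 \<gamma> \<beta>] m by blast
      obtain \<alpha>4 \<beta>4 where 4: "\<forall>a\<in>gA \<alpha>3 (\<gamma>1 + \<gamma>). a \<otimes>\<^bsub>A\<^esub> y \<in> gA \<alpha>4 (\<gamma>1 + \<gamma> + \<gamma>2)"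
          "\<forall>b\<in>gB (\<gamma>1 + \<gamma>) \<beta>3. b \<otimes>\<^bsub>B\<^esub> y' \<in> gB (\<gamma>1 + \<gamma> + \<gamma>2) \<beta>4"
        using gA_mult[of \<alpha>3 "\<gamma>1 + \<gamma>" \<alpha>2 \<gamma>2] gB_mult[of "\<gamma>1 + \<gamma>" \<beta>3 \<gamma>2 \<beta>2] m by blast
      show ?thesis
        by (rule exI[of _ \<alpha>4], rule exI[of _ "\<gamma>1 + \<gamma> + \<gamma>2"], rule exI[of _ \<beta>4])
           (use 3 4 m rA_commute[OF m(1)] lB_commute[OF m(2)] in \<open>auto intro: gA_carrier gB_carrier\<close>)
    qed
    from \<open>p \<in> tensor_rels A gA rA B gB lB\<close> show "p \<in> N"
    proof cases
      case (add_left a \<alpha> \<gamma> a' b \<beta>)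
      have "sg (a \<oplus>\<^bsub>A\<^esub> a') b 1 - (sg a b 1 + sg a' b 1) \<in> N"
      proof (rule NI)
        fix x x' y y' k k' assume z: "(x, x') \<in> tensor_pairs gA gB" "(y, y') \<in> tensor_pairs gA gB"
        obtain \<alpha>' \<delta> \<beta>' where s: "\<forall>a\<in>gA \<alpha> \<gamma>. x \<otimes>\<^bsub>A\<^esub> a \<otimes>\<^bsub>A\<^esub> y \<in> gA \<alpha>' \<delta>" "\<forall>b\<in>gB \<gamma> \<beta>. x' \<otimes>\<^bsub>B\<^esub> b \<otimes>\<^bsub>B\<^esub> y' \<in> gB \<delta> \<beta>'"
          "x \<in> carrier A" "y \<in> carrier A"
          using sand[OF z, of \<alpha> \<gamma> \<beta>] by auto
        note g = s(1)[rule_format] s(2)[rule_format]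
        note g1 = g(1)[OF add_left(2)] and g2 = g(1)[OF add_left(3)] and g3 = g(2)[OF add_left(4)]
        note p1 = pairsI[OF g1 g3] and p2 = pairsI[OF g2 g3]
        have "\<Psi> (sg x x' k \<otimes>\<^bsub>TF\<^esub> sg (a \<oplus>\<^bsub>A\<^esub> a') b 1 \<otimes>\<^bsub>TF\<^esub> sg y y' k') =
          \<phi> (rA (mconst (k * k')) \<otimes>\<^bsub>A\<^esub> (x \<otimes>\<^bsub>A\<^esub> a \<otimes>\<^bsub>A\<^esub> y) \<oplus>\<^bsub>A\<^esub> rA (mconst (k * k')) \<otimes>\<^bsub>A\<^esub> (x \<otimes>\<^bsub>A\<^esub> a' \<otimes>\<^bsub>A\<^esub> y)) (x' \<otimes>\<^bsub>B\<^esub> b \<otimes>\<^bsub>B\<^esub> y')"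
          using add_left(2-4) s(3,4) pairsI[OF g(1)[OF gA_add[OF add_left(2,3)]] g(2)[OF add_left(4)]]
          by (simp add: sg_mult \<Psi>_sg A.l_distr A.r_distr gA_carrier)
        also have "\<dots> = \<Psi> (sg (x \<otimes>\<^bsub>A\<^esub> a \<otimes>\<^bsub>A\<^esub> y) (x' \<otimes>\<^bsub>B\<^esub> b \<otimes>\<^bsub>B\<^esub> y') (k * k') + sg (x \<otimes>\<^bsub>A\<^esub> a' \<otimes>\<^bsub>A\<^esub> y) (x' \<otimes>\<^bsub>B\<^esub> b \<otimes>\<^bsub>B\<^esub> y') (k * k'))"
          using l[OF gA_rA[OF g1] gA_rA[OF g2] g3] by (simp add: \<Psi>_add sg_carrier[OF p1] sg_carrier[OF p2] \<Psi>_sg[OF p1] \<Psi>_sg[OF p2])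
        finally show "\<Psi> (sg x x' k \<otimes>\<^bsub>TF\<^esub> sg (a \<oplus>\<^bsub>A\<^esub> a') b 1 \<otimes>\<^bsub>TF\<^esub> sg y y' k') = \<Psi> (sg x x' k \<otimes>\<^bsub>TF\<^esub> (sg a b 1 + sg a' b 1) \<otimes>\<^bsub>TF\<^esub> sg y y' k')"
          using sg_carrier[OF z(1)] sg_carrier[OF z(2)] sg_carrier[OF pairsI[OF add_left(2,4)]] sg_carrier[OF pairsI[OF add_left(3,4)]] by (simp add: dist3 sg_mult)
      qed (use add_left(2-4) in \<open>auto intro!: sg_carrier pairsI gA_add I.a_closed[unfolded TF_simps(2)]\<close>)
      then show ?thesis using add_left(1) by (simp add: diff_diff_add)
    next
      case (add_right a \<alpha> \<gamma> b \<beta> b')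
      have "sg a (b \<oplus>\<^bsub>B\<^esub> b') 1 - (sg a b 1 + sg a b' 1) \<in> N"
      proof (rule NI)
        fix x x' y y' k k' assume z: "(x, x') \<in> tensor_pairs gA gB" "(y, y') \<in> tensor_pairs gA gB"
        obtain \<alpha>' \<delta> \<beta>' where s: "\<forall>a\<in>gA \<alpha> \<gamma>. x \<otimes>\<^bsub>A\<^esub> a \<otimes>\<^bsub>A\<^esub> y \<in> gA \<alpha>' \<delta>" "\<forall>b\<in>gB \<gamma> \<beta>. x' \<otimes>\<^bsub>B\<^esub> b \<otimes>\<^bsub>B\<^esub> y' \<in> gB \<delta> \<beta>'"
          "x' \<in> carrier B" "y' \<in> carrier B"
          using sand[OF z, of \<alpha> \<gamma> \<beta>] by auto
        note g = s(1)[rule_format] s(2)[rule_format]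
        note g1 = g(1)[OF add_right(2)] and g2 = g(2)[OF add_right(3)] and g3 = g(2)[OF add_right(4)]
        note p1 = pairsI[OF g1 g2] and p2 = pairsI[OF g1 g3]
        have "\<Psi> (sg x x' k \<otimes>\<^bsub>TF\<^esub> sg a (b \<oplus>\<^bsub>B\<^esub> b') 1 \<otimes>\<^bsub>TF\<^esub> sg y y' k') =
          \<phi> (rA (mconst (k * k')) \<otimes>\<^bsub>A\<^esub> (x \<otimes>\<^bsub>A\<^esub> a \<otimes>\<^bsub>A\<^esub> y)) (x' \<otimes>\<^bsub>B\<^esub> b \<otimes>\<^bsub>B\<^esub> y' \<oplus>\<^bsub>B\<^esub> x' \<otimes>\<^bsub>B\<^esub> b' \<otimes>\<^bsub>B\<^esub> y')"
          using add_right(2-4) s(3,4) pairsI[OF g(1)[OF add_right(2)] g(2)[OF gB_add[OF add_right(3,4)]]]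
          by (simp add: sg_mult \<Psi>_sg B.l_distr B.r_distr gB_carrier)
        also have "\<dots> = \<Psi> (sg (x \<otimes>\<^bsub>A\<^esub> a \<otimes>\<^bsub>A\<^esub> y) (x' \<otimes>\<^bsub>B\<^esub> b \<otimes>\<^bsub>B\<^esub> y') (k * k') + sg (x \<otimes>\<^bsub>A\<^esub> a \<otimes>\<^bsub>A\<^esub> y) (x' \<otimes>\<^bsub>B\<^esub> b' \<otimes>\<^bsub>B\<^esub> y') (k * k'))"
          using r[OF gA_rA[OF g1] g2 g3] by (simp add: \<Psi>_add sg_carrier[OF p1] sg_carrier[OF p2] \<Psi>_sg[OF p1] \<Psi>_sg[OF p2])
        finally show "\<Psi> (sg x x' k \<otimes>\<^bsub>TF\<^esub> sg a (b \<oplus>\<^bsub>B\<^esub> b') 1 \<otimes>\<^bsub>TF\<^esub> sg y y' k') = \<Psi> (sg x x' k \<otimes>\<^bsub>TF\<^esub> (sg a b 1 + sg a b' 1) \<otimes>\<^bsub>TF\<^esub> sg y y' k')"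
          using sg_carrier[OF z(1)] sg_carrier[OF z(2)] sg_carrier[OF pairsI[OF add_right(2,3)]] sg_carrier[OF pairsI[OF add_right(2,4)]] by (simp add: dist3 sg_mult)
      qed (use add_right(2-4) in \<open>auto intro!: sg_carrier pairsI gB_add I.a_closed[unfolded TF_simps(2)]\<close>)
      then show ?thesis using add_right(1) by (simp add: diff_diff_add)
    next
      case (scalar a \<alpha> \<gamma> b \<beta> h)
      show ?thesis unfolding scalar(1)
      proof (rule NI)
        fix x x' y y' k k' assume z: "(x, x') \<in> tensor_pairs gA gB" "(y, y') \<in> tensor_pairs gA gB"
        obtain \<alpha>' \<delta> \<beta>' where s: "\<forall>a\<in>gA \<alpha> \<gamma>. x \<otimes>\<^bsub>A\<^esub> a \<otimes>\<^bsub>A\<^esub> y \<in> gA \<alpha>' \<delta>" "\<forall>b\<in>gB \<gamma> \<beta>. x' \<otimes>\<^bsub>B\<^esub> b \<otimes>\<^bsub>B\<^esub> y' \<in> gB \<delta> \<beta>'"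
          "x \<in> carrier A" "y \<in> carrier A" "\<forall>k. x \<otimes>\<^bsub>A\<^esub> rA (mconst k) = rA (mconst k) \<otimes>\<^bsub>A\<^esub> x"
          using sand[OF z, of \<alpha> \<gamma> \<beta>] by auto
        note g = s(1)[rule_format] s(2)[rule_format]
        have "x \<otimes>\<^bsub>A\<^esub> (rA (mconst h) \<otimes>\<^bsub>A\<^esub> a) \<otimes>\<^bsub>A\<^esub> y = rA (mconst h) \<otimes>\<^bsub>A\<^esub> (x \<otimes>\<^bsub>A\<^esub> a \<otimes>\<^bsub>A\<^esub> y)"
          using s(3-5) scalar(2) by (simp add: gA_carrier A.m_assoc[symmetric])
        then have "rA (mconst (k * k')) \<otimes>\<^bsub>A\<^esub> (x \<otimes>\<^bsub>A\<^esub> (rA (mconst h) \<otimes>\<^bsub>A\<^esub> a) \<otimes>\<^bsub>A\<^esub> y) = rA (mconst (k * h * k')) \<otimes>\<^bsub>A\<^esub> (x \<otimes>\<^bsub>A\<^esub> a \<otimes>\<^bsub>A\<^esub> y)"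
          using s(3-4) scalar(2) by (simp add: gA_carrier A.m_assoc[symmetric] flip: rA_mult mconst_mult) (simp add: mult_ac)
        then show "\<Psi> (sg x x' k \<otimes>\<^bsub>TF\<^esub> sg (rA (mconst h) \<otimes>\<^bsub>A\<^esub> a) b 1 \<otimes>\<^bsub>TF\<^esub> sg y y' k') = \<Psi> (sg x x' k \<otimes>\<^bsub>TF\<^esub> sg a b h \<otimes>\<^bsub>TF\<^esub> sg y y' k')"
          by (simp add: sg_mult \<Psi>_sg[OF pairsI[OF g(1)[OF gA_rA[OF scalar(2)]] g(2)[OF scalar(3)]]]
              \<Psi>_sg[OF pairsI[OF g(1)[OF scalar(2)] g(2)[OF scalar(3)]]])
      qed (use scalar(2-3) in \<open>auto intro!: sg_carrier pairsI gA_rA\<close>)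
    next
      case (balance a \<alpha> \<gamma> b \<beta> f)
      show ?thesis unfolding balance(1)
      proof (rule NI)
        fix x x' y y' k k' assume z: "(x, x') \<in> tensor_pairs gA gB" "(y, y') \<in> tensor_pairs gA gB"
        obtain \<alpha>' \<delta> \<beta>' where s: "\<forall>a\<in>gA \<alpha> \<gamma>. x \<otimes>\<^bsub>A\<^esub> a \<otimes>\<^bsub>A\<^esub> y \<in> gA \<alpha>' \<delta>" "\<forall>b\<in>gB \<gamma> \<beta>. x' \<otimes>\<^bsub>B\<^esub> b \<otimes>\<^bsub>B\<^esub> y' \<in> gB \<delta> \<beta>'"
          "x \<in> carrier A" "y \<in> carrier A" "x' \<in> carrier B" "y' \<in> carrier B"
          "\<forall>f. \<exists>f'. x \<otimes>\<^bsub>A\<^esub> rA f = rA f' \<otimes>\<^bsub>A\<^esub> x \<and> x' \<otimes>\<^bsub>B\<^esub> lB f = lB f' \<otimes>\<^bsub>B\<^esub> x'"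
          using sand[OF z, of \<alpha> \<gamma> \<beta>] by auto
        note g = s(1)[rule_format] s(2)[rule_format]
        obtain f' where f': "x \<otimes>\<^bsub>A\<^esub> rA f = rA f' \<otimes>\<^bsub>A\<^esub> x" "x' \<otimes>\<^bsub>B\<^esub> lB f = lB f' \<otimes>\<^bsub>B\<^esub> x'" using s(7) by blast
        have A: "x \<otimes>\<^bsub>A\<^esub> (rA f \<otimes>\<^bsub>A\<^esub> a) \<otimes>\<^bsub>A\<^esub> y = rA f' \<otimes>\<^bsub>A\<^esub> (x \<otimes>\<^bsub>A\<^esub> a \<otimes>\<^bsub>A\<^esub> y)"
          using s(3,4) f' balance(2) by (simp add: gA_carrier A.m_assoc[symmetric])
        have B: "x' \<otimes>\<^bsub>B\<^esub> (lB f \<otimes>\<^bsub>B\<^esub> b) \<otimes>\<^bsub>B\<^esub> y' = lB f' \<otimes>\<^bsub>B\<^esub> (x' \<otimes>\<^bsub>B\<^esub> b \<otimes>\<^bsub>B\<^esub> y')"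
          using s(5,6) f' balance(3) by (simp add: gB_carrier B.m_assoc[symmetric])
        have "rA (mconst (k * k')) \<otimes>\<^bsub>A\<^esub> (rA f' \<otimes>\<^bsub>A\<^esub> (x \<otimes>\<^bsub>A\<^esub> a \<otimes>\<^bsub>A\<^esub> y)) = rA f' \<otimes>\<^bsub>A\<^esub> (rA (mconst (k * k')) \<otimes>\<^bsub>A\<^esub> (x \<otimes>\<^bsub>A\<^esub> a \<otimes>\<^bsub>A\<^esub> y))"
          using s(3,4) balance(2) by (simp add: gA_carrier A.m_assoc[symmetric] flip: rA_mult) (simp add: mult.commute)
        then show "\<Psi> (sg x x' k \<otimes>\<^bsub>TF\<^esub> sg (rA f \<otimes>\<^bsub>A\<^esub> a) b 1 \<otimes>\<^bsub>TF\<^esub> sg y y' k') = \<Psi> (sg x x' k \<otimes>\<^bsub>TF\<^esub> sg a (lB f \<otimes>\<^bsub>B\<^esub> b) 1 \<otimes>\<^bsub>TF\<^esub> sg y y' k')"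
          using bal[OF gA_rA[OF g(1)[OF balance(2)]] g(2)[OF balance(3)]]
          by (simp add: sg_mult A B \<Psi>_sg[OF pairsI[OF gA_rA[OF g(1)[OF balance(2)]] g(2)[OF balance(3)]]]
              \<Psi>_sg[OF pairsI[OF g(1)[OF balance(2)] gB_lB[OF g(2)[OF balance(3)]]]])
      qed (use balance(2-3) in \<open>auto intro!: sg_carrier pairsI gA_rA gB_lB\<close>)
    qed
  qed
  then have sub: "tensor_ideal A gA rA B gB lB \<subseteq> N"
    unfolding tensor_ideal_def by (rule I.genideal_minimal[OF N])
  have wd: "\<Psi> p = \<Psi> s" if "p \<in> carrier TF" "s \<in> carrier TF" "cls p = cls s" for p s
  proof -
    have "p \<in> cls s" using I.a_rcos_self[OF that(1)] that(3) by simp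
    then obtain i where i: "i \<in> tensor_ideal A gA rA B gB lB" "p = i + s"
      by (auto simp: a_r_coset_def' TF_simps)
    then have "i \<in> N" using sub by blast
    \<comment> \<open>Sandwiching between units shows that \<open>N\<close> lies in the kernel of
      \<Psi>.\<close>
    then have "i \<in> carrier TF" "\<Psi> (\<one>\<^bsub>TF\<^esub> \<otimes>\<^bsub>TF\<^esub> i \<otimes>\<^bsub>TF\<^esub> \<one>\<^bsub>TF\<^esub>) = \<zero>\<^bsub>X\<^esub>"
      using I.one_closed unfolding N_def by blast+
    then show ?thesis using i that(2) by (simp add: \<Psi>_add \<Psi>_closed)
  qed
  define \<Phi> where "\<Phi> t = \<Psi> (SOME p. p \<in> carrier TF \<and> t = cls p)" for t
  have \<Phi>: "\<Phi> (cls p) = \<Psi> p" if p: "p \<in> carrier TF" for p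
  proof -
    have "(SOME s. s \<in> carrier TF \<and> cls p = cls s) \<in> carrier TF \<and> cls p = cls (SOME s. s \<in> carrier TF \<and> cls p = cls s)"
      by (rule someI[of _ p]) (simp add: p)
    then show ?thesis unfolding \<Phi>_def by (intro wd p) auto
  qed
  have surj: "\<exists>p\<in>carrier TF. t = cls p" if "t \<in> carrier T" for t
    using that unfolding tensor_def FactRing_def A_RCOSETS_def' by auto
  show thesis
  proof (rule that[of \<Phi>])
    show "\<Phi> \<in> carrier T \<rightarrow> carrier X" using surj \<Phi> \<Psi>_closed by (metis Pi_I)
    fix t u assume "t \<in> carrier T" "u \<in> carrier T"
    then obtain p s where "p \<in> carrier TF" "t = cls p" "s \<in> carrier TF" "u = cls s" using surj by metis
    then show "\<Phi> (t \<oplus>\<^bsub>T\<^esub> u) = \<Phi> t \<oplus>\<^bsub>X\<^esub> \<Phi> u"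
      using ring_hom_add[OF cls_hom, of p s, symmetric] \<Phi>[OF I.a_closed[of p s]]
      by (simp add: \<Phi>) (simp add: TF_simps(2) \<Psi>_add)
  next
    fix a b \<alpha> \<gamma> \<beta> assume ab: "a \<in> gA \<alpha> \<gamma>" "b \<in> gB \<gamma> \<beta>"
    then show "\<Phi> (a \<boxtimes> b) = \<phi> a b"
      using \<Phi>[OF sg_carrier[OF pairsI[OF ab]], of 1] \<Psi>_sg[OF pairsI[OF ab], of 1]
      by (simp add: pure_tensor_def mconst_1 rA_one gA_carrier)
  qed
qed

end

section \<open>Products of sums, and sums over an index and a subset\<close>

lemma (in ring) finsum_product:
  assumes "finite S" "finite T" "\<And>i. i \<in> S \<Longrightarrow> a i \<in> carrier R" "\<And>j. j \<in> T \<Longrightarrow> b j \<in> carrier R"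
  shows "(\<Oplus>i\<in>S. a i) \<otimes> (\<Oplus>j\<in>T. b j) = (\<Oplus>i\<in>S. \<Oplus>j\<in>T. a i \<otimes> b j)"
  using assms
  by (subst finsum_ldistr) (auto intro!: finsum_closed finsum_cong' simp: finsum_rdistr)

text \<open>For fixed i, removing i is a bijection from the subsets containing i to those avoiding
  it. Products w_i w_K vanish for i in K and otherwise land on the union of K and {i}; the
  reindexing collects them by that union, which is the shape of the recursion for
  \<open>minor\<close>.\<close>

lemma (in abelian_monoid) finsum_insert_remove:
  fixes f :: "'n::finite \<Rightarrow> 'n set \<Rightarrow> 'a"
  assumes f: "\<And>i K. i \<notin> K \<Longrightarrow> f i K \<in> carrier G"
  shows "(\<Oplus>i\<in>UNIV. \<Oplus>K\<in>UNIV. if i \<in> K then \<zero> else f i K) = (\<Oplus>K\<in>UNIV. \<Oplus>i\<in>K. f i (K - {i}))"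
proof -
  have 1: "(\<Oplus>K\<in>UNIV. if i \<in> K then \<zero> else f i K) = (\<Oplus>K\<in>UNIV. if i \<in> K then f i (K - {i}) else \<zero>)" for i
  proof -
    have "(\<Oplus>K\<in>UNIV. if i \<in> K then \<zero> else f i K) = (\<Oplus>K\<in>UNIV. if i \<notin> K then f i K else \<zero>)"
      using f by (intro finsum_cong') auto
    also have "\<dots> = (\<Oplus>K\<in>{K. i \<notin> K}. f i K)"
      using f by (subst finsum_if) auto
    also have "{K. i \<notin> K} = (\<lambda>K. K - {i}) ` {K. i \<in> K}"
      by (auto intro!: image_eqI[of _ _ "insert i K" for K])
    also have "(\<Oplus>K\<in>\<dots>. f i K) = (\<Oplus>K\<in>{K. i \<in> K}. f i (K - {i}))"
      using f by (intro finsum_reindex) (auto intro!: inj_onI)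
    also have "\<dots> = (\<Oplus>K\<in>UNIV. if i \<in> K then f i (K - {i}) else \<zero>)"
      using f by (subst finsum_if) auto
    finally show ?thesis .
  qed
  have "(\<Oplus>i\<in>UNIV. \<Oplus>K\<in>UNIV. if i \<in> K then \<zero> else f i K) = (\<Oplus>K\<in>UNIV. \<Oplus>i\<in>UNIV. if i \<in> K then f i (K - {i}) else \<zero>)"
    unfolding 1 using f by (intro finsum_swap) auto
  also have "\<dots> = (\<Oplus>K\<in>UNIV. \<Oplus>i\<in>K. f i (K - {i}))"
  proof (rule finsum_cong')
    fix K :: "'n set"
    show "(\<Oplus>i\<in>UNIV. if i \<in> K then f i (K - {i}) else \<zero>) = (\<Oplus>i\<in>K. f i (K - {i}))"
      using f by (subst finsum_if) auto
  qed (use f in \<open>auto intro!: finsum_closed\<close>)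
  finally show ?thesis .
qed

section \<open>Gradings\<close>

lemma F_deg_carrier: "a \<in> F_deg l \<alpha> \<beta> \<Longrightarrow> a \<in> carrier (F_alg l)"
  and W_deg_carrier: "v \<in> W_deg l u \<alpha> \<Longrightarrow> v \<in> carrier (W_alg l)"
  unfolding F_deg_def F_alg_def W_deg_def W_alg_def by (rule graded_carrier; assumption)+

lemma F_deg_mult: "a \<in> F_deg l \<alpha> \<beta> \<Longrightarrow> b \<in> F_deg l \<alpha>' \<beta>' \<Longrightarrow> a \<otimes>\<^bsub>F_alg l\<^esub> b \<in> F_deg l (\<alpha> + \<alpha>') (\<beta> + \<beta>')"
  unfolding F_deg_def F_alg_def using graded_mult by fastforce

lemma W_deg_mult: "a \<in> W_deg l u \<alpha> \<Longrightarrow> b \<in> W_deg l v \<beta> \<Longrightarrow> a \<otimes>\<^bsub>W_alg l\<^esub> b \<in> W_deg l w (\<alpha> + \<beta>)"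
  unfolding W_deg_def W_alg_def by (rule graded_mult)

lemma F_deg_add: "a \<in> F_deg l \<alpha> \<beta> \<Longrightarrow> b \<in> F_deg l \<alpha> \<beta> \<Longrightarrow> a \<oplus>\<^bsub>F_alg l\<^esub> b \<in> F_deg l \<alpha> \<beta>"
  and W_deg_add: "v \<in> W_deg l u \<alpha> \<Longrightarrow> w \<in> W_deg l u \<alpha> \<Longrightarrow> v \<oplus>\<^bsub>W_alg l\<^esub> w \<in> W_deg l u \<alpha>"
  unfolding F_deg_def F_alg_def W_deg_def W_alg_def by (rule graded_add; assumption)+

lemma F_deg_zero: "\<zero>\<^bsub>F_alg l\<^esub> \<in> F_deg l \<alpha> \<beta>" and W_deg_zero: "\<zero>\<^bsub>W_alg l\<^esub> \<in> W_deg l u \<alpha>"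
  unfolding F_deg_def F_alg_def W_deg_def W_alg_def by (rule graded_zero)+

lemma F_deg_one: "\<one>\<^bsub>F_alg l\<^esub> \<in> F_deg l 0 0" and W_deg_one: "\<one>\<^bsub>W_alg l\<^esub> \<in> W_deg l u 0"
  unfolding F_deg_def F_alg_def W_deg_def W_alg_def
  by (simp_all add: graded_one zero_prod_def[symmetric])

lemma F_deg_mu: "mu_l l f \<in> F_deg l 0 0" "mu_r l f \<in> F_deg l 0 0" and W_deg_mu_W: "mu_W l f \<in> W_deg l u 0"
  unfolding F_deg_def W_deg_def using mu0 by (simp_all add: zero_prod_def[symmetric])

lemma F_deg_mu_mult: "a \<in> F_deg l \<alpha> \<beta> \<Longrightarrow> mu_l l f \<otimes>\<^bsub>F_alg l\<^esub> a \<in> F_deg l \<alpha> \<beta>"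
  "a \<in> F_deg l \<alpha> \<beta> \<Longrightarrow> mu_r l f \<otimes>\<^bsub>F_alg l\<^esub> a \<in> F_deg l \<alpha> \<beta>"
  using F_deg_mult[OF F_deg_mu(1)] F_deg_mult[OF F_deg_mu(2)] by fastforce+

lemma W_deg_mu_W_mult: "v \<in> W_deg l u \<alpha> \<Longrightarrow> mu_W l f \<otimes>\<^bsub>W_alg l\<^esub> v \<in> W_deg l u \<alpha>"
  using W_deg_mult[OF W_deg_mu_W] by fastforce

lemma F_deg_t_el: "t_el l i j \<in> F_deg l (wt i) (wt j)" and W_deg_w_el: "w_el l i \<in> W_deg l u (wt i)"
  unfolding F_deg_def W_deg_def t_el_def w_el_def by (rule graded_single; simp)+

lemma balanced_tensor_FF: "balanced_tensor (F_alg l) (F_alg l) (F_deg l) (mu_r l) (F_deg l) (mu_l l)"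
  by (intro balanced_tensor.intro balanced_tensor_axioms.intro F_ring)
    ((rule F_deg_zero F_carrier mu_add mu_mult mu_1 F_deg_add F_deg_mu_mult F_deg_commute; assumption)
      | erule F_deg_carrier | rule exI, intro ballI, erule (1) F_deg_mult | rule exI, rule F_deg_one)+

lemma balanced_tensor_WF: "balanced_tensor (W_alg l) (F_alg l) (W_deg l) (mu_W l) (F_deg l) (mu_l l)"
  by (intro balanced_tensor.intro balanced_tensor_axioms.intro F_ring W_ring)
    ((rule F_deg_zero F_carrier mu_add mu_mult mu_1 F_deg_add F_deg_mu_mult F_deg_commute
        W_deg_zero W_carrier mu_W_add mu_W_mult mu_W_1 W_deg_add W_deg_mu_W_mult W_deg_commute; assumption)
      | erule F_deg_carrier W_deg_carrier | rule exI, intro ballI, erule (1) F_deg_mult W_deg_mult[where w = "()"]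
      | rule exI, rule F_deg_one W_deg_one[where u = "()"])+

section \<open>Pure tensor calculus in the two concrete products\<close>

lemmas FF_defs = FF_def tensor_FF_def
lemmas FF_carrier = balanced_tensor.pure_carrier[OF balanced_tensor_FF, folded FF_defs]
lemmas FF_mult = balanced_tensor.pure_mult[OF balanced_tensor_FF, folded FF_defs]
lemmas FF_one = balanced_tensor.pure_one[OF balanced_tensor_FF, folded FF_defs]
lemmas FF_zero_left = balanced_tensor.pure_zero_left[OF balanced_tensor_FF, folded FF_defs]
lemmas FF_zero_right = balanced_tensor.pure_zero_right[OF balanced_tensor_FF, folded FF_defs]
lemmas FF_balance = balanced_tensor.pure_balance[OF balanced_tensor_FF, folded FF_defs]
lemmas FF_finsum_left = balanced_tensor.pure_finsum_left[OF balanced_tensor_FF, folded FF_defs]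
lemmas FF_finsum_right = balanced_tensor.pure_finsum_right[OF balanced_tensor_FF, folded FF_defs]
lemmas F_deg_finsum = balanced_tensor.gA_finsum[OF balanced_tensor_FF]

lemmas WF_defs = WF_def tensor_WF_def
lemmas WF_carrier = balanced_tensor.pure_carrier[OF balanced_tensor_WF, folded WF_defs]
lemmas WF_mult = balanced_tensor.pure_mult[OF balanced_tensor_WF, folded WF_defs]
lemmas WF_one = balanced_tensor.pure_one[OF balanced_tensor_WF, folded WF_defs]
lemmas WF_zero_left = balanced_tensor.pure_zero_left[OF balanced_tensor_WF, folded WF_defs]
lemmas WF_zero_right = balanced_tensor.pure_zero_right[OF balanced_tensor_WF, folded WF_defs]
lemmas WF_balance = balanced_tensor.pure_balance[OF balanced_tensor_WF, folded WF_defs]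
lemmas WF_finsum_right = balanced_tensor.pure_finsum_right[OF balanced_tensor_WF, folded WF_defs]
lemmas WF_lift = balanced_tensor.tensor_lift[OF balanced_tensor_WF, folded WF_defs]

section \<open>The basis of \<open>W\<close>\<close>

abbreviation w_list :: "complex \<Rightarrow> 'n list \<Rightarrow> 'n::{finite,linorder} W" where
  "w_list l ks \<equiv> foldr (\<lambda>i v. w_el l i \<otimes>\<^bsub>W_alg l\<^esub> v) ks \<one>\<^bsub>W_alg l\<^esub>"

lemma wt_list: "distinct ks \<Longrightarrow> sum_list (map wt ks) = wts (set ks)"
  by (simp add: wts_def sum.distinct_set_conv_list)

lemma wts_remove: "i \<in> K \<Longrightarrow> wt i + wts (K - {i}) = wts K"
  unfolding wts_def by (simp add: sum.remove)

lemma w_list_deg: "w_list l ks \<in> W_deg l u (sum_list (map wt ks))"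
  by (induction ks) (auto intro: W_deg_one W_deg_mult[OF W_deg_w_el])

lemma w_set_deg: "w_set l K \<in> W_deg l u (wts K)"
  using w_list_deg[of l "sorted_list_of_set K" u] by (simp add: w_set_def wt_list)

lemma w_list_carrier [simp]: "w_list l ks \<in> carrier (W_alg l)"
  by (rule W_deg_carrier[OF w_list_deg])

lemma w_set_carrier [simp]: "w_set l K \<in> carrier (W_alg l)"
  by (rule W_deg_carrier[OF w_set_deg])

text \<open>Straightening: w_i travels right past each smaller letter w_j, every passage costing
  -h(\<lambda>_i - \<lambda>_j), until it finds its place or meets itself and the word becomes
  zero.\<close>

lemma w_el_w_list:
  assumes "sorted_wrt (<) ks"
  shows "w_el l i \<otimes>\<^bsub>W_alg l\<^esub> w_list l ks =
    (if i \<in> set ks then \<zero>\<^bsub>W_alg l\<^esub> else mu_W l (w_factor l i (set ks)) \<otimes>\<^bsub>W_alg l\<^esub> w_list l (insort i ks))"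
  using assms
proof (induction ks)
  case Nil
  then show ?case by (simp add: w_factor_def mu_W_1)
next
  case (Cons x ks)
  consider "i < x" | "i = x" | "x < i" by fastforce
  then show ?case
  proof cases
    case 1
    then have "i \<notin> set (x # ks)" "insort i (x # ks) = i # x # ks" "w_factor l i (set (x # ks)) = 1"
      using Cons.prems by (auto intro!: w_factor_eq_1)
    then show ?thesis by (simp add: mu_W_1)
  next
    case 2
    have "w_el l i \<otimes>\<^bsub>W_alg l\<^esub> (w_el l i \<otimes>\<^bsub>W_alg l\<^esub> w_list l ks) = \<zero>\<^bsub>W_alg l\<^esub>"
      by (simp add: w_el_sq flip: W.m_assoc)
    then show ?thesis using 2 by simp
  next
    case 3
    have x: "x \<notin> set ks" using Cons.prems by auto
    have "w_el l i \<otimes>\<^bsub>W_alg l\<^esub> w_list l (x # ks) = mu_W l (- h_at l i x) \<otimes>\<^bsub>W_alg l\<^esub> (w_el l x \<otimes>\<^bsub>W_alg l\<^esub> (w_el l i \<otimes>\<^bsub>W_alg l\<^esub> w_list l ks))"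
      using w_el_swap[OF 3, of l] by (simp flip: W.m_assoc)
    also have "\<dots> = (if i \<in> set ks then \<zero>\<^bsub>W_alg l\<^esub> else
        mu_W l (- h_at l i x) \<otimes>\<^bsub>W_alg l\<^esub> (w_el l x \<otimes>\<^bsub>W_alg l\<^esub> (mu_W l (w_factor l i (set ks)) \<otimes>\<^bsub>W_alg l\<^esub> w_list l (insort i ks))))"
      using Cons by simp
    \<comment> \<open>The inner factor crosses w_x without a shift, since x differs from i and from
      all letters of \<open>ks\<close>.\<close>
    also have "\<dots> = (if i \<in> set ks then \<zero>\<^bsub>W_alg l\<^esub> else
        mu_W l (- h_at l i x) \<otimes>\<^bsub>W_alg l\<^esub> mu_W l (w_factor l i (set ks)) \<otimes>\<^bsub>W_alg l\<^esub> w_list l (x # insort i ks))"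
      using 3 x mshift_w_factor[of x i "set ks" l] w_el_mu_W[of l x "w_factor l i (set ks)"]
      by (simp add: W.m_assoc) (simp flip: W.m_assoc)
    also have "mu_W l (- h_at l i x) \<otimes>\<^bsub>W_alg l\<^esub> mu_W l (w_factor l i (set ks)) = mu_W l (w_factor l i (set (x # ks)))"
      using 3 x w_factor_remove[of x "set (x # ks)" i l] by (simp flip: mu_W_mult)
    finally show ?thesis using 3 by auto
  qed
qed

lemma w_el_w_set:
  "w_el l i \<otimes>\<^bsub>W_alg l\<^esub> w_set l K =
    (if i \<in> K then \<zero>\<^bsub>W_alg l\<^esub> else mu_W l (w_factor l i K) \<otimes>\<^bsub>W_alg l\<^esub> w_set l (insert i K))"
  using w_el_w_list[of "sorted_list_of_set K" l i] by (simp add: w_set_def)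

text \<open>In an increasing word each letter is smaller than those it multiplies, so every factor
  is 1, and the shifts fix the coordinates 0 and 1.\<close>

lemma w_coord_w_list:
  "sorted_wrt (<) ks \<Longrightarrow> w_coord l (w_list l ks) K = (if K = set ks then 1 else 0)"
proof (induction ks arbitrary: K)
  case (Cons x ks)
  then have "w_factor l x (set ks) = 1" "x \<notin> set ks" by (auto intro!: w_factor_eq_1)
  moreover have "K = insert x (set ks) \<longleftrightarrow> x \<in> K \<and> K - {x} = set ks" using \<open>x \<notin> set ks\<close> by auto
  ultimately show ?case using Cons by (auto simp: w_coord_w_el)
qed (simp add: w_coord_one)

lemma w_coord_w_set: "w_coord l (w_set l J) K = (if K = J then 1 else 0)"
  using w_coord_w_list[of "sorted_list_of_set J" l K] by (simp add: w_set_def)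

text \<open>Freeness of W \<otimes> F over the w_K: the coefficient map at I annihilates the terms
  with K different from I, because the coordinates of w_K form a Kronecker delta.\<close>

lemma w_set_independent:
  fixes x y :: "'n::{finite,linorder} set \<Rightarrow> 'n F"
  assumes eq: "(\<Oplus>\<^bsub>WF l\<^esub>K\<in>UNIV. tensor_WF l (w_set l K) (x K)) = (\<Oplus>\<^bsub>WF l\<^esub>K\<in>UNIV. tensor_WF l (w_set l K) (y K))"
    and x: "\<And>K. \<exists>\<beta>. x K \<in> F_deg l (wts K) \<beta>" and y: "\<And>K. \<exists>\<beta>. y K \<in> F_deg l (wts K) \<beta>"
  shows "x I = y I"
proof -
  obtain \<Phi> where \<Phi>: "\<Phi> \<in> carrier (WF l) \<rightarrow> carrier (F_alg l)"
    "\<And>x y. x \<in> carrier (WF l) \<Longrightarrow> y \<in> carrier (WF l) \<Longrightarrow> \<Phi> (x \<oplus>\<^bsub>WF l\<^esub> y) = \<Phi> x \<oplus>\<^bsub>F_alg l\<^esub> \<Phi> y"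
    "\<And>v a \<alpha> \<beta>. v \<in> W_deg l () \<alpha> \<Longrightarrow> a \<in> F_deg l \<alpha> \<beta> \<Longrightarrow>
      \<Phi> (tensor_WF l v a) = mu_l l (w_coord l v I) \<otimes>\<^bsub>F_alg l\<^esub> a"
  \<comment> \<open>The map is balanced because functions stand to the left of the w_K: multiplying
    v by f multiplies its coordinate by f, and values of \<open>mu_l\<close> commute, so f can be
    passed on to a.\<close>
  proof (rule WF_lift[where X = "F_alg l" and \<phi> = "\<lambda>v a. mu_l l (w_coord l v I) \<otimes>\<^bsub>F_alg l\<^esub> a"])
    fix v :: "'n W" and a f u \<alpha> \<beta> assume "v \<in> W_deg l u \<alpha>" "a \<in> F_deg l \<alpha> \<beta>"
    then show "mu_l l (w_coord l (mu_W l f \<otimes>\<^bsub>W_alg l\<^esub> v) I) \<otimes>\<^bsub>F_alg l\<^esub> a =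
      mu_l l (w_coord l v I) \<otimes>\<^bsub>F_alg l\<^esub> (mu_l l f \<otimes>\<^bsub>F_alg l\<^esub> a)"
      by (simp add: w_coord_mu_W W_deg_carrier F_deg_carrier mult.commute flip: F.m_assoc mu_mult)
  qed (auto simp: w_coord_add W_deg_carrier F_deg_carrier mu_add F.l_distr F.r_distr F.is_abelian_group)
  have "\<Phi> (\<Oplus>\<^bsub>WF l\<^esub>K\<in>UNIV. tensor_WF l (w_set l K) (z K)) = z I" if z: "\<And>K. \<exists>\<beta>. z K \<in> F_deg l (wts K) \<beta>" for z
  proof -
    have c: "z K \<in> carrier (F_alg l)" for K using z F_deg_carrier by blast
    have "\<Phi> (\<Oplus>\<^bsub>WF l\<^esub>K\<in>UNIV. tensor_WF l (w_set l K) (z K)) = (\<Oplus>\<^bsub>F_alg l\<^esub>K\<in>UNIV. \<Phi> (tensor_WF l (w_set l K) (z K)))"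
      using z by (intro additive_finsum WF.is_abelian_group F.is_abelian_group \<Phi>(1,2)) (auto intro: WF_carrier[OF w_set_deg])
    also have "\<dots> = (\<Oplus>\<^bsub>F_alg l\<^esub>K\<in>UNIV. if I = K then z K else \<zero>\<^bsub>F_alg l\<^esub>)"
    proof (intro F.finsum_cong')
      fix K
      obtain \<beta> where "z K \<in> F_deg l (wts K) \<beta>" using z by blast
      then show "\<Phi> (tensor_WF l (w_set l K) (z K)) = (if I = K then z K else \<zero>\<^bsub>F_alg l\<^esub>)"
        using c by (simp add: \<Phi>(3)[OF w_set_deg] w_coord_w_set mu_1 mu_0)
    qed (auto simp: c)
    also have "\<dots> = z I" using c by (intro F.finsum_singleton) auto
    finally show ?thesis .
  qed
  from this[OF x] this[OF y] eq show ?thesis by simp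
qed

lemma (in ring) finsum_finsum_rdistr:
  assumes "finite S" "finite T" "a \<in> carrier R" "\<And>i j. f i j \<in> carrier R"
  shows "a \<otimes> (\<Oplus>i\<in>S. \<Oplus>j\<in>T. f i j) = (\<Oplus>i\<in>S. \<Oplus>j\<in>T. a \<otimes> f i j)"
  using assms by (subst finsum_rdistr) (auto intro!: finsum_closed finsum_cong' simp: finsum_rdistr)

section \<open>Quantum minors\<close>

text \<open>The coefficient of \<open>w\<^sub>I\<close> in \<open>R(w\<^sub>k\<^sub>1 \<cdots> w\<^sub>k\<^sub>r)\<close>; the indices \<open>k\<^sub>1, \<dots>, k\<^sub>r\<close> need be neither increasing nor distinct.\<close>

fun minor :: "complex \<Rightarrow> 'n set \<Rightarrow> 'n list \<Rightarrow> 'n::{finite,linorder} F" where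
  "minor l I [] = (if I = {} then \<one>\<^bsub>F_alg l\<^esub> else \<zero>\<^bsub>F_alg l\<^esub>)"
| "minor l I (k # ks) =
    (\<Oplus>\<^bsub>F_alg l\<^esub>i\<in>I. mu_l l (w_factor l i (I - {i})) \<otimes>\<^bsub>F_alg l\<^esub> (t_el l i k \<otimes>\<^bsub>F_alg l\<^esub> minor l (I - {i}) ks))"

lemma minor_deg: "minor l I ks \<in> F_deg l (wts I) (sum_list (map wt ks))"
proof (induction ks arbitrary: I)
  case Nil
  then show ?case by (simp add: F_deg_one F_deg_zero wts_def)
next
  case (Cons k ks)
  have "t_el l i k \<otimes>\<^bsub>F_alg l\<^esub> minor l (I - {i}) ks \<in> F_deg l (wts I) (wt k + sum_list (map wt ks))" if "i \<in> I" for i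
    using F_deg_mult[OF F_deg_t_el[of l i k] Cons[of "I - {i}"]] that by (simp add: wts_remove)
  then show ?case by (auto intro!: F_deg_finsum F_deg_mu_mult)
qed

lemma minor_carrier [simp]: "minor l I ks \<in> carrier (F_alg l)"
  by (rule F_deg_carrier[OF minor_deg])

text \<open>Each column of the recursion uses up one row. Thanks to this vanishing, expansions may
  run over all subsets, and cardinalities matter only when the sums are compared with those of the
  theorem.\<close>

lemma minor_length: "card I \<noteq> length ks \<Longrightarrow> minor l I ks = \<zero>\<^bsub>F_alg l\<^esub>"
proof (induction ks arbitrary: I)
  case (Cons k ks)
  have "card (I - {i}) \<noteq> length ks" if "i \<in> I" for i
    using Cons.prems card_Suc_Diff1[of I i] that by (metis finite length_Cons)
  then show ?case using Cons.IH by (auto intro!: F.add.finprod_one_eqI)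
qed auto

abbreviation minor_set :: "complex \<Rightarrow> 'n set \<Rightarrow> 'n set \<Rightarrow> 'n::{finite,linorder} F" where
  "minor_set l I K \<equiv> minor l I (sorted_list_of_set K)"

lemma minor_set_deg: "minor_set l I K \<in> F_deg l (wts I) (wts K)"
  using minor_deg[of l I "sorted_list_of_set K"] by (simp add: wt_list)

lemma WF_minor [simp, intro]: "tensor_WF l (w_set l I) (minor l I ks) \<in> carrier (WF l)"
  by (rule WF_carrier[OF w_set_deg minor_deg])

lemma FF_minor [simp, intro]: "tensor_FF l (minor_set l I K) (minor l K ks) \<in> carrier (FF l)"
  by (rule FF_carrier[OF minor_set_deg minor_deg])

section \<open>The coaction on words, the dual expansion and the comultiplication\<close>

locale coaction =
  fixes l :: complex and R :: "'n W \<Rightarrow> ('n W \<times> 'n::{finite,linorder} F \<Rightarrow>\<^sub>0 complex) set"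
  assumes coaction: "is_coaction l R"
begin

lemma R_hom: "R \<in> ring_hom (W_alg l) (WF l)"
  and R_w_el: "R (w_el l i) = (\<Oplus>\<^bsub>WF l\<^esub>j\<in>UNIV. tensor_WF l (w_el l j) (t_el l j i))"
  and R_mu_W: "v \<in> carrier (W_alg l) \<Longrightarrow>
    R (mu_W l f \<otimes>\<^bsub>W_alg l\<^esub> v) = tensor_WF l \<one>\<^bsub>W_alg l\<^esub> (mu_r l f) \<otimes>\<^bsub>WF l\<^esub> R v"
  using coaction unfolding is_coaction_def by auto

lemma R_w_list: "R (w_list l ks) = (\<Oplus>\<^bsub>WF l\<^esub>K\<in>UNIV. tensor_WF l (w_set l K) (minor l K ks))"
proof (induction ks)
  case Nil
  have "(\<Oplus>\<^bsub>WF l\<^esub>K\<in>(UNIV :: 'n set set). tensor_WF l (w_set l K) (minor l K [])) =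
      (\<Oplus>\<^bsub>WF l\<^esub>K\<in>UNIV. if {} = K then tensor_WF l (w_set l K) (minor l K []) else \<zero>\<^bsub>WF l\<^esub>)"
  proof (rule WF.finsum_cong')
    fix K :: "'n set"
    show "tensor_WF l (w_set l K) (minor l K []) = (if {} = K then tensor_WF l (w_set l K) (minor l K []) else \<zero>\<^bsub>WF l\<^esub>)"
      by (simp add: WF_zero_right[OF w_set_deg])
  qed (auto simp del: minor.simps)
  also have "\<dots> = tensor_WF l (w_set l {}) (minor l {} [])"
    by (rule WF.finsum_singleton[where f = "\<lambda>K. tensor_WF l (w_set l K) (minor l K [])"]) (auto simp del: minor.simps)
  also have "\<dots> = R (w_list l [])" using ring_hom_one[OF R_hom] by (simp add: WF_one w_set_def)
  finally show ?case ..
next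
  case (Cons k ks)
  let ?m = "\<lambda>i K. mu_l l (w_factor l i K) \<otimes>\<^bsub>F_alg l\<^esub> (t_el l i k \<otimes>\<^bsub>F_alg l\<^esub> minor l K ks)"
  let ?f = "\<lambda>i K. tensor_WF l (w_set l (insert i K)) (?m i K)"
  have tm: "t_el l i k \<otimes>\<^bsub>F_alg l\<^esub> minor l K ks \<in> F_deg l (wt i + wts K) (wt k + sum_list (map wt ks))" for i K
    by (rule F_deg_mult[OF F_deg_t_el minor_deg])
  have m: "?m i (K - {i}) \<in> F_deg l (wts K) (wt k + sum_list (map wt ks))" if "i \<in> K" for i K
    using F_deg_mu_mult(1)[OF tm[of i "K - {i}"], of "w_factor l i (K - {i})"] that by (simp add: wts_remove)
  have m': "?m i K \<in> F_deg l (wts (insert i K)) (wt k + sum_list (map wt ks))" if "i \<notin> K" for i K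
    using m[of i "insert i K"] that by simp
  \<comment> \<open>Origin of the recursion: the straightening factor of w_i w_K leaves W through
    the balancing relation and becomes the \<open>mu_l\<close> coefficient of the minor.\<close>
  have s: "tensor_WF l (w_el l i) (t_el l i k) \<otimes>\<^bsub>WF l\<^esub> tensor_WF l (w_set l K) (minor l K ks) =
    (if i \<in> K then \<zero>\<^bsub>WF l\<^esub> else ?f i K)" for i K
  proof (cases "i \<in> K")
    case True
    then show ?thesis
      by (simp add: WF_mult[OF W_deg_w_el F_deg_t_el w_set_deg minor_deg] w_el_w_set WF_zero_left[OF tm])
  next
    case False
    then have "wts (insert i K) = wt i + wts K" using wts_remove[of i "insert i K"] by simp
    then have "t_el l i k \<otimes>\<^bsub>F_alg l\<^esub> minor l K ks \<in> F_deg l (wts (insert i K)) (wt k + sum_list (map wt ks))"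
      using tm by simp
    from WF_balance[OF w_set_deg this, of "w_factor l i K"] False show ?thesis
      by (simp add: WF_mult[OF W_deg_w_el F_deg_t_el w_set_deg minor_deg] w_el_w_set)
  qed
  have "R (w_list l (k # ks)) = R (w_el l k) \<otimes>\<^bsub>WF l\<^esub> R (w_list l ks)"
    by (simp add: ring_hom_mult[OF R_hom])
  also have "\<dots> = (\<Oplus>\<^bsub>WF l\<^esub>i\<in>UNIV. \<Oplus>\<^bsub>WF l\<^esub>K\<in>UNIV.
      tensor_WF l (w_el l i) (t_el l i k) \<otimes>\<^bsub>WF l\<^esub> tensor_WF l (w_set l K) (minor l K ks))"
    unfolding R_w_el Cons by (rule WF.finsum_product) (auto intro: WF_carrier[OF W_deg_w_el F_deg_t_el])
  also have "\<dots> = (\<Oplus>\<^bsub>WF l\<^esub>K\<in>UNIV. \<Oplus>\<^bsub>WF l\<^esub>i\<in>K. ?f i (K - {i}))"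
    unfolding s by (rule WF.finsum_insert_remove) (rule WF_carrier[OF w_set_deg m'])
  also have "\<dots> = (\<Oplus>\<^bsub>WF l\<^esub>K\<in>UNIV. tensor_WF l (w_set l K) (minor l K (k # ks)))"
  proof (rule WF.finsum_cong')
    fix K :: "'n set"
    have "tensor_WF l (w_set l K) (minor l K (k # ks)) = (\<Oplus>\<^bsub>WF l\<^esub>i\<in>K. tensor_WF l (w_set l K) (?m i (K - {i})))"
      unfolding minor.simps by (rule WF_finsum_right[OF w_set_deg m])
    also have "\<dots> = (\<Oplus>\<^bsub>WF l\<^esub>i\<in>K. ?f i (K - {i}))"
      using WF_carrier[OF w_set_deg m] by (intro WF.finsum_cong') (auto simp: insert_absorb)
    finally show "(\<Oplus>\<^bsub>WF l\<^esub>i\<in>K. ?f i (K - {i})) = tensor_WF l (w_set l K) (minor l K (k # ks))" ..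
  qed (auto simp del: minor.simps)
  finally show ?case .
qed

lemma R_w_set: "R (w_set l J) = (\<Oplus>\<^bsub>WF l\<^esub>I\<in>UNIV. tensor_WF l (w_set l I) (minor_set l I J))"
  unfolding w_set_def[of l J] by (rule R_w_list)

lemma mu_r_w_set:
  assumes "a \<in> F_deg l (wts K) \<beta>"
  shows "tensor_WF l \<one>\<^bsub>W_alg l\<^esub> (mu_r l f) \<otimes>\<^bsub>WF l\<^esub> tensor_WF l (w_set l K) a =
    tensor_WF l (w_set l K) (mu_r l f \<otimes>\<^bsub>F_alg l\<^esub> a)"
  using WF_mult[OF W_deg_one F_deg_mu(2) w_set_deg assms] by simp

text \<open>A function coefficient in W reappears as \<open>mu_r\<close> on the matrix elements, so
  the left tensor factors remain the bare basis elements.\<close>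

lemma R_mu_W_w_set:
  "R (mu_W l f \<otimes>\<^bsub>W_alg l\<^esub> w_set l J) = (\<Oplus>\<^bsub>WF l\<^esub>I\<in>UNIV. tensor_WF l (w_set l I) (mu_r l f \<otimes>\<^bsub>F_alg l\<^esub> minor_set l I J))"
proof -
  have "R (mu_W l f \<otimes>\<^bsub>W_alg l\<^esub> w_set l J) = (\<Oplus>\<^bsub>WF l\<^esub>I\<in>UNIV.
      tensor_WF l \<one>\<^bsub>W_alg l\<^esub> (mu_r l f) \<otimes>\<^bsub>WF l\<^esub> tensor_WF l (w_set l I) (minor_set l I J))"
    unfolding R_mu_W[OF w_set_carrier] R_w_set
    using WF_carrier[OF W_deg_one F_deg_mu(2)] by (intro WF.finsum_rdistr) auto
  also have "\<dots> = (\<Oplus>\<^bsub>WF l\<^esub>I\<in>UNIV. tensor_WF l (w_set l I) (mu_r l f \<otimes>\<^bsub>F_alg l\<^esub> minor_set l I J))"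
    by (simp only: mu_r_w_set[OF minor_set_deg])
  finally show ?thesis .
qed

text \<open>Sorts a column word consisting of k followed by the increasing list of K. The factor
  depends on the columns only and is the same for every row set I; its value is that of the row
  recursion, moved to the right variables. For k in K this is the vanishing of a minor with a
  repeated column.\<close>

lemma minor_Cons_set:
  fixes I :: "'n set"
  shows "minor l I (k # sorted_list_of_set K) =
    (if k \<in> K then \<zero>\<^bsub>F_alg l\<^esub> else mu_r l (w_factor l k K) \<otimes>\<^bsub>F_alg l\<^esub> minor_set l I (insert k K))"
proof -
  have "(\<Oplus>\<^bsub>WF l\<^esub>I\<in>UNIV. tensor_WF l (w_set l I) (minor l I (k # sorted_list_of_set K))) = R (w_el l k \<otimes>\<^bsub>W_alg l\<^esub> w_set l K)"
    using R_w_list[of "k # sorted_list_of_set K"] by (simp add: w_set_def[of l K])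
  also have "\<dots> = (\<Oplus>\<^bsub>WF l\<^esub>I\<in>UNIV. tensor_WF l (w_set l I)
     (if k \<in> K then \<zero>\<^bsub>F_alg l\<^esub> else mu_r l (w_factor l k K) \<otimes>\<^bsub>F_alg l\<^esub> minor_set l I (insert k K)))"
    using ring_hom_zero[OF R_hom W_ring WF_ring] R_mu_W_w_set
    by (simp add: w_el_w_set WF_zero_right[OF w_set_deg])
  finally show ?thesis
  proof (rule w_set_independent)
    show "\<exists>\<beta>. minor l J (k # sorted_list_of_set K) \<in> F_deg l (wts J) \<beta>" for J
      using minor_deg by blast
    show "\<exists>\<beta>. (if k \<in> K then \<zero>\<^bsub>F_alg l\<^esub> else mu_r l (w_factor l k K) \<otimes>\<^bsub>F_alg l\<^esub> minor_set l J (insert k K))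
        \<in> F_deg l (wts J) \<beta>" for J
      using F_deg_zero F_deg_mu_mult(2)[OF minor_set_deg] by (cases "k \<in> K"; simp only: if_True if_False simp_thms; blast)
  qed
qed

text \<open>Induction on the column word. Applying \<Delta> to the recursion gives a sum over a row
  i, an intermediate index k and an intermediate set K. For fixed k and K the left factors add up to
  a minor with the unsorted columns k, K, which the dual expansion sorts; the sums over k and K that
  remain are the recursion for the right factors.\<close>

lemma comultiplication_minor:
  fixes I :: "'n set"
  assumes "is_comultiplication l \<Delta>"
  shows "\<Delta> (minor l I js) = (\<Oplus>\<^bsub>FF l\<^esub>K\<in>UNIV. tensor_FF l (minor_set l I K) (minor l K js))"
proof -
  have hom: "\<Delta> \<in> ring_hom (F_alg l) (FF l)"
    and t: "\<And>i j. \<Delta> (t_el l i j) = (\<Oplus>\<^bsub>FF l\<^esub>k\<in>UNIV. tensor_FF l (t_el l i k) (t_el l k j))"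
    and mu: "\<And>f. \<Delta> (mu_l l f) = tensor_FF l (mu_l l f) \<one>\<^bsub>F_alg l\<^esub>"
    using assms unfolding is_comultiplication_def by auto
  show ?thesis
  proof (induction js arbitrary: I)
    case Nil
    have "(\<Oplus>\<^bsub>FF l\<^esub>K\<in>UNIV. tensor_FF l (minor_set l I K) (minor l K [])) =
      (\<Oplus>\<^bsub>FF l\<^esub>K\<in>UNIV. if {} = K then tensor_FF l (minor_set l I K) (minor l K []) else \<zero>\<^bsub>FF l\<^esub>)"
    proof (rule FF.finsum_cong')
      fix K :: "'n set"
      show "tensor_FF l (minor_set l I K) (minor l K []) = (if {} = K then tensor_FF l (minor_set l I K) (minor l K []) else \<zero>\<^bsub>FF l\<^esub>)"
        by (simp add: FF_zero_right[OF minor_set_deg])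
    qed (use FF_minor[of l I "{}" "[]"] in \<open>auto simp del: minor.simps\<close>)
    also have "\<dots> = tensor_FF l (minor_set l I {}) (minor l {} [])"
      by (rule FF.finsum_singleton[where f = "\<lambda>K. tensor_FF l (minor_set l I K) (minor l K [])"]) (auto simp del: minor.simps)
    also have "\<dots> = \<Delta> (minor l I [])"
      using ring_hom_one[OF hom] ring_hom_zero[OF hom F_ring FF_ring]
      by (simp add: FF_one FF_zero_left[OF F_deg_one])
    finally show ?case ..
  next
    case (Cons j js)
    let ?p = "\<lambda>i k K. mu_l l (w_factor l i (I - {i})) \<otimes>\<^bsub>F_alg l\<^esub> (t_el l i k \<otimes>\<^bsub>F_alg l\<^esub> minor_set l (I - {i}) K)"
    let ?q = "\<lambda>k K. t_el l k j \<otimes>\<^bsub>F_alg l\<^esub> minor l K js"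
    have tm: "t_el l i k \<otimes>\<^bsub>F_alg l\<^esub> minor_set l J K \<in> F_deg l (wt i + wts J) (wt k + wts K)" for i k J K
      by (rule F_deg_mult[OF F_deg_t_el minor_set_deg])
    have q: "?q k K \<in> F_deg l (wt k + wts K) (wt j + sum_list (map wt js))" for k K
      by (rule F_deg_mult[OF F_deg_t_el minor_deg])
    have p: "?p i k K \<in> F_deg l (wts I) (wt k + wts K)" if "i \<in> I" for i k K
      using F_deg_mu_mult(1)[OF tm[of i k "I - {i}" K], of "w_factor l i (I - {i})"] that by (simp add: wts_remove)
    note pq = FF_carrier[OF p q]
    have 1: "\<Delta> (mu_l l (w_factor l i (I - {i})) \<otimes>\<^bsub>F_alg l\<^esub> (t_el l i j \<otimes>\<^bsub>F_alg l\<^esub> minor l (I - {i}) js)) =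
      (\<Oplus>\<^bsub>FF l\<^esub>k\<in>UNIV. \<Oplus>\<^bsub>FF l\<^esub>K\<in>UNIV. tensor_FF l (?p i k K) (?q k K))" if i: "i \<in> I" for i
    proof -
      let ?c = "tensor_FF l (mu_l l (w_factor l i (I - {i}))) \<one>\<^bsub>F_alg l\<^esub>"
      note c = FF_carrier[OF F_deg_mu(1) F_deg_one]
      have "\<Delta> (mu_l l (w_factor l i (I - {i})) \<otimes>\<^bsub>F_alg l\<^esub> (t_el l i j \<otimes>\<^bsub>F_alg l\<^esub> minor l (I - {i}) js)) =
        ?c \<otimes>\<^bsub>FF l\<^esub> (\<Delta> (t_el l i j) \<otimes>\<^bsub>FF l\<^esub> \<Delta> (minor l (I - {i}) js))"
        by (simp add: ring_hom_mult[OF hom] mu)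
      also have "\<Delta> (t_el l i j) \<otimes>\<^bsub>FF l\<^esub> \<Delta> (minor l (I - {i}) js) = (\<Oplus>\<^bsub>FF l\<^esub>k\<in>UNIV. \<Oplus>\<^bsub>FF l\<^esub>K\<in>UNIV.
        tensor_FF l (t_el l i k) (t_el l k j) \<otimes>\<^bsub>FF l\<^esub> tensor_FF l (minor_set l (I - {i}) K) (minor l K js))"
        unfolding t Cons by (rule FF.finsum_product) (auto intro: FF_carrier[OF F_deg_t_el F_deg_t_el])
      also have "?c \<otimes>\<^bsub>FF l\<^esub> \<dots> = (\<Oplus>\<^bsub>FF l\<^esub>k\<in>UNIV. \<Oplus>\<^bsub>FF l\<^esub>K\<in>UNIV. ?c \<otimes>\<^bsub>FF l\<^esub>
        (tensor_FF l (t_el l i k) (t_el l k j) \<otimes>\<^bsub>FF l\<^esub> tensor_FF l (minor_set l (I - {i}) K) (minor l K js)))"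
        by (rule FF.finsum_finsum_rdistr) (auto intro!: c FF.m_closed FF_carrier[OF F_deg_t_el F_deg_t_el])
      also have "\<dots> = (\<Oplus>\<^bsub>FF l\<^esub>k\<in>UNIV. \<Oplus>\<^bsub>FF l\<^esub>K\<in>UNIV. tensor_FF l (?p i k K) (?q k K))"
        by (simp add: FF_mult[OF F_deg_t_el F_deg_t_el minor_set_deg minor_deg]
            FF_mult[OF F_deg_mu(1) F_deg_one tm q])
      finally show ?thesis .
    qed
    \<comment> \<open>After sorting, the factor stands as \<open>mu_r\<close> on the left tensor
      factor; balancing hands it over as \<open>mu_l\<close> to the right one, where it is the
      coefficient belonging to row k.\<close>
    have 2: "(\<Oplus>\<^bsub>FF l\<^esub>i\<in>I. tensor_FF l (?p i k K) (?q k K)) =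
      (if k \<in> K then \<zero>\<^bsub>FF l\<^esub> else
        tensor_FF l (minor_set l I (insert k K)) (mu_l l (w_factor l k K) \<otimes>\<^bsub>F_alg l\<^esub> ?q k K))" for k K
    proof -
      have "(\<Oplus>\<^bsub>FF l\<^esub>i\<in>I. tensor_FF l (?p i k K) (?q k K)) = tensor_FF l (minor l I (k # sorted_list_of_set K)) (?q k K)"
        by (simp add: FF_finsum_left[OF q p])
      also have "\<dots> = (if k \<in> K then \<zero>\<^bsub>FF l\<^esub> else
        tensor_FF l (minor_set l I (insert k K)) (mu_l l (w_factor l k K) \<otimes>\<^bsub>F_alg l\<^esub> ?q k K))"
      proof (cases "k \<in> K")
        case False
        then have "wts (insert k K) = wt k + wts K" using wts_remove[of k "insert k K"] by simp
        then have "?q k K \<in> F_deg l (wts (insert k K)) (wt j + sum_list (map wt js))" using q by simp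
        from FF_balance[OF minor_set_deg this, of "w_factor l k K" I] False show ?thesis
          by (simp add: minor_Cons_set del: minor.simps sorted_list_of_set_insert_remove)
      qed (simp add: minor_Cons_set FF_zero_left[OF q] del: minor.simps)
      finally show ?thesis .
    qed
    \<comment> \<open>With K - {k} in place of K, these are the summands of the recursion for
      \<open>minor l K (j # js)\<close>.\<close>
    let ?r = "\<lambda>k K. mu_l l (w_factor l k (K - {k})) \<otimes>\<^bsub>F_alg l\<^esub> ?q k (K - {k})"
    have r: "?r k K \<in> F_deg l (wts K) (wt j + sum_list (map wt js))" if "k \<in> K" for k K
      using F_deg_mu_mult(1)[OF q[of k "K - {k}"], of "w_factor l k (K - {k})"] that by (simp add: wts_remove)
    have r': "mu_l l (w_factor l k K) \<otimes>\<^bsub>F_alg l\<^esub> ?q k K \<in> F_deg l (wts (insert k K)) (wt j + sum_list (map wt js))" if "k \<notin> K" for k K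
      using r[of k "insert k K"] that by simp
    have "\<Delta> (minor l I (j # js)) = (\<Oplus>\<^bsub>FF l\<^esub>i\<in>I. \<Oplus>\<^bsub>FF l\<^esub>k\<in>UNIV. \<Oplus>\<^bsub>FF l\<^esub>K\<in>UNIV. tensor_FF l (?p i k K) (?q k K))"
      using pq by (simp add: ring_hom_finsum[OF F_ring FF_ring hom]) (intro FF.finsum_cong', auto simp: 1 intro!: FF.finsum_closed)
    \<comment> \<open>Only the left factors depend on i, so the sum over i is brought to the inside
      in two interchanges.\<close>
    also have "\<dots> = (\<Oplus>\<^bsub>FF l\<^esub>k\<in>UNIV. \<Oplus>\<^bsub>FF l\<^esub>i\<in>I. \<Oplus>\<^bsub>FF l\<^esub>K\<in>UNIV. tensor_FF l (?p i k K) (?q k K))"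
      using pq by (intro FF.finsum_swap) (auto intro!: FF.finsum_closed)
    also have "\<dots> = (\<Oplus>\<^bsub>FF l\<^esub>k\<in>UNIV. \<Oplus>\<^bsub>FF l\<^esub>K\<in>UNIV. \<Oplus>\<^bsub>FF l\<^esub>i\<in>I. tensor_FF l (?p i k K) (?q k K))"
      using pq by (intro FF.finsum_cong' refl FF.finsum_swap) (auto intro!: FF.finsum_closed)
    also have "\<dots> = (\<Oplus>\<^bsub>FF l\<^esub>K\<in>UNIV. \<Oplus>\<^bsub>FF l\<^esub>k\<in>K. tensor_FF l (minor_set l I (insert k (K - {k}))) (?r k K))"
      unfolding 2 by (rule FF.finsum_insert_remove) (rule FF_carrier[OF minor_set_deg r'])
    also have "\<dots> = (\<Oplus>\<^bsub>FF l\<^esub>K\<in>UNIV. tensor_FF l (minor_set l I K) (minor l K (j # js)))"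
    proof (rule FF.finsum_cong')
      fix K :: "'n set"
      have "tensor_FF l (minor_set l I K) (minor l K (j # js)) = (\<Oplus>\<^bsub>FF l\<^esub>k\<in>K. tensor_FF l (minor_set l I K) (?r k K))"
        unfolding minor.simps by (rule FF_finsum_right[OF minor_set_deg r])
      also have "\<dots> = (\<Oplus>\<^bsub>FF l\<^esub>k\<in>K. tensor_FF l (minor_set l I (insert k (K - {k}))) (?r k K))"
        using FF_carrier[OF minor_set_deg r]
        by (intro FF.finsum_cong') (auto simp: insert_absorb simp del: sorted_list_of_set_insert_remove)
      finally show "(\<Oplus>\<^bsub>FF l\<^esub>k\<in>K. tensor_FF l (minor_set l I (insert k (K - {k}))) (?r k K)) =
        tensor_FF l (minor_set l I K) (minor l K (j # js))" ..
    qed (auto simp del: minor.simps)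
    finally show ?case .
  qed
qed

text \<open>\<open>is_matrix_elements\<close> merely characterizes \<xi>; comparing coefficients of
  R(w_J) at the w_I leaves the minors as the only possibility.\<close>

lemma matrix_elements_minor:
  assumes "is_matrix_elements l R \<xi>"
  shows "\<xi> I J = minor_set l I J"
proof (cases "card I = card J")
  case True
  \<comment> \<open>Padding by zero extends the sum over sets of one cardinality to all subsets, the
    form in which coefficients are compared.\<close>
  let ?x = "\<lambda>I. if card I = card J then \<xi> I J else \<zero>\<^bsub>F_alg l\<^esub>"
  have x: "\<exists>\<beta>. ?x K \<in> F_deg l (wts K) \<beta>" for K
    using assms F_deg_zero unfolding is_matrix_elements_def by auto
  have "(\<Oplus>\<^bsub>WF l\<^esub>K\<in>UNIV. tensor_WF l (w_set l K) (?x K)) = (\<Oplus>\<^bsub>WF l\<^esub>K\<in>{K. card K = card J}. tensor_WF l (w_set l K) (\<xi> K J))"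
    using x by (intro WF.add.finprod_mono_neutral_cong_right)
      (auto simp: WF_zero_right[OF w_set_deg] intro: WF_carrier[OF w_set_deg])
  also have "\<dots> = R (w_set l J)" using assms unfolding is_matrix_elements_def by simp
  also have "\<dots> = (\<Oplus>\<^bsub>WF l\<^esub>K\<in>UNIV. tensor_WF l (w_set l K) (minor_set l K J))" by (rule R_w_set)
  finally have "?x I = minor_set l I J"
    by (rule w_set_independent) (use x minor_deg in blast)+
  then show ?thesis using True by simp
next
  case False
  then show ?thesis using assms unfolding is_matrix_elements_def by (simp add: minor_length)
qed

text \<open>The coefficient of w_I in R(w_J) is a minor and vanishes unless #I = #J, while function
  coefficients only multiply it by \<open>mu_r f\<close>. Hence a spanning element of length r is
  sent to a sum of tensors whose left factors have length r.\<close>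

lemma R_W_sub: "R ` W_sub l r \<subseteq> WF_sub l r"
proof -
  let ?G = "{tensor_WF l v (a :: 'n F) | v a \<alpha> \<beta>. v \<in> W_sub l r \<inter> W_deg l () \<alpha> \<and> a \<in> F_deg l \<alpha> \<beta>}"
  have G: "?G \<subseteq> carrier (WF l)" by (auto intro: WF_carrier)
  then have sub: "subgroup (WF_sub l r) (add_monoid (WF l :: ('n W \<times> 'n F \<Rightarrow>\<^sub>0 complex) set ring))"
    unfolding WF_sub_def by (intro WF.add.generate_is_subgroup) simp
  have sum: "(\<Oplus>\<^bsub>WF l\<^esub>i\<in>S. f i) \<in> WF_sub l r" if "\<And>i. i \<in> S \<Longrightarrow> f i \<in> WF_sub l r" for S :: "'n set set" and f :: "'n set \<Rightarrow> ('n W \<times> 'n F \<Rightarrow>\<^sub>0 complex) set"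
    using finite[of S] that
  proof (induction S rule: finite_induct)
    case empty
    then show ?case using subgroup.one_closed[OF sub] by simp
  next
    case (insert i S)
    then have "f \<in> insert i S \<rightarrow> carrier (WF l)" using subgroup.subset[OF sub] by auto
    moreover have "f i \<oplus>\<^bsub>WF l\<^esub> finsum (WF l) f S \<in> WF_sub l r"
      using subgroup.m_closed[OF sub, of "f i" "finsum (WF l) f S"] insert by simp
    ultimately show ?case using insert(1,2) by (simp add: Pi_def)
  qed
  have w: "w_set l K \<in> W_sub l r" if K: "card K = r" for K :: "'n set"
  proof -
    have "(\<Oplus>\<^bsub>W_alg l\<^esub>I\<in>{I. card I = r}. mu_W l (if K = I then 1 else 0) \<otimes>\<^bsub>W_alg l\<^esub> w_set l I) =
      (\<Oplus>\<^bsub>W_alg l\<^esub>I\<in>{I. card I = r}. if K = I then w_set l I else \<zero>\<^bsub>W_alg l\<^esub>)"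
      by (intro W.finsum_cong') (auto simp: mu_W_1 mu_W_0)
    also have "\<dots> = w_set l K" using K by (intro W.finsum_singleton) auto
    finally show ?thesis
      unfolding W_sub_def by (intro range_eqI[where x = "\<lambda>I. if K = I then 1 else 0"]) (rule sym)
  qed
  have "R (mu_W l f \<otimes>\<^bsub>W_alg l\<^esub> w_set l J) \<in> WF_sub l r" if J: "card J = r" for f J
    unfolding R_mu_W_w_set
  proof (rule sum)
    fix I :: "'n set"
    show "tensor_WF l (w_set l I) (mu_r l f \<otimes>\<^bsub>F_alg l\<^esub> minor_set l I J) \<in> WF_sub l r"
    proof (cases "card I = r")
      case True
      have "tensor_WF l (w_set l I) (mu_r l f \<otimes>\<^bsub>F_alg l\<^esub> minor_set l I J) \<in> ?G"
        by (rule CollectI, intro exI, intro conjI IntI)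
          (rule refl w[OF True] w_set_deg F_deg_mu_mult(2)[OF minor_set_deg])+
      then show ?thesis unfolding WF_sub_def by (rule generate.incl)
    next
      case False
      then show ?thesis using J subgroup.one_closed[OF sub] by (simp add: minor_length WF_zero_right[OF w_set_deg])
    qed
  qed
  then have "(\<Oplus>\<^bsub>WF l\<^esub>I\<in>{I. card I = r}. R (mu_W l (c I) \<otimes>\<^bsub>W_alg l\<^esub> w_set l I)) \<in> WF_sub l r" for c
    by (intro sum) simp
  then show ?thesis
    unfolding W_sub_def by (auto simp: ring_hom_finsum[OF W_ring WF_ring R_hom])
qed

end

text \<open>\<epsilon> kills \<open>t_el l i j\<close> off the diagonal, so the recursion retains
  only the row i = j. In an increasing word j is smaller than all later columns, so its factor is 1,
  and the shifts by single weights compose to the shift by \<open>- wts I\<close>.\<close>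

lemma counit_minor:
  assumes "is_counit l \<epsilon>" and "sorted_wrt (<) js"
  shows "\<epsilon> (minor l I js) = (if I = set js then mshift (- wts I) else (\<lambda>_. 0))"
proof -
  have hom: "\<epsilon> \<in> ring_hom (F_alg l) D_alg"
    and t: "\<And>i j. \<epsilon> (t_el l i j) = (if i = j then mshift (- wt i) else (\<lambda>_. 0))"
    and mu: "\<And>f. \<epsilon> (mu_l l f) = (*) f"
    using assms(1) unfolding is_counit_def by (auto simp: D_alg_def)
  \<comment> \<open>The zero of F is the value of \<open>mu_l\<close> at the zero function, where
    \<epsilon> is prescribed.\<close>
  have zero: "\<epsilon> \<zero>\<^bsub>F_alg l\<^esub> = (\<lambda>_. 0)" using mu[of 0] by (simp add: mu_0 fun_eq_iff)
  have one: "\<epsilon> \<one>\<^bsub>F_alg l\<^esub> = id" using ring_hom_one[OF hom] by (simp add: D_alg_def)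
  have mult: "\<epsilon> (a \<otimes>\<^bsub>F_alg l\<^esub> b) u = \<epsilon> a (\<epsilon> b u)" if "a \<in> carrier (F_alg l)" "b \<in> carrier (F_alg l)" for a b u
    using ring_hom_mult[OF hom that] by (simp add: D_alg_def)
  have add: "\<epsilon> (a \<oplus>\<^bsub>F_alg l\<^esub> b) u = \<epsilon> a u + \<epsilon> b u" if "a \<in> carrier (F_alg l)" "b \<in> carrier (F_alg l)" for a b u
    using ring_hom_add[OF hom that] by (simp add: D_alg_def)
  have sum: "\<epsilon> (\<Oplus>\<^bsub>F_alg l\<^esub>i\<in>S. f i) u = (\<Sum>i\<in>S. \<epsilon> (f i) u)" if "\<And>i. f i \<in> carrier (F_alg l)" for S f u
    using that by (induction S rule: infinite_finite_induct) (auto simp: zero add)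
  show ?thesis
    using assms(2)
  proof (induction js arbitrary: I)
    case Nil
    then show ?case by (auto simp: one zero wts_def fun_eq_iff)
  next
    case (Cons j js)
    have j: "w_factor l j (set js) = 1" "j \<notin> set js" using Cons.prems by (auto intro!: w_factor_eq_1)
    show ?case
    proof
      fix u
      have "\<epsilon> (minor l I (j # js)) u = (\<Sum>i\<in>I. w_factor l i (I - {i}) *
          \<epsilon> (t_el l i j) (if I - {i} = set js then mshift (- wts (I - {i})) u else 0))"
        using Cons by (simp add: sum mult mu if_distrib[of "\<lambda>f. f u"] cong: if_cong)
      also have "\<dots> = (\<Sum>i\<in>I. if i = j then (if I - {j} = set js then mshift (- wt j) (mshift (- wts (I - {j})) u) else 0) else 0)"
        by (rule sum.cong) (auto simp: t j)
      also have "\<dots> = (if j \<in> I \<and> I - {j} = set js then mshift (- wt j) (mshift (- wts (I - {j})) u) else 0)"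
        by simp
      also have "\<dots> = (if I = set (j # js) then mshift (- wts I) else (\<lambda>_. 0)) u"
      proof (cases "I = set (j # js)")
        case True
        then have "- wt j + - wts (I - {j}) = - wts I" using wts_remove[of j I] by (simp add: algebra_simps)
        then show ?thesis using True j by simp
      next
        case False
        then show ?thesis by auto
      qed
      finally show "\<epsilon> (minor l I (j # js)) u = (if I = set (j # js) then mshift (- wts I) else (\<lambda>_. 0)) u" .
    qed
  qed
qed

theorem corollary3p8:
  fixes q logq :: complex
    and \<Delta> :: "'n::{finite,linorder} F \<Rightarrow> ('n F \<times> 'n F \<Rightarrow>\<^sub>0 complex) set"
    and \<epsilon> :: "'n F \<Rightarrow> 'n mero \<Rightarrow> 'n mero"
    and R :: "'n W \<Rightarrow> ('n W \<times> 'n F \<Rightarrow>\<^sub>0 complex) set"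
    and \<xi> :: "'n set \<Rightarrow> 'n set \<Rightarrow> 'n F"
  assumes "exp logq = q"
    and "\<forall>m::nat. m > 0 \<longrightarrow> q ^ m \<noteq> 1"
    and "is_comultiplication logq \<Delta>"
    and "is_counit logq \<epsilon>"
    and "is_coaction logq R"
    and "is_matrix_elements logq R \<xi>"
  shows "(\<forall>I J. card I = card J \<longrightarrow>
            \<Delta> (\<xi> I J) = (\<Oplus>\<^bsub>FF logq\<^esub>K\<in>{K. card K = card I}. tensor_FF logq (\<xi> I K) (\<xi> K J)) \<and>
            \<epsilon> (\<xi> I J) = (if I = J then mshift (- wts I) else \<zero>\<^bsub>D_alg\<^esub>)) \<and>
         (\<forall>r\<le>CARD('n). R ` W_sub logq r \<subseteq> WF_sub logq r)"
proof (intro conjI allI impI)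
  interpret coaction logq R by unfold_locales fact
  have \<xi>: "\<xi> I J = minor_set logq I J" for I J using assms(6) by (rule matrix_elements_minor)
  show "R ` W_sub logq r \<subseteq> WF_sub logq r" for r by (rule R_W_sub)
  fix I J :: "'n set" assume "card I = card J"
  have "\<Delta> (\<xi> I J) = (\<Oplus>\<^bsub>FF logq\<^esub>K\<in>UNIV. tensor_FF logq (\<xi> I K) (\<xi> K J))"
    unfolding \<xi> using assms(3) by (rule comultiplication_minor)
  \<comment> \<open>For #K different from #I the left tensor factor is zero.\<close>
  also have "\<dots> = (\<Oplus>\<^bsub>FF logq\<^esub>K\<in>{K. card K = card I}. tensor_FF logq (\<xi> I K) (\<xi> K J))"
    unfolding \<xi>
    by (intro FF.add.finprod_mono_neutral_cong_right) (auto simp: minor_length FF_zero_left[OF minor_set_deg])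
  finally show "\<Delta> (\<xi> I J) = (\<Oplus>\<^bsub>FF logq\<^esub>K\<in>{K. card K = card I}. tensor_FF logq (\<xi> I K) (\<xi> K J))" .
  show "\<epsilon> (\<xi> I J) = (if I = J then mshift (- wts I) else \<zero>\<^bsub>D_alg\<^esub>)"
    using counit_minor[OF assms(4), of "sorted_list_of_set J" I] by (simp add: \<xi> D_alg_def)
qed

end
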